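(* Let $G(z)$ be a discrete-time transfer function with minimal realization $(A,b,c)$, $A\in\mathbb{R}^{n\times n}$, $b,c^{\mathsf T}\in\mathbb{R}^n$, and let $1\le k\le n$. Then $G(z)$ has a minimal internally Hankel $k$-positive realization if and only if there exist a matrix $P\in\mathbb{R}^{n\times n}$ with $\mathrm{rank}(P)=n$ and a $k$-positive matrix $N\in\mathbb{R}^{n\times n}$ such that $AP=PN$ and, for all $1\le j\le k$, $$\mathcal{C}^j(A,b)_{[j]}\in\mathrm{cone}(P_{[j]}),\qquad \big(\mathcal{O}^j(A,c)_{[j]}\big)^{\mathsf T}\in\mathrm{cone}(P_{[j]})^{*}.$$
   Context: A triple $(A,b,c)$ is a realization of $G(z)$ if $A$ is stable (all eigenvalues in the open unit disc) and $G(z)=c(zI-A)^{-1}b$; it describes $x(t+1)=Ax(t)+bu(t)$, $y(t)=cx(t)$. It is minimal if the eigenvalues of $A$ (with multiplicity) are precisely the poles of $G(z)$. Compounds: for $X\in\mathbb{R}^{n\times m}$ and $r\le\min\{n,m\}$, $X_{[r]}\in\mathbb{R}^{\binom nr\times\binom mr}$ is the matrix of all $r\times r$ minors $\det(X_{I,J})$, with the $r$-element index sets ordered lexicographically. $X$ is $k$-positive if $X_{[j]}\ge0$ entrywise for all $1\le j\le k$. $\mathcal{C}^j(A,b)=\begin{pmatrix} b & Ab&\cdots&A^{j-1}b\end{pmatrix}$, and $\mathcal{O}^j(A,c)=\mathcal{C}^j(A^{\mathsf T},c^{\mathsf T})^{\mathsf T}$ has rows $c,cA,\dots,cA^{j-1}$.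 For a matrix $M$ with $q$ columns, $\mathrm{cone}(M)=\{Mx: x\in\mathbb{R}^q,\ x\ge 0\}$; for a cone $\mathcal{K}$, $\mathcal{K}^*=\{y: y^{\mathsf T}x\ge0\ \text{for all } x\in\mathcal{K}\}$ is the dual cone. Variation: for a real vector or sequence $u$, $S(u)$ is the number of sign changes in $u$ after deleting all zero entries, with $S(0)=0$. A linear map $X$ is order-preserving $m$-variation diminishing ($\mathrm{OVD}_m$), $m\ge 0$, if for all $u$ with $S(u)\le m$: (1) $S(Xu)\le S(u)$; and (2) whenever $S(Xu)=S(u)$, the signs of the first nonzero elements of $u$ and $Xu$ coincide (void if $u$ or $Xu$ is zero). Operators: $\mathcal{C}(A,b)u=\sum_{t=-\infty}^{-1}A^{-t-1}b\,u(t)$ for bounded $u$, where the past input is ordered as the sequence $(u(-1),u(-2),u(-3),\dots)$; and $(\mathcal{O}(A,c)x_0)(t)=cA^tx_0$ for $x_0\in\mathbb{R}^n$, $t=0,1,2,\dots$. $(A,b,c)$ is internally Hankel $k$-positive ($k\ge1$) if the linear maps $A$, $\mathcal{C}(A,b)$ and $\mathcal{O}(A,c)$ are all $\mathrm{OVD}_{k-1}$. *)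

theory Defs
  imports
    "HOL-Complex_Analysis.Complex_Singularities"
    "HOL-Library.Extended_Nat"
    "Jordan_Normal_Form.Char_Poly"
    "Jordan_Normal_Form.DL_Rank"
    "Jordan_Normal_Form.DL_Submatrix"
begin

text \<open>Both HOL-Analysis and Jordan_Normal_Form provide vectors, matrices and determinants. Only the
  dimension-as-argument versions of Jordan_Normal_Form are used here, with qualified names where
  needed. A row vector $c$ is represented by the vector $c^T$.\<close>

unbundle no inner_syntax and no vec_syntax

section \<open>Transfer functions and minimal realizations\<close>

abbreviation cmat :: "real Matrix.mat \<Rightarrow> complex Matrix.mat" where
  "cmat \<equiv> map_mat complex_of_real"

abbreviation cvec :: "real Matrix.vec \<Rightarrow> complex Matrix.vec" where
  "cvec \<equiv> map_vec complex_of_real"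

definition stable :: "real Matrix.mat \<Rightarrow> bool" where
  "stable A \<longleftrightarrow> (\<forall>l. eigenvalue (cmat A) l \<longrightarrow> cmod l < 1)"

text \<open>The value of $c(zI-A)^{-1}b$; meaningful for $z$ outside the spectrum of $A$ only.\<close>

definition transfer_value ::
  "real Matrix.mat \<Rightarrow> real Matrix.vec \<Rightarrow> real Matrix.vec \<Rightarrow> complex \<Rightarrow> complex" where
  "transfer_value A b c z =
     scalar_prod (cvec c)
       (the (mat_inverse (z \<cdot>\<^sub>m 1\<^sub>m (dim_row A) - cmat A)) *\<^sub>v cvec b)"

text \<open>Transfer functions are identified off the (finite) spectrum of $A$, so that the
  value which the total function $G$ takes at its poles is irrelevant.\<close>

definition realization ::
  "nat \<Rightarrow> real Matrix.mat \<Rightarrow> real Matrix.vec \<Rightarrow> real Matrix.vec \<Rightarrow> (complex \<Rightarrow> complex) \<Rightarrow> bool" where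
  "realization n A b c G \<longleftrightarrow>
     A \<in> carrier_mat n n \<and> b \<in> carrier_vec n \<and> c \<in> carrier_vec n \<and> stable A \<and>
     (\<forall>z. \<not> eigenvalue (cmat A) z \<longrightarrow> G z = transfer_value A b c z)"

definition pole_mult :: "(complex \<Rightarrow> complex) \<Rightarrow> complex \<Rightarrow> nat" where
  "pole_mult G l = (if is_pole G l then nat (- zorder G l) else 0)"

definition minimal_realization ::
  "nat \<Rightarrow> real Matrix.mat \<Rightarrow> real Matrix.vec \<Rightarrow> real Matrix.vec \<Rightarrow> (complex \<Rightarrow> complex) \<Rightarrow> bool" where
  "minimal_realization n A b c G \<longleftrightarrow>
     realization n A b c G \<and> (\<forall>l. Polynomial.order l (char_poly (cmat A)) = pole_mult G l)"

section \<open>Compound matrices and positivity\<close>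

text \<open>\<^const>\<open>subseqs\<close> lists the subsequences starting with the first element before the others, so
  that its restriction to a fixed length is in lexicographic order; see the lemmas below.\<close>

definition lex_subsets :: "nat \<Rightarrow> nat \<Rightarrow> nat list list" where
  "lex_subsets n r = filter (\<lambda>I. length I = r) (subseqs [0..<n])"

definition compound :: "nat \<Rightarrow> real Matrix.mat \<Rightarrow> real Matrix.mat" where
  "compound r X = (let Is = lex_subsets (dim_row X) r; Js = lex_subsets (dim_col X) r in
     Matrix.mat (length Is) (length Js)
       (\<lambda>(i, j). Determinant.det (submatrix X (set (Is ! i)) (set (Js ! j)))))"

definition k_positive :: "nat \<Rightarrow> real Matrix.mat \<Rightarrow> bool" where
  "k_positive k X \<longleftrightarrow> (\<forall>j\<in>{1..k}. \<forall>p < dim_row (compound j X). \<forall>q < dim_col (compound j X).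
     0 \<le> compound j X $$ (p, q))"

lemma length_lex_subsets: "length (lex_subsets n r) = n choose r"
proof -
  have d: "distinct (map set (subseqs [0..<n]))"
    by (rule distinct_set_subseqs) simp
  have "length (lex_subsets n r) = card (set ` set (lex_subsets n r))"
  proof -
    have "distinct (subseqs [0..<n])" and i: "inj_on set (set (subseqs [0..<n]))"
      using d by (auto simp: distinct_map)
    then have "distinct (lex_subsets n r)" "inj_on set (set (lex_subsets n r))"
      by (auto simp: lex_subsets_def inj_on_def)
    then show ?thesis by (simp add: card_image distinct_card)
  qed
  also have "set ` set (lex_subsets n r) = {I. I \<subseteq> {0..<n} \<and> card I = r}"
  proof (intro equalityI subsetI)
    fix I assume "I \<in> set ` set (lex_subsets n r)"
    then obtain xs where x: "xs \<in> set (subseqs [0..<n])" "length xs = r" "I = set xs"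
      by (auto simp: lex_subsets_def)
    then have "distinct xs" "set xs \<in> Pow {0..<n}"
      using subseqs_distinctD[OF x(1)] subseqs_powset[of "[0..<n]"] by auto
    then show "I \<in> {I. I \<subseteq> {0..<n} \<and> card I = r}" using x by (auto simp: distinct_card)
  next
    fix I assume I: "I \<in> {I. I \<subseteq> {0..<n} \<and> card I = r}"
    then have "I \<in> set ` set (subseqs [0..<n])" using subseqs_powset[of "[0..<n]"] by auto
    then obtain xs where x: "xs \<in> set (subseqs [0..<n])" "I = set xs" by auto
    then have "distinct xs" using subseqs_distinctD[OF x(1)] by simp
    then show "I \<in> set ` set (lex_subsets n r)"
      using x I by (auto simp: lex_subsets_def distinct_card)
  qed
  also have "card \<dots> = n choose r" using n_subsets[of "{0..<n}" r] by simp
  finally show ?thesis .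
qed

lemma lex_subsets_lexicographic:
  "sorted_wrt (\<lambda>I J. (I, J) \<in> lexord {(x, y). x < y}) (lex_subsets n r)"
proof -
  have "sorted_wrt (\<lambda>I J. (I, J) \<in> lexord {(x, y). x < y})
      (filter (\<lambda>I. length I = r) (subseqs xs))" if "sorted_wrt (<) xs" for xs :: "nat list"
    using that
  proof (induction xs arbitrary: r)
    case Nil
    then show ?case by simp
  next
    case (Cons x xs)
    let ?R = "\<lambda>I J. (I, J) \<in> lexord {(x::nat, y). x < y}"
    have 1: "sorted_wrt ?R (filter (\<lambda>I. length I = r) (map ((#) x) (subseqs xs)))"
    proof (cases r)
      case 0
      then show ?thesis by (simp add: filter_map o_def)
    next
      case (Suc s)
      then show ?thesis using Cons.IH[of s] Cons.prems
        by (simp add: filter_map o_def sorted_wrt_map)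
    qed
    have 2: "?R (x # I) J" if "J \<in> set (subseqs xs)" "length (x # I) = length J" for I J
    proof (cases J)
      case Nil
      then show ?thesis using that by simp
    next
      case (Cons y J')
      have "set J \<in> Pow (set xs)" using that(1) subseqs_powset[of xs] by blast
      then have "x < y" using Cons Cons.prems by auto
      then show ?thesis using Cons by simp
    qed
    show ?case using 1 2 Cons.IH[of r] Cons.prems
      by (auto simp: Let_def sorted_wrt_append)
  qed
  then show ?thesis by (simp add: lex_subsets_def)
qed

section \<open>Controllability and observability matrices, cones\<close>

definition ctrb :: "nat \<Rightarrow> real Matrix.mat \<Rightarrow> real Matrix.vec \<Rightarrow> real Matrix.mat" where
  "ctrb j A b = mat_of_cols (dim_row A) (map (\<lambda>i. (A ^\<^sub>m i) *\<^sub>v b) [0..<j])"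

definition obsv :: "nat \<Rightarrow> real Matrix.mat \<Rightarrow> real Matrix.vec \<Rightarrow> real Matrix.mat" where
  "obsv j A c = transpose_mat (ctrb j (transpose_mat A) c)"

definition mat_cone :: "real Matrix.mat \<Rightarrow> real Matrix.vec set" where
  "mat_cone M = {M *\<^sub>v x | x. x \<in> carrier_vec (dim_col M) \<and> (\<forall>i < dim_col M. 0 \<le> vec_index x i)}"

definition dual_cone :: "nat \<Rightarrow> real Matrix.vec set \<Rightarrow> real Matrix.vec set" where
  "dual_cone d K = {y \<in> carrier_vec d. \<forall>x\<in>K. 0 \<le> scalar_prod y x}"

section \<open>Variation diminishing maps and internal Hankel positivity\<close>

text \<open>A finite vector is treated as the sequence obtained by appending zeros, which neither affects
  the variation nor the first nonzero element.\<close>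

definition vec_seq :: "real Matrix.vec \<Rightarrow> nat \<Rightarrow> real" where
  "vec_seq v = (\<lambda>i. if i < dim_vec v then vec_index v i else 0)"

text \<open>A sign change after deletion of the zeros is a pair of nonzero entries of opposite signs with
  only zeros between them.\<close>

definition variation :: "(nat \<Rightarrow> real) \<Rightarrow> enat" where
  "variation u =
    (let D = {(i, j). i < j \<and> u i * u j < 0 \<and> (\<forall>l. i < l \<and> l < j \<longrightarrow> u l = 0)} in
     if finite D then enat (card D) else \<infinity>)"

definition first_sign :: "(nat \<Rightarrow> real) \<Rightarrow> real" where
  "first_sign u = sgn (u (LEAST i. u i \<noteq> 0))"

text \<open>The functions \<open>s\<close> and \<open>s'\<close> give the entries of inputs and outputs; \<open>D\<close> is the
  domain of \<open>X\<close>.\<close>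

definition OVD ::
  "nat \<Rightarrow> ('a \<Rightarrow> nat \<Rightarrow> real) \<Rightarrow> ('b \<Rightarrow> nat \<Rightarrow> real) \<Rightarrow> 'a set \<Rightarrow> ('a \<Rightarrow> 'b) \<Rightarrow> bool" where
  "OVD m s s' D X \<longleftrightarrow> (\<forall>u\<in>D. variation (s u) \<le> enat m \<longrightarrow>
     variation (s' (X u)) \<le> variation (s u) \<and>
     (variation (s' (X u)) = variation (s u) \<longrightarrow>
      (\<exists>i. s u i \<noteq> 0) \<longrightarrow> (\<exists>i. s' (X u) i \<noteq> 0) \<longrightarrow> first_sign (s u) = first_sign (s' (X u))))"

text \<open>The past input is given by the sequence $w(s) = u(-1-s)$, so that $t = -1-s$ and the
  sum of $A^{-t-1}b\,u(t)$ over $t \<le> -1$ becomes the sum of $A^s b\,w(s)$ over $s \<ge> 0$. For stable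
  $A$ and bounded input it converges absolutely.\<close>

definition ctrb_op :: "real Matrix.mat \<Rightarrow> real Matrix.vec \<Rightarrow> (nat \<Rightarrow> real) \<Rightarrow> real Matrix.vec" where
  "ctrb_op A b w = Matrix.vec (dim_row A) (\<lambda>i. \<Sum>s. vec_index ((A ^\<^sub>m s) *\<^sub>v b) i * w s)"

definition obsv_op :: "real Matrix.mat \<Rightarrow> real Matrix.vec \<Rightarrow> real Matrix.vec \<Rightarrow> nat \<Rightarrow> real" where
  "obsv_op A c x = (\<lambda>t. scalar_prod c ((A ^\<^sub>m t) *\<^sub>v x))"

definition internally_Hankel_positive ::
  "nat \<Rightarrow> real Matrix.mat \<Rightarrow> real Matrix.vec \<Rightarrow> real Matrix.vec \<Rightarrow> bool" where
  "internally_Hankel_positive k A b c \<longleftrightarrow>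
     OVD (k - 1) vec_seq vec_seq (carrier_vec (dim_row A)) (\<lambda>x. A *\<^sub>v x) \<and>
     OVD (k - 1) (\<lambda>w. w) vec_seq {w. bounded (range w)} (ctrb_op A b) \<and>
     OVD (k - 1) vec_seq (\<lambda>y. y) (carrier_vec (dim_row A)) (obsv_op A c)"

end

theory Submission
  imports Defs "Jordan_Normal_Form.Spectral_Radius"
begin

text \<open>A minimal realization has a nonsingular Hankel matrix of Markov parameters, so any two minimal
  realizations of $G$ are similar, $A P = P N$, and the Cauchy--Binet formula turns the cone conditions
  into nonnegativity of the leading minors of the controllability and observability arrays of the
  realization with state matrix $N$. For any array, order-preserving variation diminution of order
  $k - 1$ is equivalent to nonnegativity of all minors of order at most $k$. It remains to pass from
  the leading minors, on the first $j$ rows $c, cA, \<dots>, cA^{j-1}$, to all minors of the infinite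
  array: $k$-positivity of $A$ propagates the sign to consecutive rows, multiplication by a strictly
  totally positive matrix close to the identity makes the minors on independent consecutive rows
  strictly positive, and Fekete's lemma then covers arbitrary rows. As $A$ may be singular, the rows
  may become dependent, and the lemma has to keep track of their rank.\<close>

section \<open>Variation of real sequences, expressed by finite sign patterns\<close>

section \<open>Sign changes and alternation patterns\<close>

text \<open>Variation is awkward to compare under a map: zeros are deleted, and the sign clause only
  bites when the two variations agree. Finite alternation patterns avoid both, since
  order-preserving diminution becomes a single inclusion of patterns. The perturbation in the Fekete
  argument acts on the right of the orbit array, so it keeps every linear relation between rows, and
  rank data of the unperturbed array stay valid. Rank is measured by the shortest monic relation
  between consecutive rows, because the state matrix carries such a relation to the next row even
  when it is singular. Minimality is a statement about pole orders of \<open>G\<close>; it enters as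
  the absence of common roots of numerator and characteristic polynomial. A kernel vector of the
  Hankel matrix would be a polynomial of degree below \<open>n\<close> that cancels all poles, which
  is why that matrix is nonsingular. Of the two cone conditions, membership in the cone is decoded
  with the compound of the inverse of \<open>P\<close>, membership in the dual cone by testing on
  the columns of the compound of \<open>P\<close>.\<close>

lemma strict_mono_on_lessThanI:
  fixes f :: "nat \<Rightarrow> nat"
  assumes "\<And>a. Suc a < q \<Longrightarrow> f a < f (Suc a)"
  shows "strict_mono_on {..<q} f"
proof (rule strict_mono_onI)
  fix a b assume "a \<in> {..<q}" "b \<in> {..<q}" "a < b"
  then show "f a < f b"
  proof (induction b)
    case (Suc b)
    then have "f b < f (Suc b)" using assms by auto
    then show ?case using Suc by (cases "a = b") auto
  qed simp
qed

text \<open>\<open>q\<close> counts the changes, so a pattern has \<open>q + 1\<close> places, and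
  \<open>s\<close> is its starting sign. Only finitely many strict inequalities at chosen places are
  required, whatever lies between them; so a pattern of a subsequence is a pattern of the
  sequence.\<close>

definition alternates :: "(nat \<Rightarrow> real) \<Rightarrow> nat \<Rightarrow> real \<Rightarrow> bool" where
  "alternates u q s \<longleftrightarrow>
     (\<exists>f. strict_mono_on {..<Suc q} f \<and> (\<forall>a\<le>q. 0 < s * (-1) ^ a * u (f a)))"

lemma alternates_le:
  assumes "alternates u q s" "p \<le> q"
  shows "alternates u p s"
  using assms unfolding alternates_def
  by (meson le_trans lessThan_subset_iff monotone_on_subset Suc_le_mono)

text \<open>Dropping the first place flips the starting sign.\<close>

lemma alternates_Suc:
  assumes "alternates u (Suc q) s"
  shows "alternates u q (- s)"
proof -
  obtain f where f: "strict_mono_on {..<Suc (Suc q)} f"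
      "\<forall>a\<le>Suc q. 0 < s * (-1) ^ a * u (f a)"
    using assms by (auto simp: alternates_def)
  have "strict_mono_on {..<Suc q} (\<lambda>a. f (Suc a))"
    using f(1) by (auto simp: strict_mono_on_def)
  moreover have "0 < - s * (-1) ^ a * u (f (Suc a))" if "a \<le> q" for a
    using f(2)[rule_format, of "Suc a"] that by simp
  ultimately show ?thesis unfolding alternates_def by blast
qed

text \<open>One spare change pays for either starting sign: drop places at the end, or also the
  first one.\<close>

lemma alternates_less:
  assumes "alternates u q t" "p < q" "t = 1 \<or> t = -1" "s = 1 \<or> s = -1"
  shows "alternates u p s"
proof (cases "s = t")
  case True
  then show ?thesis using assms alternates_le by auto
next
  case False
  then have "s = - t" using assms by auto
  moreover have "alternates u (Suc p) t" using assms alternates_le by auto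
  ultimately show ?thesis using alternates_Suc by blast
qed

lemma alternates_comp:
  assumes "alternates (\<lambda>l. u (h l)) q s" "strict_mono h"
  shows "alternates u q s"
proof -
  obtain f where f: "strict_mono_on {..<Suc q} f" "\<forall>a\<le>q. 0 < s * (-1) ^ a * u (h (f a))"
    using assms(1) by (auto simp: alternates_def)
  have "strict_mono_on {..<Suc q} (\<lambda>a. h (f a))"
    using f(1) assms(2) by (auto simp: strict_mono_on_def strict_mono_def)
  then show ?thesis using f(2) unfolding alternates_def by blast
qed

text \<open>Meant for truncations: \<open>v\<close> has the signs of \<open>u\<close> on the support
  of \<open>u\<close> and is arbitrary elsewhere.\<close>

lemma alternates_sgn_cong:
  assumes "alternates u q s" "\<And>l. u l \<noteq> 0 \<Longrightarrow> sgn (v l) = sgn (u l)"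
  shows "alternates v q s"
proof -
  obtain f where f: "strict_mono_on {..<Suc q} f" "\<forall>a\<le>q. 0 < s * (-1) ^ a * u (f a)"
    using assms(1) by (auto simp: alternates_def)
  have "0 < s * (-1) ^ a * v (f a)" if "a \<le> q" for a
  proof -
    have "0 < s * (-1) ^ a * u (f a)" using f(2) that by blast
    then have "sgn (s * (-1) ^ a * u (f a)) = 1" "u (f a) \<noteq> 0" by auto
    then have "sgn (s * (-1) ^ a * v (f a)) = 1"
      using assms(2)[of "f a"] by (simp add: sgn_mult)
    then show ?thesis by (simp add: sgn_1_pos)
  qed
  then show ?thesis using f(1) unfolding alternates_def by blast
qed

section \<open>Variation as the length of the longest alternation pattern\<close>

definition sign_changes :: "(nat \<Rightarrow> real) \<Rightarrow> (nat \<times> nat) set" where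
  "sign_changes u = {(i, j). i < j \<and> u i * u j < 0 \<and> (\<forall>l. i < l \<and> l < j \<longrightarrow> u l = 0)}"

lemma variation_eq:
  "variation u = (if finite (sign_changes u) then enat (card (sign_changes u)) else \<infinity>)"
  by (simp add: variation_def sign_changes_def Let_def)

text \<open>Take \<open>y\<close> as the first place after \<open>i\<close> with sign opposite to
  \<open>u i\<close>, and \<open>x\<close> as the last nonzero place before \<open>y\<close>.
  Minimality of \<open>y\<close> gives \<open>u x\<close> the sign of \<open>u i\<close>.\<close>

lemma sign_change_between:
  assumes "i < j" "u i * u j < 0"
  shows "\<exists>x y. (x, y) \<in> sign_changes u \<and> i \<le> x \<and> y \<le> j"
proof -
  define y where "y = (LEAST y. i < y \<and> u i * u y < 0)"
  have y: "i < y" "u i * u y < 0" "y \<le> j"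
    using LeastI[of "\<lambda>y. i < y \<and> u i * u y < 0" j] Least_le[of "\<lambda>y. i < y \<and> u i * u y < 0" j] assms
    by (auto simp: y_def)
  have ymin: "\<not> u i * u l < 0" if "i < l" "l < y" for l
    using not_less_Least[of l "\<lambda>y. i < y \<and> u i * u y < 0"] that by (auto simp: y_def)
  define x where "x = (GREATEST x. x < y \<and> u x \<noteq> 0)"
  have ui: "i < y \<and> u i \<noteq> 0" using assms y by auto
  have x: "x < y" "u x \<noteq> 0" "i \<le> x"
    using GreatestI_nat[of "\<lambda>x. x < y \<and> u x \<noteq> 0" i y]
      Greatest_le_nat[of "\<lambda>x. x < y \<and> u x \<noteq> 0" i y] ui
    by (auto simp: x_def)
  have xmax: "u l = 0" if "x < l" "l < y" for l
    using Greatest_le_nat[of "\<lambda>x. x < y \<and> u x \<noteq> 0" l y] that by (auto simp: x_def)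
  have "u i * u x > 0"
  proof (cases "x = i")
    case True then show ?thesis using ui by (simp add: zero_less_mult_iff) linarith
  next
    case False
    then have "i < x" using x by auto
    then have "\<not> u i * u x < 0" using ymin x by auto
    then show ?thesis using ui x by (simp add: not_less less_le)
  qed
  then have "u x * u y < 0" using y(2) by (auto simp: zero_less_mult_iff mult_less_0_iff)
  then show ?thesis using x y xmax by (auto simp: sign_changes_def)
qed

text \<open>Each step of the pattern encloses a sign change, and the steps do not overlap, so these
  changes are distinct.\<close>

lemma alternates_imp_variation_ge:
  assumes "alternates u q s"
  shows "enat q \<le> variation u"
proof (cases "finite (sign_changes u)")
  case False then show ?thesis by (simp add: variation_eq)
next
  case True
  obtain f where f: "strict_mono_on {..<Suc q} f" "\<forall>a\<le>q. 0 < s * (-1) ^ a * u (f a)"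
    using assms by (auto simp: alternates_def)
  have "\<exists>p. p \<in> sign_changes u \<and> f a \<le> fst p \<and> snd p \<le> f (Suc a)" if "a < q" for a
  proof -
    have lt: "f a < f (Suc a)" using f(1) that by (auto simp: strict_mono_on_def)
    have "0 < (s * (-1) ^ a * u (f a)) * (s * (-1) ^ Suc a * u (f (Suc a)))"
      using f(2)[rule_format, of a] f(2)[rule_format, of "Suc a"] that
      by (intro mult_pos_pos[of "s * (-1) ^ a * u (f a)"]) simp_all
    also have "\<dots> = - ((s * (-1) ^ a)\<^sup>2 * (u (f a) * u (f (Suc a))))"
      by (simp add: power2_eq_square)
    finally have "u (f a) * u (f (Suc a)) < 0"
      by (smt (verit) mult_nonneg_nonneg zero_le_power2)
    then show ?thesis using sign_change_between[OF lt] by force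
  qed
  then obtain p where p: "\<And>a. a < q \<Longrightarrow> p a \<in> sign_changes u \<and> f a \<le> fst (p a) \<and> snd (p a) \<le> f (Suc a)"
    by metis
  have lt: "fst (p a) < snd (p a)" if "a < q" for a using p[OF that] by (auto simp: sign_changes_def)
  have "fst (p a) < fst (p b)" if "a < b" "b < q" for a b
  proof -
    have "f (Suc a) \<le> f b"
      using f(1) that unfolding strict_mono_on_def by (cases "Suc a = b") (auto simp: less_le)
    then show ?thesis using p[of a] p[of b] lt[of a] that by auto
  qed
  then have "inj_on p {..<q}" by (intro linorder_inj_onI) (auto, metis less_irrefl)
  moreover have "p ` {..<q} \<subseteq> sign_changes u" using p by auto
  ultimately have "q \<le> card (sign_changes u)"
    using card_inj_on_le[of p "{..<q}"] True by auto
  then show ?thesis using True by (simp add: variation_eq)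
qed

text \<open>The set of all changes may be infinite; cutting at a right endpoint attaches a finite
  count to each place.\<close>

definition changes_upto :: "(nat \<Rightarrow> real) \<Rightarrow> nat \<Rightarrow> (nat \<times> nat) set" where
  "changes_upto u x = {p \<in> sign_changes u. snd p \<le> x}"

lemma finite_changes_upto: "finite (changes_upto u x)"
  by (rule finite_subset[of _ "{..x} \<times> {..x}"])
     (auto simp: changes_upto_def sign_changes_def)

lemma first_sign_cases:
  assumes "u i \<noteq> 0"
  shows "first_sign u = 1 \<or> first_sign u = -1"
  using LeastI[of "\<lambda>i. u i \<noteq> 0" i] assms by (auto simp: first_sign_def sgn_if)

text \<open>The claim is strengthened by letting the pattern end exactly at \<open>x\<close>.
  Passing from the preceding nonzero place \<open>y\<close> to \<open>x\<close>, the pattern is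
  extended by \<open>x\<close> if the signs differ; otherwise \<open>x\<close> replaces its last
  place.\<close>

lemma alternation_upto:
  assumes "u x \<noteq> 0"
  shows "\<exists>f. strict_mono_on {..<Suc (card (changes_upto u x))} f \<and>
    (\<forall>a\<le>card (changes_upto u x). 0 < first_sign u * (-1) ^ a * u (f a)) \<and>
    f (card (changes_upto u x)) = x"
  using assms
proof (induction x rule: less_induct)
  case (less x)
  show ?case
  proof (cases "\<exists>y<x. u y \<noteq> 0")
    case False
    then have x: "x = (LEAST i. u i \<noteq> 0)" using less.prems
      by (metis (mono_tags, lifting) LeastI Least_le le_neq_implies_less)
    have "changes_upto u x = {}" using False
      by (auto simp: changes_upto_def sign_changes_def)
    moreover have "0 < first_sign u * u x" using less.prems
      by (auto simp: first_sign_def sgn_if simp flip: x)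
    ultimately show ?thesis
      by (intro exI[of _ "\<lambda>_. x"]) (auto simp: strict_mono_on_def)
  next
    case True
    define y where "y = (GREATEST y. y < x \<and> u y \<noteq> 0)"
    obtain y0 where y0: "y0 < x \<and> u y0 \<noteq> 0" using True by auto
    have y: "y < x" "u y \<noteq> 0"
      using GreatestI_nat[of "\<lambda>y. y < x \<and> u y \<noteq> 0" y0 x] y0 by (auto simp: y_def)
    have ymax: "u l = 0" if "y < l" "l < x" for l
      using Greatest_le_nat[of "\<lambda>y. y < x \<and> u y \<noteq> 0" l x] that by (auto simp: y_def)
    obtain f where f: "strict_mono_on {..<Suc (card (changes_upto u y))} f"
      "\<forall>a\<le>card (changes_upto u y). 0 < first_sign u * (-1) ^ a * u (f a)"
      "f (card (changes_upto u y)) = y"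
      using less.IH[OF y] by auto
    let ?c = "card (changes_upto u y)"
    have fle: "f a \<le> y" if "a \<le> ?c" for a
      using strict_mono_onD[OF f(1), of a ?c] f(3) that by (cases "a = ?c") auto
    have pair: "p = (y, x)" if "p \<in> sign_changes u" "y < snd p" "snd p \<le> x" for p
    proof (cases p)
      case (Pair i j)
      have "i < j" "u i \<noteq> 0" "u j \<noteq> 0" "\<And>l. i < l \<Longrightarrow> l < j \<Longrightarrow> u l = 0"
        using that Pair by (auto simp: sign_changes_def)
      moreover have "j = x" using calculation that ymax[of j] Pair by (cases "j = x") auto
      moreover have "i = y" using calculation y ymax[of i]
        by (metis linorder_neqE_nat)
      ultimately show ?thesis using Pair by simp
    qed
    show ?thesis
    proof (cases "u y * u x < 0")
      case True
      have "(y, x) \<in> sign_changes u" using True y ymax by (auto simp: sign_changes_def)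
      then have "changes_upto u x = insert (y, x) (changes_upto u y)"
        using pair y by (force simp: changes_upto_def not_le)
      moreover have "(y, x) \<notin> changes_upto u y" using y by (auto simp: changes_upto_def)
      ultimately have c: "card (changes_upto u x) = Suc ?c" by (simp add: finite_changes_upto)
      let ?g = "f(Suc ?c := x)"
      have g1: "strict_mono_on {..<Suc (Suc ?c)} ?g"
      proof (rule strict_mono_on_lessThanI)
        fix a assume "Suc a < Suc (Suc ?c)"
        then show "?g a < ?g (Suc a)"
          using f(1) fle[of a] y by (cases "a = ?c") (auto simp: strict_mono_on_def)
      qed
      have g2: "0 < first_sign u * (-1) ^ a * u (?g a)" if "a \<le> Suc ?c" for a
      proof (cases "a = Suc ?c")
        case False then show ?thesis using f(2) that by auto
      next
        case a: True
        have "0 < first_sign u * (-1) ^ ?c * u y" using f(2,3) by force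
        then have "0 < - (first_sign u * (-1) ^ ?c * u x)" using True
          by (auto simp: zero_less_mult_iff mult_less_0_iff)
        then show ?thesis using a by simp
      qed
      show ?thesis unfolding c by (intro exI[of _ ?g] conjI g1 allI impI g2) simp_all
    next
      case False
      then have pos: "u y * u x > 0" using y less.prems by (simp add: not_less less_le)
      have "(y, x) \<notin> sign_changes u" using False by (auto simp: sign_changes_def)
      then have c: "changes_upto u x = changes_upto u y"
        using pair y by (force simp: changes_upto_def not_le)
      let ?g = "f(?c := x)"
      have g1: "strict_mono_on {..<Suc ?c} ?g"
      proof (rule strict_mono_on_lessThanI)
        fix a assume "Suc a < Suc ?c"
        then show "?g a < ?g (Suc a)"
          using f(1) fle[of a] y by (auto simp: strict_mono_on_def)
      qed
      have g2: "0 < first_sign u * (-1) ^ a * u (?g a)" if "a \<le> ?c" for a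
      proof (cases "a = ?c")
        case False then show ?thesis using f(2) that by auto
      next
        case a: True
        have "0 < first_sign u * (-1) ^ ?c * u y" using f(2,3) by force
        then have "0 < first_sign u * (-1) ^ ?c * u x" using pos
          by (auto simp: zero_less_mult_iff)
        then show ?thesis using a by simp
      qed
      show ?thesis unfolding c by (intro exI[of _ ?g] conjI g1 allI impI g2) simp_all
    qed
  qed
qed

text \<open>Infinite variation is covered by choosing \<open>q\<close> of the changes and looking
  only up to their largest right endpoint.\<close>

lemma variation_ge_imp_alternates:
  assumes "u i \<noteq> 0" "enat q \<le> variation u"
  shows "alternates u q (first_sign u)"
proof -
  obtain S where S: "S \<subseteq> sign_changes u" "finite S" "card S = q"
  proof (cases "finite (sign_changes u)")
    case True
    then show ?thesis using assms(2) that obtain_subset_with_card_n[of q "sign_changes u"]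
      by (metis variation_eq enat_ord_simps(1))
  next
    case False
    then show ?thesis using infinite_arbitrarily_large that by metis
  qed
  show ?thesis
  proof (cases "q = 0")
    case True
    have "u (LEAST i. u i \<noteq> 0) \<noteq> 0" using assms(1) by (rule LeastI)
    then have "0 < first_sign u * u (LEAST i. u i \<noteq> 0)"
      by (auto simp: first_sign_def sgn_if)
    then show ?thesis using True unfolding alternates_def
      by (intro exI[of _ "\<lambda>_. LEAST i. u i \<noteq> 0"]) (auto simp: strict_mono_on_def)
  next
    case False
    then have "snd ` S \<noteq> {}" using S by auto
    then have m: "Max (snd ` S) \<in> snd ` S" using S by (intro Max_in) auto
    define x where "x = Max (snd ` S)"
    have "u x \<noteq> 0" using m S by (auto simp: sign_changes_def x_def)
    moreover have "S \<subseteq> changes_upto u x"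
    proof
      fix p assume p: "p \<in> S"
      then have "snd p \<le> x" using S unfolding x_def by (intro Max_ge) auto
      then show "p \<in> changes_upto u x" using p S by (auto simp: changes_upto_def)
    qed
    then have "q \<le> card (changes_upto u x)" using S card_mono finite_changes_upto by blast
    ultimately show ?thesis using alternation_upto[of u x] alternates_le
      unfolding alternates_def[of u "card (changes_upto u x)"]
      by (metis alternates_def)
  qed
qed

text \<open>If the pattern started with the other sign, the first nonzero entry could be put in
  front of it, giving one change too many.\<close>

lemma alternates_first_sign:
  assumes "variation u = enat q" "alternates u q s" "s = 1 \<or> s = -1"
  shows "s = first_sign u"
proof (rule ccontr)
  assume ne: "s \<noteq> first_sign u"
  obtain f where f: "strict_mono_on {..<Suc q} f" "\<forall>a\<le>q. 0 < s * (-1) ^ a * u (f a)"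
    using assms by (auto simp: alternates_def)
  have f0: "0 < s * u (f 0)" using f(2)[rule_format, of 0] by simp
  then have nz: "u (f 0) \<noteq> 0" by auto
  define x where "x = (LEAST i. u i \<noteq> 0)"
  have x: "u x \<noteq> 0" "x \<le> f 0" using LeastI[of "\<lambda>i. u i \<noteq> 0", OF nz] Least_le[of "\<lambda>i. u i \<noteq> 0", OF nz]
    unfolding x_def by auto
  have s: "first_sign u = - s" using first_sign_cases[of u "f 0"] nz ne assms(3) by auto
  have sx: "0 < - s * u x" using x s by (simp add: first_sign_def x_def[symmetric] sgn_if split: if_splits)
  then have "x \<noteq> f 0" using f0 by auto
  then have lt: "x < f 0" using x by auto
  let ?g = "case_nat x f"
  have "strict_mono_on {..<Suc (Suc q)} ?g"
    by (rule strict_mono_on_lessThanI) (use f(1) lt in \<open>auto simp: strict_mono_on_def split: nat.splits\<close>)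
  moreover have "0 < - s * (-1) ^ a * u (?g a)" if "a \<le> Suc q" for a
    using that sx f(2) by (auto split: nat.splits)
  ultimately have "alternates u (Suc q) (- s)" unfolding alternates_def by blast
  from alternates_imp_variation_ge[OF this] assms(1) show False by simp
qed

lemma not_alternates_zero:
  assumes "\<And>i. u i = 0"
  shows "\<not> alternates u q s"
  using assms by (auto simp: alternates_def)

text \<open>For $S(u) = p$ the sequence $u$ alternates $q$ times starting with sign $s$ iff $q < p$, or
  $q = p$ and $s$ is the first sign; so both clauses of the definition of \<^const>\<open>OVD\<close> amount to an
  inclusion of alternation patterns.\<close>

lemma OVD_iff_alternates:
  assumes zero: "\<forall>u\<in>D. (\<forall>i. s u i = 0) \<longrightarrow> (\<forall>i. s' (X u) i = 0)"
  shows "OVD m s s' D X \<longleftrightarrow>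
    (\<forall>u\<in>D. \<not> alternates (s u) (Suc m) 1 \<longrightarrow> \<not> alternates (s u) (Suc m) (-1) \<longrightarrow>
      (\<forall>q \<sigma>. (\<sigma> = 1 \<or> \<sigma> = -1) \<longrightarrow> alternates (s' (X u)) q \<sigma> \<longrightarrow> alternates (s u) q \<sigma>))"
proof -
  have le: "variation v \<le> enat m \<longleftrightarrow> \<not> alternates v (Suc m) 1 \<and> \<not> alternates v (Suc m) (-1)" for v
  proof
    assume "variation v \<le> enat m"
    then show "\<not> alternates v (Suc m) 1 \<and> \<not> alternates v (Suc m) (-1)"
      using alternates_imp_variation_ge[of v "Suc m"] order_trans[of "enat (Suc m)" "variation v" "enat m"]
      by auto
  next
    assume a: "\<not> alternates v (Suc m) 1 \<and> \<not> alternates v (Suc m) (-1)"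
    show "variation v \<le> enat m"
    proof (rule ccontr)
      assume "\<not> variation v \<le> enat m"
      then have g: "enat (Suc m) \<le> variation v" by (simp add: Suc_ile_eq not_le)
      have "sign_changes v \<noteq> {}"
        using g by (auto simp: variation_eq)
      then obtain i where "v i \<noteq> 0" by (force simp: sign_changes_def)
      from variation_ge_imp_alternates[OF this g] first_sign_cases[of v i] a \<open>v i \<noteq> 0\<close>
      show False by auto
    qed
  qed
  let ?P = "\<lambda>u. variation (s' (X u)) \<le> variation (s u) \<and>
     (variation (s' (X u)) = variation (s u) \<longrightarrow>
      (\<exists>i. s u i \<noteq> 0) \<longrightarrow> (\<exists>i. s' (X u) i \<noteq> 0) \<longrightarrow> first_sign (s u) = first_sign (s' (X u)))"
  let ?Q = "\<lambda>u. (\<forall>q \<sigma>. (\<sigma> = 1 \<or> \<sigma> = -1) \<longrightarrow> alternates (s' (X u)) q \<sigma> \<longrightarrow> alternates (s u) q \<sigma>)"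
  have "?P u \<longleftrightarrow> ?Q u"
    (is "?L \<longleftrightarrow> ?R") if u: "u \<in> D" and fin: "variation (s u) \<le> enat m" for u
  proof -
    let ?u = "s u" and ?v = "s' (X u)"
    obtain p where p: "variation ?u = enat p" using fin by (cases "variation ?u") auto
    show ?thesis
    proof
      assume L: ?L
      show ?R
      proof (intro allI impI)
        fix q \<sigma> assume \<sigma>: "\<sigma> = (1::real) \<or> \<sigma> = -1" and a: "alternates ?v q \<sigma>"
        have "\<exists>i. ?v i \<noteq> 0" using a not_alternates_zero by blast
        \<comment> \<open>This is where \<open>zero\<close> enters: a zero input with nonzero output
          of variation 0 would satisfy both clauses, the sign clause being void, and yet the output
          has a pattern that the input lacks.\<close>
        then have nz: "\<exists>i. ?v i \<noteq> 0" "\<exists>i. ?u i \<noteq> 0" using zero u by blast+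
        then obtain i where i: "?u i \<noteq> 0" by blast
        have qp: "q \<le> p" using alternates_imp_variation_ge[OF a] L p
          by (metis enat_ord_simps(1) order_trans)
        show "alternates ?u q \<sigma>"
        proof (cases "q < p")
          case True
          have "alternates ?u p (first_sign ?u)" using variation_ge_imp_alternates[of ?u i p] i p by simp
          then show ?thesis using alternates_less True first_sign_cases[of ?u i] i \<sigma> by blast
        next
          case False
          then have q: "q = p" using qp by simp
          have "variation ?v = enat p" using alternates_imp_variation_ge[OF a] L p q
            by (metis order_antisym)
          then have "first_sign ?u = first_sign ?v" "first_sign ?v = \<sigma>"
            using L nz p alternates_first_sign[of ?v p \<sigma>] a \<sigma> q by auto
          then show ?thesis using variation_ge_imp_alternates[of ?u i p] i p q by simp
        qed
      qed
    next
      assume R: ?R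
      have le: "variation ?v \<le> variation ?u"
      proof (rule ccontr)
        assume "\<not> ?thesis"
        then have g: "enat (Suc p) \<le> variation ?v" using p by (simp add: Suc_ile_eq not_le)
        then have "sign_changes ?v \<noteq> {}" by (auto simp: variation_eq)
        then obtain i where i: "?v i \<noteq> 0" by (force simp: sign_changes_def)
        have "alternates ?u (Suc p) (first_sign ?v)"
          using variation_ge_imp_alternates[of ?v i, OF i g] R first_sign_cases[of ?v i] i by blast
        from alternates_imp_variation_ge[OF this] p show False by simp
      qed
      moreover have "first_sign ?u = first_sign ?v" if "variation ?v = variation ?u" "?v i \<noteq> 0" for i
      proof -
        have "alternates ?v p (first_sign ?v)" using variation_ge_imp_alternates that p by simp
        then have "alternates ?u p (first_sign ?v)" using R first_sign_cases[of ?v i] that by blast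
        then show ?thesis using alternates_first_sign[OF p] first_sign_cases[of ?v i] that by metis
      qed
      ultimately show ?L by blast
    qed
  qed
  note main = this
  show ?thesis
    unfolding OVD_def
  proof (rule ball_cong[OF refl])
    fix u assume u: "u \<in> D"
    show "(variation (s u) \<le> enat m \<longrightarrow> ?P u) \<longleftrightarrow>
      (\<not> alternates (s u) (Suc m) 1 \<longrightarrow> \<not> alternates (s u) (Suc m) (-1) \<longrightarrow> ?Q u)"
    proof (cases "variation (s u) \<le> enat m")
      case True
      then show ?thesis using le[of "s u"] main[OF u True] by satx
    next
      case False
      then show ?thesis using le[of "s u"] by satx
    qed
  qed
qed

section \<open>Determinants and minors of infinite arrays\<close>

text \<open>Entries are a function and the size is an argument, so rows and columns are selected by
  composition with index maps and replaced by \<open>if\<close>, without carrier conditions.\<close>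

definition fdet :: "nat \<Rightarrow> (nat \<Rightarrow> nat \<Rightarrow> 'a::comm_ring_1) \<Rightarrow> 'a" where
  "fdet n M = Determinant.det (Matrix.mat n n (\<lambda>(a, b). M a b))"

lemma fdet_cong:
  assumes "\<And>a b. a < n \<Longrightarrow> b < n \<Longrightarrow> M a b = M' a b"
  shows "fdet n M = fdet n M'"
  unfolding fdet_def using assms by (intro arg_cong[of _ _ Determinant.det]) (auto intro!: eq_matI)

lemma fdet_0 [simp]: "fdet 0 M = 1"
  by (simp add: fdet_def)

lemma fdet_transpose: "fdet n (\<lambda>a b. M b a) = fdet n M"
proof -
  have "transpose_mat (Matrix.mat n n (\<lambda>(a, b). M a b)) = Matrix.mat n n (\<lambda>(a, b). M b a)"
    by (auto intro!: eq_matI)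
  then show ?thesis unfolding fdet_def
    by (metis det_transpose mat_carrier)
qed

text \<open>Column \<open>k\<close> is supplied separately as \<open>y\<close>, so the cofactors
  visibly do not depend on it; linearity and Cramer's rule are read off from this form.\<close>

lemma fdet_expand_col:
  assumes "k < n"
  shows "fdet n (\<lambda>a b. if b = k then y a else M a b) =
    (\<Sum>i<n. y i * ((-1) ^ (i + k) *
      fdet (n - 1) (\<lambda>a b. M (insert_index i a) (insert_index k b))))"
proof -
  let ?A = "Matrix.mat n n (\<lambda>(a, b). if b = k then y a else M a b)"
  have "fdet n (\<lambda>a b. if b = k then y a else M a b) = (\<Sum>i<n. ?A $$ (i, k) * cofactor ?A i k)"
    unfolding fdet_def using assms by (intro laplace_expansion_column) auto
  also have "\<dots> = (\<Sum>i<n. y i * ((-1) ^ (i + k) *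
      fdet (n - 1) (\<lambda>a b. M (insert_index i a) (insert_index k b))))"
  proof (rule sum.cong[OF refl])
    fix i assume "i \<in> {..<n}"
    moreover have "mat_delete ?A i k =
        Matrix.mat (n - 1) (n - 1) (\<lambda>(a, b). M (insert_index i a) (insert_index k b))"
      by (rule eq_matI) (auto simp: mat_delete_def insert_index_def)
    ultimately show "?A $$ (i, k) * cofactor ?A i k = y i * ((-1) ^ (i + k) *
      fdet (n - 1) (\<lambda>a b. M (insert_index i a) (insert_index k b)))"
      using assms by (simp add: cofactor_def fdet_def)
  qed
  finally show ?thesis .
qed

lemma fdet_expand_row:
  assumes "k < n"
  shows "fdet n (\<lambda>a b. if a = k then y b else M a b) =
    (\<Sum>i<n. y i * ((-1) ^ (i + k) *
      fdet (n - 1) (\<lambda>a b. M (insert_index k a) (insert_index i b))))"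
  using fdet_expand_col[OF assms, of y "\<lambda>a b. M b a"]
  unfolding fdet_transpose[of _ "\<lambda>b a. M (insert_index _ b) (insert_index _ a)"]
    fdet_transpose[of _ "\<lambda>b a. if b = k then y a else M b a"] .

lemma fdet_identical_cols:
  assumes "k < n" "l < n" "k \<noteq> l" "\<And>a. a < n \<Longrightarrow> M a k = M a l"
  shows "fdet n M = 0"
  unfolding fdet_def using assms
  by (intro det_identical_cols[of _ n k l]) (auto intro!: eq_vecI)

lemma fdet_identical_rows:
  assumes "k < n" "l < n" "k \<noteq> l" "\<And>b. b < n \<Longrightarrow> M k b = M l b"
  shows "fdet n M = 0"
  using fdet_identical_cols[of k n l "\<lambda>a b. M b a"] assms by (simp add: fdet_transpose[of n M])

lemma fdet_zero_row:
  assumes "k < n" "\<And>b. b < n \<Longrightarrow> M k b = 0"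
  shows "fdet n M = 0"
proof -
  have "fdet n M = fdet n (\<lambda>a b. if a = k then 0 else M a b)"
    by (rule fdet_cong) (use assms in auto)
  then show ?thesis using fdet_expand_row[OF assms(1), of "\<lambda>_. 0" M] by simp
qed

lemma fdet_col_linear:
  assumes "k < n"
  shows "fdet n (\<lambda>a b. if b = k then x a + c * y a else M a b) =
    fdet n (\<lambda>a b. if b = k then x a else M a b) + c * fdet n (\<lambda>a b. if b = k then y a else M a b)"
  unfolding fdet_expand_col[OF assms]
  by (simp add: sum_distrib_left ring_distribs sum.distrib mult.assoc)

text \<open>The division-free Cramer rule: expand \<open>v\<close> into columns of \<open>M\<close>;
  every term but the one for column \<open>k\<close> repeats a column.\<close>

lemma fdet_cramer:
  assumes "k < n" "\<And>a. a < n \<Longrightarrow> v a = (\<Sum>b<n. M a b * x b)"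
  shows "fdet n (\<lambda>a b. if b = k then v a else M a b) = x k * fdet n M"
proof -
  have "fdet n (\<lambda>a b. if b = k then v a else M a b) =
      (\<Sum>i<n. \<Sum>c<n. x c * (M i c * ((-1) ^ (i + k) *
        fdet (n - 1) (\<lambda>a b. M (insert_index i a) (insert_index k b)))))"
    unfolding fdet_expand_col[OF assms(1)]
    by (rule sum.cong) (auto simp: assms(2) sum_distrib_left sum_distrib_right algebra_simps)
  also have "\<dots> = (\<Sum>c<n. x c * fdet n (\<lambda>a b. if b = k then M a c else M a b))"
    unfolding fdet_expand_col[OF assms(1)] by (subst sum.swap) (simp add: sum_distrib_left)
  also have "\<dots> = (\<Sum>c<n. if c = k then x k * fdet n M else 0)"
  proof (rule sum.cong[OF refl])
    fix c assume c: "c \<in> {..<n}"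
    show "x c * fdet n (\<lambda>a b. if b = k then M a c else M a b) = (if c = k then x k * fdet n M else 0)"
    proof (cases "c = k")
      case True
      then show ?thesis by (auto intro!: arg_cong[of _ _ "\<lambda>y. x k * y"] fdet_cong)
    next
      case False
      then have "fdet n (\<lambda>a b. if b = k then M a c else M a b) = 0"
        using c assms(1) by (intro fdet_identical_cols[of k n c]) auto
      then show ?thesis using False by simp
    qed
  qed
  also have "\<dots> = x k * fdet n M" using assms(1) by simp
  finally show ?thesis .
qed

lemma mat_inverse_if_det_nonzero:
  fixes M :: "'a::field Matrix.mat"
  assumes M: "M \<in> carrier_mat n n" and "Determinant.det M \<noteq> 0"
  obtains B where "B \<in> carrier_mat n n" "M * B = 1\<^sub>m n" "B * M = 1\<^sub>m n"
proof -
  have "M \<in> Units (ring_mat TYPE('a) n ())" using assms by (rule det_non_zero_imp_unit)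
  then obtain B where "mat_inverse M = Some B"
    using mat_inverse(1)[OF M, where b = "()"] by (cases "mat_inverse M") auto
  then show ?thesis using mat_inverse(2)[OF M] that by auto
qed

lemma fdet_solve:
  fixes M :: "nat \<Rightarrow> nat \<Rightarrow> 'a::field"
  assumes "fdet n M \<noteq> 0"
  shows "\<exists>x. \<forall>a<n. (\<Sum>b<n. M a b * x b) = v a"
proof -
  let ?A = "Matrix.mat n n (\<lambda>(a, b). M a b)" and ?v = "Matrix.vec n v"
  have A: "?A \<in> carrier_mat n n" by simp
  obtain B where B: "B \<in> carrier_mat n n" "?A * B = 1\<^sub>m n"
    using mat_inverse_if_det_nonzero[OF A] assms unfolding fdet_def by metis
  define y where "y = B *\<^sub>v ?v"
  have y: "y \<in> carrier_vec n" using B(1) by (simp add: y_def)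
  have "?A *\<^sub>v y = ?v"
    using assoc_mult_mat_vec[OF A B(1), of ?v] B(2) by (simp add: y_def)
  have "(\<Sum>b<n. M a b * vec_index y b) = v a" if "a < n" for a
  proof -
    have "vec_index (?A *\<^sub>v y) a = (\<Sum>b<n. M a b * vec_index y b)"
      using that y by (auto simp: scalar_prod_def lessThan_atLeast0)
    then show ?thesis using \<open>?A *\<^sub>v y = ?v\<close> that by simp
  qed
  then show ?thesis by blast
qed

lemma fdet_kernel:
  fixes M :: "nat \<Rightarrow> nat \<Rightarrow> 'a::field"
  assumes "fdet n M = 0"
  shows "\<exists>x. (\<exists>b<n. x b \<noteq> 0) \<and> (\<forall>a<n. (\<Sum>b<n. M a b * x b) = 0)"
proof -
  let ?A = "Matrix.mat n n (\<lambda>(a, b). M a b)"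
  obtain v where v: "v \<in> carrier_vec n" "v \<noteq> 0\<^sub>v n" "?A *\<^sub>v v = 0\<^sub>v n"
    using assms det_0_iff_vec_prod_zero_field[of ?A n] by (auto simp: fdet_def)
  have "\<exists>b<n. vec_index v b \<noteq> 0" using v(1,2) by (metis carrier_vecD eq_vecI index_zero_vec)
  moreover have "(\<Sum>b<n. M a b * vec_index v b) = 0" if "a < n" for a
  proof -
    have "vec_index (?A *\<^sub>v v) a = (\<Sum>b<n. M a b * vec_index v b)"
      using that v(1) by (auto simp: scalar_prod_def lessThan_atLeast0)
    then show ?thesis using v(3) that by simp
  qed
  ultimately show ?thesis by blast
qed

lemma fdet_nonzero_imp_injective:
  fixes M :: "nat \<Rightarrow> nat \<Rightarrow> 'a::field"
  assumes "fdet n M \<noteq> 0" "\<And>a. a < n \<Longrightarrow> (\<Sum>b<n. M a b * x b) = 0" "b < n"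
  shows "x b = 0"
proof -
  have "x b * fdet n M = fdet n (\<lambda>a c. if c = b then 0 else M a c)"
    by (rule fdet_cramer[symmetric]) (use assms in auto)
  also have "\<dots> = 0" using assms(3) by (simp add: fdet_expand_col)
  finally show ?thesis using assms(1) by simp
qed

section \<open>Minors of infinite arrays along increasing index maps\<close>

definition minor :: "(nat \<Rightarrow> nat \<Rightarrow> real) \<Rightarrow> nat \<Rightarrow> (nat \<Rightarrow> nat) \<Rightarrow> (nat \<Rightarrow> nat) \<Rightarrow> real" where
  "minor K j f g = fdet j (\<lambda>a b. K (f a) (g b))"

lemma minor_cong:
  assumes "\<And>a b. a < j \<Longrightarrow> b < j \<Longrightarrow> K (f a) (g b) = K' (f' a) (g' b)"
  shows "minor K j f g = minor K' j f' g'"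
  unfolding minor_def using assms by (rule fdet_cong)

text \<open>Index maps are strictly monotone on all of the naturals; only their first values matter.\<close>

definition minors_nonneg :: "nat \<Rightarrow> (nat \<Rightarrow> nat \<Rightarrow> real) \<Rightarrow> bool" where
  "minors_nonneg m K \<longleftrightarrow>
     (\<forall>j\<le>m. \<forall>f g. strict_mono f \<longrightarrow> strict_mono g \<longrightarrow> 0 \<le> minor K j f g)"

lemma strict_mono_extend:
  fixes f :: "nat \<Rightarrow> nat"
  assumes "strict_mono_on {..<n} f"
  obtains f' where "strict_mono f'" "\<And>a. a < n \<Longrightarrow> f' a = f a"
proof (cases "n = 0")
  case True
  then show ?thesis using that[of id] by (auto simp: strict_mono_def)
next
  case False
  let ?f = "\<lambda>a. if a < n then f a else f (n - 1) + a"
  have "?f a < ?f b" if "a < b" for a b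
  proof -
    have "f a \<le> f (n - 1)" if "a < n"
    proof (cases "a = n - 1")
      case False
      then have "a < n - 1" using that by linarith
      then show ?thesis using strict_mono_onD[OF assms, of a "n - 1"] that by simp
    qed simp
    then show ?thesis using that strict_mono_onD[OF assms, of a b] False by auto
  qed
  then show ?thesis using that[of ?f] by (auto simp: strict_mono_def)
qed

lemma minors_nonnegD:
  assumes "minors_nonneg m K" "j \<le> m" "strict_mono_on {..<j} f" "strict_mono_on {..<j} g"
  shows "0 \<le> minor K j f g"
proof -
  obtain f' g' where "strict_mono f'" "\<And>a. a < j \<Longrightarrow> f' a = f a" "strict_mono g'" "\<And>a. a < j \<Longrightarrow> g' a = g a"
    using strict_mono_extend[OF assms(3)] strict_mono_extend[OF assms(4)] by metis
  moreover from this have "minor K j f g = minor K j f' g'" by (intro minor_cong) auto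
  ultimately show ?thesis using assms(1,2) by (auto simp: minors_nonneg_def)
qed

lemma minors_nonneg_comp:
  assumes "minors_nonneg m K" "strict_mono r" "strict_mono s"
  shows "minors_nonneg m (\<lambda>i l. K (r i) (s l))"
  unfolding minors_nonneg_def
proof (intro allI impI)
  fix j :: nat and f g :: "nat \<Rightarrow> nat"
  assume "j \<le> m" "strict_mono f" "strict_mono g"
  then have "0 \<le> minor K j (r \<circ> f) (s \<circ> g)"
    using assms by (simp add: minors_nonneg_def strict_mono_o)
  then show "0 \<le> minor (\<lambda>i l. K (r i) (s l)) j f g" by (simp add: minor_def)
qed

lemma minors_nonneg_transpose: "minors_nonneg m (\<lambda>i l. K l i) \<longleftrightarrow> minors_nonneg m K"
  unfolding minors_nonneg_def minor_def
  by (subst fdet_transpose) blast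

lemma strict_mono_insert_index: "strict_mono (insert_index i)"
  by (auto simp: strict_mono_def insert_index_def)

lemma alternates_strict_mono:
  "alternates u q s \<longleftrightarrow> (\<exists>f. strict_mono f \<and> (\<forall>a\<le>q. 0 < s * (-1) ^ a * u (f a)))"
proof
  assume "alternates u q s"
  then obtain f where f: "strict_mono_on {..<Suc q} f" "\<forall>a\<le>q. 0 < s * (-1) ^ a * u (f a)"
    by (auto simp: alternates_def)
  from strict_mono_extend[OF f(1)] obtain f' where "strict_mono f'" "\<And>a. a < Suc q \<Longrightarrow> f' a = f a" by blast
  then show "\<exists>f. strict_mono f \<and> (\<forall>a\<le>q. 0 < s * (-1) ^ a * u (f a))"
    using f(2) by (intro exI[of _ f']) auto
next
  assume "\<exists>f. strict_mono f \<and> (\<forall>a\<le>q. 0 < s * (-1) ^ a * u (f a))"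
  then show "alternates u q s"
    unfolding alternates_def by (auto simp: strict_mono_def strict_mono_on_def)
qed

lemma strict_mono_Suc: "strict_mono Suc"
  by (simp add: strict_mono_def)

lemma insert_index_0: "insert_index 0 = Suc"
  by (auto simp: insert_index_def)

text \<open>If \<open>v\<close> alternates in sign, the factors \<open>(-1) ^ i\<close> cancel and
  the right side combines smaller minors with coefficients of one sign. So the sign of
  \<open>x 0\<close> and the sign of the large minor determine each other, given nonnegative smaller
  minors.\<close>

lemma minor_cramer:
  assumes "0 < n" "\<And>a. a < n \<Longrightarrow> v a = (\<Sum>b<n. K (f a) (g b) * x b)"
  shows "x 0 * minor K n f g =
    (\<Sum>i<n. v i * (-1) ^ i * minor K (n - 1) (f \<circ> insert_index i) (g \<circ> Suc))"
proof -
  have "x 0 * minor K n f g = fdet n (\<lambda>a b. if b = 0 then v a else K (f a) (g b))"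
    unfolding minor_def by (rule fdet_cramer[symmetric]) (use assms in auto)
  also have "\<dots> = (\<Sum>i<n. v i * (-1) ^ i * minor K (n - 1) (f \<circ> insert_index i) (g \<circ> Suc))"
    by (subst fdet_expand_col[OF assms(1)]) (simp add: minor_def insert_index_0 mult.assoc)
  finally show ?thesis .
qed

section \<open>Variation diminution and nonnegative minors\<close>

text \<open>Induction on the order of the minor. A nonzero minor allows to prescribe an alternating
  image on the rows \<open>f\<close> by an input supported on the columns \<open>g\<close>. That
  input must alternate with the same starting sign, which makes its first entry positive, and
  Cramer's rule transfers the sign to the minor.\<close>

lemma minors_nonneg_if_alternates:
  assumes "\<And>u N q. (\<And>l. l \<ge> N \<Longrightarrow> u l = 0) \<Longrightarrow>
      \<not> alternates u (Suc m) 1 \<Longrightarrow> \<not> alternates u (Suc m) (-1) \<Longrightarrow>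
      alternates (\<lambda>i. \<Sum>l<N. K i l * u l) q 1 \<Longrightarrow> alternates u q 1"
  shows "minors_nonneg (Suc m) K"
  unfolding minors_nonneg_def
proof (intro allI impI)
  fix j :: nat and f g :: "nat \<Rightarrow> nat"
  assume "j \<le> Suc m" "strict_mono f" "strict_mono g"
  then show "0 \<le> minor K j f g"
  proof (induction j arbitrary: f g)
    case 0 then show ?case by (simp add: minor_def)
  next
    case (Suc j)
    show ?case
    proof (cases "minor K (Suc j) f g = 0")
      case False
      obtain x where x: "\<forall>a<Suc j. (\<Sum>b<Suc j. K (f a) (g b) * x b) = (-1) ^ a"
        using fdet_solve[of "Suc j" "\<lambda>a b. K (f a) (g b)" "\<lambda>a. (-1) ^ a"] False
        unfolding minor_def by blast
      define N where "N = Suc (g j)"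
      have inj: "inj_on g {..<Suc j}" using Suc.prems strict_mono_imp_inj_on inj_on_subset by blast
      have gN: "g ` {..<Suc j} \<subseteq> {..<N}"
        using Suc.prems(3) by (auto simp: N_def less_Suc_eq_le strict_mono_less_eq)
      define u where "u l = (if l \<in> g ` {..<Suc j} then x (inv_into {..<Suc j} g l) else 0)" for l
      have ug: "u (g b) = x b" if "b < Suc j" for b
        using that inj by (auto simp: u_def)
      have u0: "u l = 0" if "l \<ge> N" for l using gN that by (auto simp: u_def)
      have Ku: "(\<Sum>l<N. K i l * u l) = (\<Sum>b<Suc j. K i (g b) * x b)" for i
      proof -
        have "(\<Sum>l<N. K i l * u l) = (\<Sum>l\<in>g ` {..<Suc j}. K i l * u l)"
          using gN by (intro sum.mono_neutral_right) (auto simp: u_def)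
        also have "\<dots> = (\<Sum>b<Suc j. K i (g b) * x b)"
          using inj by (subst sum.reindex) (auto simp: ug intro!: sum.cong)
        finally show ?thesis .
      qed
      have supp: "\<exists>h. strict_mono h \<and> (\<forall>a\<le>q. h a \<le> j \<and> 0 < s * (-1) ^ a * x (h a))"
        if alt: "alternates u q s" for q s
      proof -
        obtain e where e: "strict_mono e" "\<forall>a\<le>q. 0 < s * (-1) ^ a * u (e a)"
          using alt by (auto simp: alternates_strict_mono)
        have "\<exists>b. b \<le> j \<and> e a = g b" if "a \<le> q" for a
        proof (rule ccontr)
          assume "\<not> ?thesis"
          then have "u (e a) = 0" by (auto simp: u_def less_Suc_eq_le)
          then show False using e(2)[rule_format, OF that] by simp
        qed
        then obtain h where h: "\<And>a. a \<le> q \<Longrightarrow> h a \<le> j \<and> e a = g (h a)" by metis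
        have "strict_mono_on {..<Suc q} h"
        proof (rule strict_mono_onI)
          fix a b assume ab: "a \<in> {..<Suc q}" "b \<in> {..<Suc q}" "a < b"
          then have "e a < e b" using e(1) by (simp add: strict_mono_def)
          then have "g (h a) < g (h b)" using h[of a] h[of b] ab by simp
          then show "h a < h b" using Suc.prems(3) by (simp add: strict_mono_less)
        qed
        then obtain h' where "strict_mono h'" "\<And>a. a < Suc q \<Longrightarrow> h' a = h a"
          using strict_mono_extend by metis
        then show ?thesis using h e(2) ug
          by (intro exI[of _ h']) (auto simp: less_Suc_eq_le)
      qed
      \<comment> \<open>Only \<open>j + 1\<close> columns carry entries, and
        \<open>j \<le> m\<close>; so \<open>u\<close> cannot have \<open>Suc m\<close> changes and
        the hypothesis on \<open>K\<close> applies to it.\<close>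
      have bound: "q \<le> j" if "alternates u q s" for q s
        using supp[OF that] by (metis order_refl order_trans seq_suble)
      have "alternates (\<lambda>i. \<Sum>l<N. K i l * u l) j 1"
        unfolding alternates_strict_mono Ku using Suc.prems(2) x
        by (intro exI[of _ f]) (auto simp: less_Suc_eq_le simp flip: power_mult_distrib)
      then have "alternates u j 1"
        using bound[of "Suc m"] Suc.prems(1) by (intro assms[of N u]) (use u0 in auto)
      then obtain h where h: "strict_mono h" "\<forall>a\<le>j. h a \<le> j \<and> 0 < 1 * (-1) ^ a * x (h a)"
        using supp by blast
      \<comment> \<open>A strictly increasing map of \<open>{..j}\<close> into itself fixes 0: if it
        moved 0 upwards, it would leave the range at \<open>j\<close>.\<close>
      have "h 0 = 0"
      proof (rule ccontr)
        assume "h 0 \<noteq> 0"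
        then have "a < h a" for a
        proof (induction a)
          case (Suc a)
          then show ?case using strict_monoD[OF h(1), of a "Suc a"] by auto
        qed auto
        then show False using h(2) by (metis not_le order_refl)
      qed
      then have x0: "0 < x 0" using h(2)[rule_format, of 0] by simp
      have "x 0 * minor K (Suc j) f g =
          (\<Sum>i<Suc j. (-1) ^ i * (-1) ^ i * minor K j (f \<circ> insert_index i) (g \<circ> Suc))"
        using minor_cramer[of "Suc j" "\<lambda>a. (-1) ^ a" K f g x] x by simp
      also have "\<dots> \<ge> 0"
        using Suc.prems Suc.IH
        by (intro sum_nonneg) (auto simp: strict_mono_o strict_mono_insert_index strict_mono_Suc
            simp flip: power_mult_distrib)
      finally show ?thesis using x0 by (simp add: zero_le_mult_iff)
    qed simp
  qed
qed

lemma sum_insert_index: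
  fixes F :: "nat \<Rightarrow> 'a::comm_monoid_add"
  assumes "l < Suc q"
  shows "(\<Sum>i<Suc q. F i) = F l + (\<Sum>b<q. F (insert_index l b))"
proof -
  have "(\<Sum>b<q. F (insert_index l b)) = (\<Sum>i\<in>insert_index l ` {..<q}. F i)"
    by (subst sum.reindex) (auto simp: insert_index_inj_on)
  also have "insert_index l ` {..<q} = {..<Suc q} - {l}"
    using insert_index_image[OF assms] by (simp add: lessThan_atLeast0)
  finally show ?thesis using assms by (simp add: sum.remove[of "{..<Suc q}" l] del: sum.lessThan_Suc)
qed

text \<open>A minor using the merged column is linear in it and splits into two minors of
  \<open>K\<close>, one through column \<open>l\<close> and one through \<open>Suc l\<close>. No
  other selected column lies between these, so both index maps stay increasing.\<close>

lemma minors_nonneg_merge_cols: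
  assumes K: "minors_nonneg m K" and c: "0 \<le> c"
  shows "minors_nonneg m (\<lambda>i b. if b = l then K i l + c * K i (Suc l) else K i (insert_index (Suc l) b))"
    (is "minors_nonneg m ?K")
  unfolding minors_nonneg_def
proof (intro allI impI)
  fix j :: nat and f g :: "nat \<Rightarrow> nat"
  assume j: "j \<le> m" and f: "strict_mono f" and g: "strict_mono g"
  let ?h = "insert_index (Suc l)"
  have hg: "strict_mono (?h \<circ> g)" using g strict_mono_o strict_mono_insert_index by blast
  show "0 \<le> minor ?K j f g"
  proof (cases "\<exists>b<j. g b = l")
    case False
    then have "minor ?K j f g = minor K j f (?h \<circ> g)" by (intro minor_cong) auto
    then show ?thesis using K j f hg by (simp add: minors_nonneg_def)
  next
    case True
    then obtain k where k: "k < j" "g k = l" by blast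
    have gk: "g b = l \<longleftrightarrow> b = k" for b using k(2) g by (metis strict_mono_eq)
    have "minor ?K j f g = fdet j (\<lambda>a b. if b = k then K (f a) l + c * K (f a) (Suc l) else K (f a) (?h (g b)))"
      unfolding minor_def by (rule fdet_cong) (auto simp: gk)
    also have "\<dots> = fdet j (\<lambda>a b. if b = k then K (f a) l else K (f a) (?h (g b))) +
        c * fdet j (\<lambda>a b. if b = k then K (f a) (Suc l) else K (f a) (?h (g b)))"
      using k(1) by (rule fdet_col_linear)
    also have "fdet j (\<lambda>a b. if b = k then K (f a) l else K (f a) (?h (g b))) = minor K j f (?h \<circ> g)"
      unfolding minor_def by (rule fdet_cong) (use k in auto)
    also have "fdet j (\<lambda>a b. if b = k then K (f a) (Suc l) else K (f a) (?h (g b))) =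
        minor K j f ((?h \<circ> g)(k := Suc l))"
      unfolding minor_def by (rule fdet_cong) auto
    finally have eq: "minor ?K j f g = minor K j f (?h \<circ> g) + c * minor K j f ((?h \<circ> g)(k := Suc l))" .
    have "strict_mono ((?h \<circ> g)(k := Suc l))"
      unfolding strict_mono_def
    proof (intro allI impI)
      fix a b :: nat assume ab: "a < b"
      then have "g a < g b" using g by (simp add: strict_mono_def)
      then show "((?h \<circ> g)(k := Suc l)) a < ((?h \<circ> g)(k := Suc l)) b"
        using k(2) gk[of a] gk[of b] ab by (auto simp: insert_index_def)
    qed
    then show ?thesis unfolding eq using K j f hg c by (simp add: minors_nonneg_def)
  qed
qed

lemma variation_diminishing_drop_col:
  assumes "u l = 0" "l < Suc q"
  shows "(\<Sum>b<Suc q. K b * u b) = (\<Sum>b<q. K (insert_index l b) * u (insert_index l b) :: real)"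
  using assms by (simp add: sum_insert_index[of l q] del: sum.lessThan_Suc)

text \<open>After dropping zero entries of $u$ and merging adjacent columns that are hit with the same sign,
  $u$ alternates in every entry. If some square submatrix of rows on which the image alternates is
  singular, then $u$ can be moved along the kernel until an entry vanishes; otherwise
  Cramer's rule compares the first signs.\<close>

lemma variation_diminishing:
  assumes "minors_nonneg (Suc m) K" "\<And>l. l \<ge> q \<Longrightarrow> u l = 0"
    "\<not> alternates u (Suc m) 1" "\<not> alternates u (Suc m) (-1)"
    "alternates (\<lambda>i. \<Sum>l<q. K i l * u l) r \<sigma>" "\<sigma> = 1 \<or> \<sigma> = -1"
  shows "alternates u r \<sigma>"
  using assms
proof (induction q arbitrary: K u r \<sigma>)
  case 0
  then show ?case using not_alternates_zero by force
next
  case (Suc q)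
  note K = Suc.prems(1) and u0 = Suc.prems(2) and nalt = Suc.prems(3,4) and alt = Suc.prems(5)
  \<comment> \<open>The induction hypothesis after deleting a column that meets a zero entry. The
    row map \<open>\<rho>\<close> restricts attention to the rows of a pattern, where a modified
    input still has the same image.\<close>
  have drop: "alternates w t \<tau>" if "w l = 0" "l < Suc q" "\<And>l. l \<ge> Suc q \<Longrightarrow> w l = 0"
    "\<not> alternates w (Suc m) 1" "\<not> alternates w (Suc m) (-1)"
    "alternates (\<lambda>i. \<Sum>l<Suc q. K (\<rho> i) l * w l) t \<tau>" "\<tau> = 1 \<or> \<tau> = -1" "strict_mono \<rho>" for w l t \<tau> \<rho>
  proof -
    let ?h = "insert_index l"
    have h: "strict_mono ?h" by (rule strict_mono_insert_index)
    have "alternates (\<lambda>b. w (?h b)) t \<tau>"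
    proof (rule Suc.IH[of "\<lambda>i b. K (\<rho> i) (?h b)"])
      show "minors_nonneg (Suc m) (\<lambda>i b. K (\<rho> i) (?h b))" using K that(8) h by (rule minors_nonneg_comp)
      show "w (?h b) = 0" if "b \<ge> q" for b
        using \<open>\<And>l. l \<ge> Suc q \<Longrightarrow> w l = 0\<close> \<open>w l = 0\<close> \<open>l < Suc q\<close> that by (simp add: insert_index_def)
      show "\<not> alternates (\<lambda>b. w (?h b)) (Suc m) 1" "\<not> alternates (\<lambda>b. w (?h b)) (Suc m) (-1)"
        using that alternates_comp[OF _ h] by blast+
      show "alternates (\<lambda>i. \<Sum>b<q. K (\<rho> i) (?h b) * w (?h b)) t \<tau>"
        using that variation_diminishing_drop_col[of w l q] by simp
    qed (use that in auto)
    then show ?thesis using alternates_comp[OF _ h] by blast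
  qed
  show ?case
  proof (cases "\<exists>l<Suc q. u l = 0")
    case True
    then obtain l where "l < Suc q" "u l = 0" by blast
    from drop[of u l id r \<sigma>, OF this(2,1) u0 nalt] alt Suc.prems(6) show ?thesis by (simp add: strict_mono_def)
  next
    case False
    then have nz: "u l \<noteq> 0" if "l \<le> q" for l using that by auto
    show ?thesis
    proof (cases "\<exists>l<q. 0 < u l * u (Suc l)")
      case True
      then obtain l where l: "l < q" "0 < u l * u (Suc l)" by blast
      let ?h = "insert_index (Suc l)"
      have h: "strict_mono ?h" by (rule strict_mono_insert_index)
      \<comment> \<open>With this weight the merged column times \<open>u l\<close> reproduces both
        original terms; it is nonnegative because the two entries have equal signs.\<close>
      define c where "c = u (Suc l) / u l"
      have c: "0 \<le> c" using l(2) by (auto simp: c_def zero_less_mult_iff zero_le_divide_iff)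
      let ?K = "\<lambda>i b. if b = l then K i l + c * K i (Suc l) else K i (?h b)"
      have eq: "(\<Sum>b<q. ?K i b * u (?h b)) = (\<Sum>b<Suc q. K i b * u b)" for i
      proof -
        have "(\<Sum>b<q. ?K i b * u (?h b)) =
            (\<Sum>b<q. K i (?h b) * u (?h b) + (if b = l then c * K i (Suc l) * u l else 0))"
          by (rule sum.cong) (auto simp: ring_distribs)
        also have "\<dots> = (\<Sum>b<q. K i (?h b) * u (?h b)) + K i (Suc l) * u (Suc l)"
          using l nz[of l] by (simp add: sum.distrib c_def)
        also have "\<dots> = (\<Sum>b<Suc q. K i b * u b)"
          using l(1) by (subst sum_insert_index[of "Suc l" q]) auto
        finally show ?thesis .
      qed
      have "alternates (\<lambda>b. u (?h b)) r \<sigma>"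
      proof (rule Suc.IH[of ?K])
        show "minors_nonneg (Suc m) ?K" using K c by (rule minors_nonneg_merge_cols)
        show "u (?h b) = 0" if "b \<ge> q" for b using that l u0 by simp
        show "\<not> alternates (\<lambda>b. u (?h b)) (Suc m) 1" "\<not> alternates (\<lambda>b. u (?h b)) (Suc m) (-1)"
          using nalt alternates_comp[OF _ h] by blast+
        show "alternates (\<lambda>i. \<Sum>b<q. ?K i b * u (?h b)) r \<sigma>" unfolding eq by (rule alt)
      qed (use Suc.prems in auto)
      then show ?thesis using alternates_comp[OF _ h] by blast
    next
      case False
      define \<sigma>0 where "\<sigma>0 = sgn (u 0)"
      have \<sigma>0: "\<sigma>0 = 1 \<or> \<sigma>0 = -1" using nz[of 0] by (auto simp: \<sigma>0_def sgn_if)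
      have ualt: "0 < \<sigma>0 * (-1) ^ l * u l" if "l \<le> q" for l
        using that
      proof (induction l)
        case 0 then show ?case using nz[of 0] by (auto simp: \<sigma>0_def sgn_if)
      next
        case (Suc l)
        have "u l * u (Suc l) \<le> 0" using False Suc.prems by (metis Suc_le_lessD not_le)
        moreover have "0 < \<sigma>0 * (-1) ^ l * u l" "u (Suc l) \<noteq> 0" using Suc nz by auto
        moreover have "\<sigma>0 * (-1) ^ l = 1 \<or> \<sigma>0 * (-1) ^ l = -1" using \<sigma>0 by (cases "even l") auto
        ultimately show ?case by (auto simp: mult_le_0_iff)
      qed
      then have altu: "alternates u q \<sigma>0"
        unfolding alternates_strict_mono by (intro exI[of _ id]) (auto simp: strict_mono_def)
      \<comment> \<open>All \<open>q + 1\<close> entries alternate, so the bound on the changes of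
        \<open>u\<close> limits \<open>q\<close>, and minors of order \<open>q + 1\<close> are
        covered by the hypothesis.\<close>
      have qm: "q \<le> m"
      proof (rule ccontr)
        assume "\<not> q \<le> m"
        then have "alternates u (Suc m) \<sigma>0" using altu alternates_le by (meson not_less_eq_eq)
        then show False using nalt \<sigma>0 by auto
      qed
      let ?v = "\<lambda>i. \<Sum>l<Suc q. K i l * u l"
      \<comment> \<open>A pattern with \<open>q\<close> changes in the image must start with the
        sign of \<open>u 0\<close>. It is applied to the given pattern and, were that longer, to the
        pattern without its first place; the two answers contradict each other.\<close>
      have first: "\<tau> = \<sigma>0" if f: "strict_mono f" and \<tau>: "\<tau> = 1 \<or> \<tau> = -1"
        and va: "\<And>a. a \<le> q \<Longrightarrow> 0 < \<tau> * (-1) ^ a * ?v (f a)" for f \<tau>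
      proof (cases "minor K (Suc q) f id = 0")
        case True
        then obtain z l where z: "l < Suc q" "z l \<noteq> 0" "\<forall>a<Suc q. (\<Sum>b<Suc q. K (f a) b * z b) = 0"
          using fdet_kernel[of "Suc q" "\<lambda>a b. K (f a) b"] by (auto simp: minor_def simp del: sum.lessThan_Suc)
        \<comment> \<open>Moving \<open>u\<close> along the kernel vector \<open>z\<close> kills
          entry \<open>l\<close> and keeps the image on the rows \<open>f\<close>. At most
          \<open>q\<close> nonzero entries remain, so \<open>w\<close> has fewer than
          \<open>q\<close> changes, while \<open>drop\<close> would give it
          \<open>q\<close>.\<close>
        define w where "w b = (if b < Suc q then u b - u l / z l * z b else 0)" for b
        have eq: "(\<Sum>b<Suc q. K (f a) b * w b) = ?v (f a)" if "a < Suc q" for a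
        proof -
          have "(\<Sum>b<Suc q. K (f a) b * w b) = ?v (f a) - u l / z l * (\<Sum>b<Suc q. K (f a) b * z b)"
            unfolding sum_distrib_left sum_subtractf[symmetric] w_def
            by (rule sum.cong) (auto simp: algebra_simps)
          then show ?thesis using z(3) that by simp
        qed
        have wl: "w l = 0" using z by (simp add: w_def)
        have bound: "t < q" if wt: "alternates w t s" for t s
        proof -
          obtain e where e: "strict_mono e" "\<forall>a\<le>t. 0 < s * (-1) ^ a * w (e a)"
            using wt by (auto simp: alternates_strict_mono)
          have "e a < Suc q \<and> e a \<noteq> l" if "a \<le> t" for a
            using e(2)[rule_format, OF that] wl by (auto simp: w_def split: if_splits)
          then have "e ` {..t} \<subseteq> {..<Suc q} - {l}" by auto
          from card_mono[OF _ this] show ?thesis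
            using z(1) e(1) by (simp add: card_image strict_mono_imp_inj_on inj_on_subset)
        qed
        have "alternates (\<lambda>i. \<Sum>l<Suc q. K (f i) l * w l) q \<tau>"
          unfolding alternates_strict_mono using va eq
          by (intro exI[of _ id]) (auto simp: strict_mono_def less_Suc_eq_le simp del: sum.lessThan_Suc)
        then have "alternates w q \<tau>"
          using drop[of w l f q \<tau>] wl z(1) bound[of "Suc m"] qm \<tau> f by (auto simp: w_def)
        then show ?thesis using bound by blast
      next
        case False
        have pos: "0 \<le> minor K j f' g'" if "j \<le> Suc q" "strict_mono f'" "strict_mono g'" for j f' g'
          using K that qm by (simp add: minors_nonneg_def)
        \<comment> \<open>Now Cramer's rule expresses \<open>\<tau> * u 0\<close> times this
          positive minor by nonnegative terms.\<close>
        have "minor K (Suc q) f id > 0" using pos[of "Suc q" f id] f False by (simp add: strict_mono_def)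
        moreover have "u 0 * minor K (Suc q) f id =
            (\<Sum>i<Suc q. ?v (f i) * (-1) ^ i * minor K q (f \<circ> insert_index i) (id \<circ> Suc))"
          using minor_cramer[of "Suc q" "\<lambda>a. ?v (f a)" K f id u] by simp
        then have "\<tau> * u 0 * minor K (Suc q) f id =
            (\<Sum>i<Suc q. (\<tau> * (-1) ^ i * ?v (f i)) * minor K q (f \<circ> insert_index i) Suc)"
          by (simp add: sum_distrib_left mult_ac del: sum.lessThan_Suc)
        moreover have "\<dots> \<ge> 0"
        proof (rule sum_nonneg)
          fix i assume "i \<in> {..<Suc q}"
          then show "0 \<le> (\<tau> * (-1) ^ i * ?v (f i)) * minor K q (f \<circ> insert_index i) Suc"
            using va[of i] f
            by (intro mult_nonneg_nonneg[OF less_imp_le pos])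
              (auto simp: less_Suc_eq_le strict_mono_o strict_mono_insert_index strict_mono_Suc)
        qed
        ultimately have "0 \<le> \<tau> * u 0" by (metis mult_less_0_iff not_le)
        then show ?thesis using \<tau> nz[of 0] by (auto simp: \<sigma>0_def sgn_if)
      qed
      obtain f where f: "strict_mono f" "\<forall>a\<le>r. 0 < \<sigma> * (-1) ^ a * ?v (f a)"
        using alt by (auto simp: alternates_strict_mono)
      show ?thesis
      proof (cases "r < q")
        case True
        then show ?thesis using altu alternates_less \<sigma>0 Suc.prems(6) by blast
      next
        case False
        then have "\<sigma> = \<sigma>0" using first[OF f(1) Suc.prems(6)] f(2) by auto
        moreover have "r = q"
        proof (rule ccontr)
          assume "r \<noteq> q"
          then have "Suc q \<le> r" using False by simp
          then have "0 < (- \<sigma>) * (-1) ^ a * ?v (f (Suc a))" if "a \<le> q" for a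
            using f(2)[rule_format, of "Suc a"] that by simp
          then have "- \<sigma> = \<sigma>0"
            using first[of "\<lambda>a. f (Suc a)" "- \<sigma>"] f(1) Suc.prems(6) by (auto simp: strict_mono_def)
          then show False using \<open>\<sigma> = \<sigma>0\<close> \<sigma>0 by auto
        qed
        ultimately show ?thesis using altu by simp
      qed
    qed
  qed
qed

section \<open>The Cauchy--Binet formula\<close>

lemma subseqs_sorted_wrt:
  assumes "xs \<in> set (subseqs ys)" "sorted_wrt P ys"
  shows "sorted_wrt P xs \<and> set xs \<subseteq> set ys"
  using assms
proof (induction ys arbitrary: xs)
  case (Cons y ys)
  then show ?case by (fastforce simp: Let_def)
qed simp

lemma set_lex_subsets: "set (lex_subsets n j) = {I. sorted_wrt (<) I \<and> length I = j \<and> set I \<subseteq> {..<n}}"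
proof (intro equalityI subsetI)
  fix I assume "I \<in> set (lex_subsets n j)"
  then have I: "I \<in> set (subseqs [0..<n])" "length I = j" by (auto simp: lex_subsets_def)
  then show "I \<in> {I. sorted_wrt (<) I \<and> length I = j \<and> set I \<subseteq> {..<n}}"
    using subseqs_sorted_wrt[OF I(1), of "(<)"] by auto
next
  fix I assume I: "I \<in> {I. sorted_wrt (<) I \<and> length I = j \<and> set I \<subseteq> {..<n}}"
  then have "set I \<in> set ` set (subseqs [0..<n])" using subseqs_powset[of "[0..<n]"] by auto
  then obtain xs where xs: "xs \<in> set (subseqs [0..<n])" "set I = set xs" by auto
  then have "sorted_wrt (<) xs" using subseqs_sorted_wrt[of xs "[0..<n]" "(<)"] by simp
  then have "I = xs" using I xs(2) by (intro strict_sorted_equal) auto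
  then show "I \<in> set (lex_subsets n j)" using I xs by (simp add: lex_subsets_def)
qed

lemma strict_mono_on_nth: "sorted_wrt (<) I \<Longrightarrow> strict_mono_on {..<length I} ((!) I)"
  by (auto simp: strict_mono_on_def sorted_wrt_iff_nth_less)

lemma fdet_leibniz:
  "fdet n M = (\<Sum>p | p permutes {0..<n}. signof p * (\<Prod>i = 0..<n. M i (p i)))"
  unfolding fdet_def by (subst det_def'[of _ n]) (auto intro!: sum.cong prod.cong dest: permutes_in_image)

lemma fdet_permute_rows:
  assumes "p permutes {0..<n}"
  shows "fdet n (\<lambda>a b. M (p a) b) = signof p * fdet n M"
proof -
  have "Matrix.mat n n (\<lambda>(i, j). Matrix.mat n n (\<lambda>(a, b). M a b) $$ (p i, j)) =
      Matrix.mat n n (\<lambda>(a, b). M (p a) b)"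
    by (rule eq_matI) (use assms permutes_in_image[OF assms] in auto)
  then show ?thesis unfolding fdet_def
    using det_permute_rows[of "Matrix.mat n n (\<lambda>(a, b). M a b)" n p] assms by simp
qed

text \<open>An injective selection of \<open>j\<close> indices is its sorted image together with the
  permutation in which the image is visited. This groups the terms of the Cauchy--Binet expansion by
  index sets.\<close>

lemma injective_selections_bij:
  "bij_betw (\<lambda>(I, p). restrict (\<lambda>a. I ! p a) {0..<j})
    (set (lex_subsets n j) \<times> {p. p permutes {0..<j}})
    {h \<in> {0..<j} \<rightarrow>\<^sub>E {..<n}. inj_on h {0..<j}}"
proof (rule bij_betw_imageI)
  let ?F = "\<lambda>(I, p). restrict (\<lambda>a. I ! p a) {0..<j}"
  have rng: "?F (I, p) ` {0..<j} = set I" if "length I = j" "p permutes {0..<j}" for I :: "nat list" and p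
  proof -
    have "?F (I, p) ` {0..<j} = (!) I ` p ` {0..<j}" by auto
    also have "\<dots> = set I" using permutes_image[OF that(2)] nth_image[of j I] that(1) by simp
    finally show ?thesis .
  qed
  show "inj_on ?F (set (lex_subsets n j) \<times> {p. p permutes {0..<j}})"
  proof (rule inj_onI, clarify)
    fix I p I' p'
    assume I: "I \<in> set (lex_subsets n j)" "I' \<in> set (lex_subsets n j)"
      and p: "p permutes {0..<j}" "p' permutes {0..<j}"
      and eq: "restrict (\<lambda>a. I ! p a) {0..<j} = restrict (\<lambda>a. I' ! p' a) {0..<j}"
    have "set I = set I'" using rng[of I p] rng[of I' p'] I p eq by (simp add: set_lex_subsets)
    then have II: "I = I'" using I by (intro strict_sorted_equal) (auto simp: set_lex_subsets)
    have "p a = p' a" for a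
    proof (cases "a < j")
      case True
      then have "I ! p a = I ! p' a" using fun_cong[OF eq, of a] II by simp
      moreover have "p a < j" "p' a < j" using p True by (metis atLeastLessThan_iff permutes_in_image zero_le)+
      moreover have "distinct I" "length I = j" using I by (auto simp: set_lex_subsets strict_sorted_iff)
      ultimately show ?thesis by (simp add: nth_eq_iff_index_eq)
    next
      case False
      then show ?thesis using p by (simp add: permutes_not_in)
    qed
    then show "I = I' \<and> p = p'" using II by auto
  qed
  show "?F ` (set (lex_subsets n j) \<times> {p. p permutes {0..<j}}) =
      {h \<in> {0..<j} \<rightarrow>\<^sub>E {..<n}. inj_on h {0..<j}}"
  proof (intro equalityI subsetI)
    fix h assume "h \<in> ?F ` (set (lex_subsets n j) \<times> {p. p permutes {0..<j}})"
    then obtain I p where Ip: "I \<in> set (lex_subsets n j)" "p permutes {0..<j}" "h = ?F (I, p)" by auto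
    then have I: "distinct I" "length I = j" "set I \<subseteq> {..<n}" by (auto simp: set_lex_subsets strict_sorted_iff)
    have "h ` {0..<j} = set I" using rng[of I p] I Ip by simp
    moreover from this have "inj_on h {0..<j}"
      using I by (intro eq_card_imp_inj_on) (auto simp: distinct_card)
    ultimately show "h \<in> {h \<in> {0..<j} \<rightarrow>\<^sub>E {..<n}. inj_on h {0..<j}}"
      using I Ip(3) by (auto simp: PiE_def extensional_def)
  next
    fix h assume h: "h \<in> {h \<in> {0..<j} \<rightarrow>\<^sub>E {..<n}. inj_on h {0..<j}}"
    define I where "I = sorted_list_of_set (h ` {0..<j})"
    have I: "sorted_wrt (<) I" "set I = h ` {0..<j}" "distinct I" by (auto simp: I_def)
    then have len: "length I = j" using h by (metis (no_types, lifting) card_atLeastLessThan card_image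
          distinct_card diff_zero mem_Collect_eq)
    have bI: "bij_betw ((!) I) {0..<j} (h ` {0..<j})"
      using bij_betw_nth[of I "{0..<j}" "h ` {0..<j}"] I len by (simp add: lessThan_atLeast0)
    define p where "p a = (if a < j then inv_into {0..<j} ((!) I) (h a) else a)" for a
    have "bij_betw (inv_into {0..<j} ((!) I) \<circ> h) {0..<j} {0..<j}"
      using h bI by (intro bij_betw_trans[OF _ bij_betw_inv_into]) (auto simp: bij_betw_def)
    then have "bij_betw p {0..<j} {0..<j}"
      by (rule iffD1[OF bij_betw_cong, rotated]) (auto simp: p_def)
    then have p: "p permutes {0..<j}" by (rule bij_imp_permutes) (simp add: p_def)
    have "h = ?F (I, p)"
    proof
      fix a show "h a = ?F (I, p) a"
        using h bI by (cases "a < j")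
          (auto simp: p_def bij_betw_def f_inv_into_f PiE_def extensional_def)
    qed
    moreover have "I \<in> set (lex_subsets n j)" using I len h by (auto simp: set_lex_subsets)
    ultimately show "h \<in> ?F ` (set (lex_subsets n j) \<times> {p. p permutes {0..<j}})" using p by blast
  qed
qed

text \<open>Multiplying out the Leibniz formula gives a sum over all maps \<open>h\<close> into the
  inner index range. Maps that are not injective yield a determinant with equal rows; the others are
  grouped by image, and the permutation signs reassemble the determinant of
  \<open>X\<close>.\<close>

lemma cauchy_binet:
  fixes X Y :: "nat \<Rightarrow> nat \<Rightarrow> 'a::comm_ring_1"
  shows "fdet j (\<lambda>a b. \<Sum>l<n. X a l * Y l b) =
    (\<Sum>I\<in>set (lex_subsets n j). fdet j (\<lambda>a b. X a (I ! b)) * fdet j (\<lambda>a b. Y (I ! a) b))"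
proof -
  let ?H = "{0..<j} \<rightarrow>\<^sub>E {..<n}" and ?P = "{p. p permutes {0..<j}}"
  have "fdet j (\<lambda>a b. \<Sum>l<n. X a l * Y l b) =
      (\<Sum>p\<in>?P. \<Sum>h\<in>?H. signof p * (\<Prod>a = 0..<j. X a (h a) * Y (h a) (p a)))"
    unfolding fdet_leibniz by (subst prod_sum_PiE) (auto simp: sum_distrib_left)
  also have "\<dots> = (\<Sum>h\<in>?H. (\<Prod>a = 0..<j. X a (h a)) * fdet j (\<lambda>a b. Y (h a) b))"
    unfolding fdet_leibniz by (subst sum.swap) (simp add: sum_distrib_left prod.distrib mult_ac)
  also have "\<dots> = (\<Sum>h\<in>{h \<in> ?H. inj_on h {0..<j}}. (\<Prod>a = 0..<j. X a (h a)) * fdet j (\<lambda>a b. Y (h a) b))"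
  proof (rule sum.mono_neutral_right)
    show "finite ?H" by (intro finite_PiE) auto
    show "\<forall>h\<in>?H - {h \<in> ?H. inj_on h {0..<j}}. (\<Prod>a = 0..<j. X a (h a)) * fdet j (\<lambda>a b. Y (h a) b) = 0"
    proof
      fix h assume "h \<in> ?H - {h \<in> ?H. inj_on h {0..<j}}"
      then obtain a a' where "a < j" "a' < j" "a \<noteq> a'" "h a = h a'" by (auto simp: inj_on_def)
      then have "fdet j (\<lambda>a b. Y (h a) b) = 0" by (intro fdet_identical_rows[of a j a']) auto
      then show "(\<Prod>a = 0..<j. X a (h a)) * fdet j (\<lambda>a b. Y (h a) b) = 0" by simp
    qed
  qed auto
  also have "\<dots> = (\<Sum>(I, p)\<in>set (lex_subsets n j) \<times> ?P.
      (\<Prod>a = 0..<j. X a (I ! p a)) * fdet j (\<lambda>a b. Y (I ! p a) b))"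
    by (subst sum.reindex_bij_betw[OF injective_selections_bij, symmetric])
       (auto intro!: sum.cong arg_cong2[of _ _ _ _ "(*)"] prod.cong fdet_cong)
  also have "\<dots> = (\<Sum>I\<in>set (lex_subsets n j). \<Sum>p\<in>?P.
      (\<Prod>a = 0..<j. X a (I ! p a)) * fdet j (\<lambda>a b. Y (I ! p a) b))"
    by (rule sum.cartesian_product[symmetric])
  also have "\<dots> = (\<Sum>I\<in>set (lex_subsets n j). fdet j (\<lambda>a b. X a (I ! b)) * fdet j (\<lambda>a b. Y (I ! a) b))"
  proof (rule sum.cong[OF refl])
    fix I
    have "(\<Sum>p\<in>?P. (\<Prod>a = 0..<j. X a (I ! p a)) * fdet j (\<lambda>a b. Y (I ! p a) b)) =
        (\<Sum>p\<in>?P. (signof p * (\<Prod>a = 0..<j. X a (I ! p a))) * fdet j (\<lambda>a b. Y (I ! a) b))"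
      by (rule sum.cong) (auto simp: fdet_permute_rows[of _ j "\<lambda>a b. Y (I ! a) b"])
    then show "(\<Sum>p\<in>?P. (\<Prod>a = 0..<j. X a (I ! p a)) * fdet j (\<lambda>a b. Y (I ! p a) b)) =
        fdet j (\<lambda>a b. X a (I ! b)) * fdet j (\<lambda>a b. Y (I ! a) b)"
      unfolding fdet_leibniz[of j "\<lambda>a b. X a (I ! b)"] by (simp add: sum_distrib_right)
  qed
  finally show ?thesis .
qed

lemma minor_cauchy_binet:
  assumes "\<And>a b. a < j \<Longrightarrow> b < j \<Longrightarrow> K (f a) (g b) = (\<Sum>l<n. X (f a) l * Y l (g b))"
  shows "minor K j f g = (\<Sum>I\<in>set (lex_subsets n j). minor X j f ((!) I) * minor Y j ((!) I) g)"
proof -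
  have "minor K j f g = fdet j (\<lambda>a b. \<Sum>l<n. X (f a) l * Y l (g b))"
    unfolding minor_def by (rule fdet_cong) (rule assms)
  then show ?thesis unfolding cauchy_binet minor_def by simp
qed

section \<open>A three-term Pluecker relation and Fekete's lemma\<close>

text \<open>Moving row \<open>p\<close> to the top passes \<open>p\<close> rows; both determinants
  are compared through their expansions along \<open>y\<close>.\<close>

lemma fdet_insert_row:
  assumes "p \<le> n"
  shows "fdet (Suc n) (\<lambda>a b. if a = p then y b else N (delete_index p a) b) =
    (-1) ^ p * fdet (Suc n) (\<lambda>a b. if a = 0 then y b else N (a - 1) b)"
proof -
  have *: "fdet (Suc n) (\<lambda>a b. if a = q then y b else N (delete_index q a) b) =
    (-1) ^ q * (\<Sum>i<Suc n. y i * ((-1) ^ i * fdet n (\<lambda>a b. N a (insert_index i b))))" if "q \<le> n" for q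
    using that by (subst fdet_expand_row)
      (auto simp: power_add sum_distrib_left mult_ac simp del: sum.lessThan_Suc)
  have "fdet (Suc n) (\<lambda>a b. if a = 0 then y b else N (a - 1) b) =
      fdet (Suc n) (\<lambda>a b. if a = 0 then y b else N (delete_index 0 a) b)"
    by (rule fdet_cong) (auto simp: delete_index_def)
  then show ?thesis using *[OF assms] *[of 0] by simp
qed

text \<open>\<open>\<Delta> i\<close> omits row \<open>i\<close> of \<open>j + 1\<close> rows of
  length \<open>j\<close>, and \<open>E x y\<close> for \<open>x < y\<close> omits two rows and the
  last column. The numbers \<open>(-1) ^ i * \<Delta> i\<close> are the coefficients of a linear
  relation between the rows. A linear form that vanishes on all rows except \<open>0\<close>,
  \<open>m\<close> and \<open>j\<close> reduces it to three terms.\<close>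

lemma plucker_relation:
  fixes M :: "nat \<Rightarrow> nat \<Rightarrow> 'a::comm_ring_1"
  assumes m: "0 < m" "m < j"
  defines "\<Delta> \<equiv> \<lambda>i. fdet j (\<lambda>a b. M (insert_index i a) b)"
    and "E \<equiv> \<lambda>x y. fdet (j - 1) (\<lambda>a b. M (insert_index y (insert_index x a)) b)"
  shows "\<Delta> m * E 0 j = \<Delta> 0 * E m j + \<Delta> j * E 0 m"
proof -
  have rel: "(\<Sum>i<Suc j. (-1) ^ i * \<Delta> i * M i l) = 0" if "l < j" for l
  proof -
    have "0 = fdet (Suc j) (\<lambda>a b. if b = 0 then M a l else M a (b - 1))"
      using that by (subst fdet_identical_cols[of 0 _ "Suc l"]) auto
    also have "\<dots> = (\<Sum>i<Suc j. (-1) ^ i * \<Delta> i * M i l)"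
      by (subst fdet_expand_col) (auto simp: \<Delta>_def mult_ac insert_index_0 simp del: sum.lessThan_Suc)
    finally show ?thesis by simp
  qed
  define n where "n = j - 2"
  have j: "j = Suc (Suc n)" using m by (simp add: n_def)
  \<comment> \<open>For \<open>a < n\<close> these are the rows other than \<open>0\<close>,
    \<open>m\<close> and \<open>j\<close>. The form \<open>\<Phi>\<close> below puts its argument on
    top of them, so it vanishes on each of them.\<close>
  define N where "N a = M (Suc (insert_index (m - 1) a))" for a
  define \<Phi> where "\<Phi> y = fdet (Suc n) (\<lambda>a b. if a = 0 then y b else N (a - 1) b)" for y :: "nat \<Rightarrow> 'a"
  have \<Phi>_expand: "\<Phi> y = (\<Sum>i<Suc n. y i * ((-1) ^ i * fdet n (\<lambda>a b. N a (insert_index i b))))" for y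
    unfolding \<Phi>_def by (subst fdet_expand_row) (auto simp: insert_index_0)
  have sum0: "(\<Sum>i<Suc j. (-1) ^ i * \<Delta> i * \<Phi> (M i)) = 0"
  proof -
    have "(\<Sum>i<Suc j. (-1) ^ i * \<Delta> i * \<Phi> (M i)) = (\<Sum>l<Suc n. (\<Sum>i<Suc j. (-1) ^ i * \<Delta> i * M i l) *
        ((-1) ^ l * fdet n (\<lambda>a b. N a (insert_index l b))))"
      unfolding \<Phi>_expand sum_distrib_left sum_distrib_right
      by (subst sum.swap) (simp add: mult_ac del: sum.lessThan_Suc)
    also have "\<dots> = 0" using rel j by (intro sum.neutral) (simp del: sum.lessThan_Suc)
    finally show ?thesis .
  qed
  have \<Phi>0: "\<Phi> (M 0) = E m j"
    unfolding \<Phi>_def E_def j N_def using m j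
    by (auto intro!: fdet_cong simp: insert_index_def)
  have \<Phi>m: "\<Phi> (M m) = (-1) ^ (m - 1) * E 0 j"
  proof -
    have "E 0 j = fdet (Suc n) (\<lambda>a b. if a = m - 1 then M m b else N (delete_index (m - 1) a) b)"
      unfolding E_def j N_def using m j
      by (auto intro!: fdet_cong simp: insert_index_def delete_index_def)
    also have "\<dots> = (-1) ^ (m - 1) * \<Phi> (M m)" unfolding \<Phi>_def using m j by (intro fdet_insert_row) auto
    finally show ?thesis by (simp add: mult.assoc[symmetric] power_mult_distrib[symmetric])
  qed
  have \<Phi>j: "\<Phi> (M j) = (-1) ^ n * E 0 m"
  proof -
    have "E 0 m = fdet (Suc n) (\<lambda>a b. if a = n then M j b else N (delete_index n a) b)"
      unfolding E_def j N_def using m j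
      by (auto intro!: fdet_cong simp: insert_index_def delete_index_def)
    also have "\<dots> = (-1) ^ n * \<Phi> (M j)" unfolding \<Phi>_def by (intro fdet_insert_row) auto
    finally show ?thesis by (simp add: mult.assoc[symmetric] power_mult_distrib[symmetric])
  qed
  have \<Phi>other: "\<Phi> (M i) = 0" if i: "i \<noteq> 0" "i \<noteq> m" "i < j" for i
  proof -
    have "i - 1 \<noteq> m - 1" using i m by auto
    then have "insert_index (m - 1) (delete_index (m - 1) (i - 1)) = i - 1" by (rule insert_delete_index)
    then have "N (delete_index (m - 1) (i - 1)) = M i" using i by (simp add: N_def)
    moreover have "delete_index (m - 1) (i - 1) < n" using i m j by (auto simp: delete_index_def)
    ultimately show ?thesis unfolding \<Phi>_def
      by (intro fdet_identical_rows[of 0 _ "Suc (delete_index (m - 1) (i - 1))"]) auto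
  qed
  have "(\<Sum>i<Suc j. (-1) ^ i * \<Delta> i * \<Phi> (M i)) = (\<Sum>i\<in>{0, m, j}. (-1) ^ i * \<Delta> i * \<Phi> (M i))"
    using m by (intro sum.mono_neutral_right) (auto simp: \<Phi>other)
  also have "\<dots> = \<Delta> 0 * E m j + (-1) ^ m * \<Delta> m * ((-1) ^ (m - 1) * E 0 j) + (-1) ^ j * \<Delta> j * ((-1) ^ n * E 0 m)"
    using m by (simp add: \<Phi>0 \<Phi>m \<Phi>j add.assoc)
  also have "(-1) ^ m * \<Delta> m * ((-1) ^ (m - 1) * E 0 j) = - (\<Delta> m * E 0 j)"
    using m by (cases m) (auto simp: mult_ac simp flip: power_mult_distrib)
  also have "(-1) ^ j * \<Delta> j * ((-1) ^ n * E 0 m) = \<Delta> j * E 0 m"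
    unfolding j by (simp add: mult_ac flip: power_mult_distrib)
  finally show ?thesis using sum0 by (simp add: algebra_simps)
qed

text \<open>Fekete's lemma for rows that may become dependent: $R\,t$ plays the role of the rank of the rows
  from $t$ on.\<close>

lemma fekete:
  fixes W :: "nat \<Rightarrow> nat \<Rightarrow> real" and R :: "nat \<Rightarrow> nat" and G :: "(nat \<Rightarrow> nat) set"
  assumes R: "antimono R"
    and zero: "\<And>j f g. j \<le> k \<Longrightarrow> strict_mono f \<Longrightarrow> g \<in> G \<Longrightarrow> \<exists>a<j. R (f a) < j - a \<Longrightarrow> minor W j f g = 0"
    and consecutive: "\<And>j t g. j \<le> k \<Longrightarrow> g \<in> G \<Longrightarrow> \<forall>a<j. j - a \<le> R (t + a) \<Longrightarrow> 0 < minor W j (\<lambda>a. t + a) g"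
  shows "j \<le> k \<Longrightarrow> strict_mono f \<Longrightarrow> g \<in> G \<Longrightarrow> \<forall>a<j. j - a \<le> R (f a) \<Longrightarrow> 0 < minor W j f g"
proof (induction j arbitrary: f)
  case 0
  then show ?case by (simp add: minor_def)
next
  case (Suc i)
  note IHj = Suc.IH and j = Suc.prems(1) and g = Suc.prems(3)
  define j where "j = Suc i"
  have jk: "j \<le> k" using j by (simp add: j_def)
  have "strict_mono f \<Longrightarrow> \<forall>a<j. j - a \<le> R (f a) \<Longrightarrow> 0 < minor W j f g" for f
  \<comment> \<open>The induction is on the spread of the rows; without a gap they are consecutive
    and covered by hypothesis.\<close>
  proof (induction "f i - f 0" arbitrary: f rule: less_induct)
    case less
    note f = less.prems(1) and good = less.prems(2)
    show ?case
    proof (cases "\<exists>m<i. f (Suc m) \<noteq> Suc (f m)")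
      case False
      have fa: "f 0 + a = f a" if "a < j" for a
        using that by (induction a) (use False in \<open>auto simp: j_def\<close>)
      have "minor W j f g = minor W j (\<lambda>a. f 0 + a) g" by (intro minor_cong) (simp add: fa)
      moreover have "\<forall>a<j. j - a \<le> R (f 0 + a)" using good by (simp add: fa)
      ultimately show ?thesis using consecutive[OF jk g] by simp
    next
      case True
      then obtain m' where m': "m' < i" "f (Suc m') \<noteq> Suc (f m')" by blast
      define m where "m = Suc m'"
      define s where "s = Suc (f m')"
      have sm: "s < f m" using m'(2) f strict_monoD[OF f, of m' m] by (simp add: s_def m_def)
      have m: "0 < m" "m < j" "m \<le> i" using m' by (auto simp: m_def j_def)
      \<comment> \<open>\<open>\<rho>\<close> lists \<open>j + 1\<close> rows, namely
        \<open>f\<close> with the first missing row \<open>s\<close> of the gap inserted at position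
        \<open>m\<close>; so \<open>f\<close> is \<open>\<rho>\<close> without position
        \<open>m\<close>. Omitting an end of \<open>\<rho>\<close> instead leaves rows of smaller
        spread.\<close>
      define \<rho> where "\<rho> a = (if a < m then f a else if a = m then s else f (a - 1))" for a
      have \<rho>: "strict_mono \<rho>"
      proof (rule strict_mono_Suc_iff[THEN iffD2], rule allI)
        fix a
        have "f a < f (Suc a)" "f (a - 1) < f a" if "a > 0" for a
          using f that by (auto simp: strict_mono_def)
        then show "\<rho> a < \<rho> (Suc a)"
          using f sm by (auto simp: \<rho>_def s_def m_def strict_mono_def less_Suc_eq)
      qed
      note ins = strict_mono_insert_index
      let ?d = insert_index
      have comp: "strict_mono (\<lambda>a. \<rho> (?d x a))" for x
        using strict_mono_o[OF \<rho> ins] by (simp add: comp_def)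
      have comp2: "strict_mono (\<lambda>a. \<rho> (?d x (?d y a)))" for x y
        using strict_mono_o[OF comp ins] by (simp add: comp_def)
      have Rs: "j - m \<le> R s" using antimonoD[OF R, of s "f m"] sm good m by force
      have g': "j - a \<le> R (f a)" if "a < j" for a using good that by blast
      have f_eq: "minor W j (\<lambda>a. \<rho> (?d m a)) g = minor W j f g"
        by (rule minor_cong) (auto simp: \<rho>_def insert_index_def)
      have pos1: "0 < minor W i (\<lambda>a. \<rho> (?d j (?d 0 a))) g"
      proof (rule IHj[OF _ comp2 g])
        show "\<forall>a<i. i - a \<le> R (\<rho> (?d j (?d 0 a)))" (is "\<forall>a<i. ?G a")
        proof (intro allI impI)
          fix a assume "a < i"
          then show "?G a"
            using g'[of a] g'[of "Suc a"] Rs m by (auto simp: \<rho>_def j_def insert_index_def)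
        qed
      qed (use jk in \<open>simp add: j_def\<close>)
      have pos2: "0 < minor W i (\<lambda>a. \<rho> (?d j (?d m a))) g"
      proof (rule IHj[OF _ comp2 g])
        show "\<forall>a<i. i - a \<le> R (\<rho> (?d j (?d m a)))" (is "\<forall>a<i. ?G a")
        proof (intro allI impI)
          fix a assume "a < i"
          then show "?G a"
            using g'[of a] m by (auto simp: \<rho>_def j_def insert_index_def)
        qed
      qed (use jk in \<open>simp add: j_def\<close>)
      have pos3: "0 < minor W i (\<lambda>a. \<rho> (?d m (?d 0 a))) g"
      proof (rule IHj[OF _ comp2 g])
        show "\<forall>a<i. i - a \<le> R (\<rho> (?d m (?d 0 a)))" (is "\<forall>a<i. ?G a")
        proof (intro allI impI)
          fix a assume "a < i"
          then show "?G a"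
            using g'[of "Suc a"] m by (auto simp: \<rho>_def j_def insert_index_def)
        qed
      qed (use jk in \<open>simp add: j_def\<close>)
      have f0i: "f 0 < f i" using f m m' by (auto simp: strict_mono_def)
      have last: "\<rho> i < f i" "\<rho> 0 = f 0" "\<rho> j = f i" "f 0 < \<rho> 1"
        using m sm f strict_monoD[OF \<rho>, of 0 1]
        by (auto simp: \<rho>_def j_def strict_mono_def) 
      have pos4: "0 < minor W j (\<lambda>a. \<rho> (?d j a)) g"
      proof (rule less.hyps[OF _ comp])
        show "\<rho> (?d j i) - \<rho> (?d j 0) < f i - f 0"
          using last f0i by (simp add: j_def insert_index_def)
        show "\<forall>a<j. j - a \<le> R (\<rho> (?d j a))" (is "\<forall>a<j. ?G a")
        proof (intro allI impI)
          fix a assume "a < j"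
          then show "?G a"
            using g'[of a] g'[of "a - 1", OF less_imp_diff_less[OF \<open>a < j\<close>]] Rs m by (auto simp: \<rho>_def insert_index_def)
        qed
      qed
      \<comment> \<open>Omitting the first row moves the others forward in the list, which may
        violate the rank condition. Then the minor vanishes; nonnegativity is enough here because
        the other product in the relation is strictly positive.\<close>
      have pos5: "0 \<le> minor W j (\<lambda>a. \<rho> (?d 0 a)) g"
      proof (cases "\<forall>a<j. j - a \<le> R (\<rho> (?d 0 a))")
        case True
        have "0 < minor W j (\<lambda>a. \<rho> (?d 0 a)) g"
        proof (rule less.hyps[OF _ comp True])
          show "\<rho> (?d 0 i) - \<rho> (?d 0 0) < f i - f 0"
            using last f0i strict_monoD[OF \<rho>, of 0 1] by (simp add: j_def insert_index_def)
        qed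
        then show ?thesis by simp
      next
        case False
        then have "minor W j (\<lambda>a. \<rho> (?d 0 a)) g = 0"
          using zero[OF jk comp g, of 0] by (force simp: not_le)
        then show ?thesis by simp
      qed
      have "minor W j f g * minor W i (\<lambda>a. \<rho> (?d j (?d 0 a))) g =
          minor W j (\<lambda>a. \<rho> (?d 0 a)) g * minor W i (\<lambda>a. \<rho> (?d j (?d m a))) g +
          minor W j (\<lambda>a. \<rho> (?d j a)) g * minor W i (\<lambda>a. \<rho> (?d m (?d 0 a))) g"
        using plucker_relation[OF m(1,2), of "\<lambda>a b. W (\<rho> a) (g b)"]
        unfolding f_eq[symmetric] unfolding minor_def by (simp add: j_def)
      also have "\<dots> > 0" using pos2 pos3 pos4 pos5 by (simp add: add_nonneg_pos)
      finally show ?thesis using pos1 by (simp add: zero_less_mult_iff)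
    qed
  qed
  then show ?case using Suc.prems(2,4) by (simp add: j_def)
qed

section \<open>A strictly totally positive approximation of the identity\<close>

text \<open>Swapping values so that the last index becomes fixed changes the sum by
  \<open>(f j - f r) * (g j - g q)\<close>, a positive number; the rest is the induction
  hypothesis.\<close>

lemma rearrangement_strict:
  fixes f g :: "nat \<Rightarrow> int"
  assumes "p permutes {0..<j}"
    and "\<And>a b. a < b \<Longrightarrow> b < j \<Longrightarrow> f a < f b" "\<And>a b. a < b \<Longrightarrow> b < j \<Longrightarrow> g a < g b"
  shows "(\<Sum>a<j. f a * g (p a)) \<le> (\<Sum>a<j. f a * g a) \<and>
    (p \<noteq> id \<longrightarrow> (\<Sum>a<j. f a * g (p a)) < (\<Sum>a<j. f a * g a))"
  using assms
proof (induction j arbitrary: p)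
  case 0
  then show ?case by auto
next
  case (Suc j)
  note p = Suc.prems(1)
  have IH: "(\<Sum>a<j. f a * g (q a)) \<le> (\<Sum>a<j. f a * g a) \<and>
    (q \<noteq> id \<longrightarrow> (\<Sum>a<j. f a * g (q a)) < (\<Sum>a<j. f a * g a))" if "q permutes {0..<j}" for q
    by (rule Suc.IH[OF that]) (use Suc.prems in auto)
  show ?case
  proof (cases "p j = j")
    case True
    then have "p permutes {0..<j}"
      by (intro permutes_superset[OF p]) (auto simp: less_Suc_eq)
    then show ?thesis using IH[of p] True by (simp add: id_def)
  next
    case False
    define q where "q = p j"
    obtain r where pr: "p r = j" using permutes_surj[OF p] by (metis surjD)
    have "q \<in> {0..<Suc j}" using p by (simp add: q_def permutes_in_image)
    then have q: "q < j" using False by (simp add: q_def)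
    have "r \<in> {0..<Suc j}" using permutes_in_image[OF p, of r] pr by simp
    moreover have "r \<noteq> j" using pr False by auto
    ultimately have r: "r < j" by simp
    define p' where "p' = Transposition.transpose q j \<circ> p"
    have p': "p' permutes {0..<Suc j}"
      unfolding p'_def using p q by (intro permutes_compose permutes_swap_id) auto
    have p'j: "p' j = j" and p'r: "p' r = q" by (auto simp: p'_def q_def pr Transposition.transpose_def)
    have p'o: "p' a = p a" if "a \<noteq> j" "a \<noteq> r" for a
    proof -
      have "p a \<noteq> q" "p a \<noteq> j" using that p pr unfolding q_def by (metis permutes_def)+
      then show ?thesis by (simp add: p'_def Transposition.transpose_def)
    qed
    have "p' permutes {0..<j}"
      using p'j by (intro permutes_superset[OF p']) (auto simp: less_Suc_eq)
    then have le: "(\<Sum>a<j. f a * g (p' a)) \<le> (\<Sum>a<j. f a * g a)" using IH by blast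
    have "(\<Sum>a<j. f a * g (p' a)) - (\<Sum>a<j. f a * g (p a)) = (\<Sum>a<j. if a = r then f r * g q - f r * g j else 0)"
      unfolding sum_subtractf[symmetric] by (rule sum.cong) (auto simp: p'r pr p'o)
    also have "\<dots> = f r * g q - f r * g j" using r by simp
    finally have "(\<Sum>a<Suc j. f a * g (p a)) = (\<Sum>a<j. f a * g (p' a)) + f j * g j - (f j - f r) * (g j - g q)"
      by (simp add: q_def algebra_simps)
    moreover have "0 < (f j - f r) * (g j - g q)"
      using Suc.prems(2)[of r j] Suc.prems(3)[of q j] q r by (intro mult_pos_pos) auto
    ultimately have "(\<Sum>a<Suc j. f a * g (p a)) < (\<Sum>a<Suc j. f a * g a)" using le by simp
    then show ?thesis by simp
  qed
qed

text \<open>The discrete Gauss kernel. Expanding the square leaves \<open>- 2 * i * l\<close> as the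
  only term mixing rows and columns, so the least exponent in a minor is found by the rearrangement
  inequality. For \<epsilon> tending to 0 the kernel tends to the identity.\<close>

definition gauss_kernel :: "real \<Rightarrow> nat \<Rightarrow> nat \<Rightarrow> real" where
  "gauss_kernel \<epsilon> i l = \<epsilon> ^ nat ((int i - int l)\<^sup>2)"

text \<open>In the Leibniz expansion the identity permutation has the smallest exponent, so it dominates the
  other at most $j! - 1$ terms.\<close>

lemma minor_gauss_kernel_pos:
  assumes "0 < \<epsilon>" "\<epsilon> * fact j < 1" "strict_mono_on {..<j} f" "strict_mono_on {..<j} g"
  shows "0 < minor (gauss_kernel \<epsilon>) j f g"
proof -
  let ?P = "{p. p permutes {0..<j}}"
  define e where "e p = (\<Sum>a<j. nat ((int (f a) - int (g (p a)))\<^sup>2))" for p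
  have fin: "finite ?P" by (simp add: finite_permutations)
  have \<epsilon>1: "\<epsilon> < 1"
  proof -
    have "\<epsilon> * 1 \<le> \<epsilon> * fact j" using assms(1) by (intro mult_left_mono) (auto simp: fact_ge_1)
    then show ?thesis using assms(2) by linarith
  qed
  have lt: "e id < e p" if p: "p \<in> ?P" "p \<noteq> id" for p
  proof -
    have perm: "p permutes {0..<j}" using p by simp
    \<comment> \<open>A permutation does not change the sums of squares, so only the mixed term
      decides between exponents.\<close>
    have ie: "int (e q) = (\<Sum>a<j. (int (f a))\<^sup>2) + (\<Sum>a<j. (int (g (q a)))\<^sup>2) - 2 * (\<Sum>a<j. int (f a) * int (g (q a)))" for q
    proof -
      have "int (e q) = (\<Sum>a<j. (int (f a) - int (g (q a)))\<^sup>2)" by (simp add: e_def)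
      then show ?thesis
        by (simp add: power2_diff sum.distrib sum_subtractf sum_distrib_left algebra_simps)
    qed
    have "(\<Sum>a<j. (int (g (p a)))\<^sup>2) = (\<Sum>a<j. (int (g a))\<^sup>2)"
      using sum.permute[OF perm, of "\<lambda>a. (int (g a))\<^sup>2"] by (simp add: lessThan_atLeast0 comp_def)
    moreover have "(\<Sum>a<j. int (f a) * int (g (p a))) < (\<Sum>a<j. int (f a) * int (g a))"
      using rearrangement_strict[OF perm, of "\<lambda>a. int (f a)" "\<lambda>a. int (g a)"] assms(3,4) p(2)
      by (auto simp: strict_mono_on_def)
    ultimately have "int (e id) < int (e p)" unfolding ie by simp
    then show ?thesis by simp
  qed
  have summand: "signof p * (\<Prod>i = 0..<j. gauss_kernel \<epsilon> (f i) (g (p i))) = signof p * \<epsilon> ^ e p" for p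
    by (simp add: gauss_kernel_def e_def power_sum lessThan_atLeast0)
  have "minor (gauss_kernel \<epsilon>) j f g = (\<Sum>p\<in>?P. signof p * \<epsilon> ^ e p)"
    unfolding minor_def fdet_leibniz summand ..
  also have "\<dots> = \<epsilon> ^ e id + (\<Sum>p\<in>?P - {id}. signof p * \<epsilon> ^ e p)"
    using fin permutes_id by (subst sum.remove[of _ id]) auto
  also have "\<dots> \<ge> \<epsilon> ^ e id + (\<Sum>p\<in>?P - {id}. - (\<epsilon> * \<epsilon> ^ e id))"
  proof (intro add_left_mono sum_mono)
    fix p assume p: "p \<in> ?P - {id}"
    then have "\<epsilon> ^ e p \<le> \<epsilon> ^ Suc (e id)"
      using lt assms(1) \<epsilon>1 by (intro power_decreasing) (auto simp: Suc_le_eq)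
    moreover have "\<bar>signof p * \<epsilon> ^ e p\<bar> = \<epsilon> ^ e p" using assms(1) by (simp add: abs_mult sign_def)
    ultimately show "- (\<epsilon> * \<epsilon> ^ e id) \<le> signof p * \<epsilon> ^ e p" by simp
  qed
  moreover have "0 < \<epsilon> ^ e id + (\<Sum>p\<in>?P - {id}. - (\<epsilon> * \<epsilon> ^ e id))"
  proof -
    have "real (card (?P - {id})) * \<epsilon> \<le> fact j * \<epsilon>"
      using assms(1) fin by (intro mult_right_mono)
        (auto simp: card_permutations[of "{0..<j}" j] card_Diff_subset permutes_id)
    then have "0 < 1 - real (card (?P - {id})) * \<epsilon>" using assms(2) by (simp add: mult.commute)
    then have "0 < \<epsilon> ^ e id * (1 - real (card (?P - {id})) * \<epsilon>)" using assms(1) by simp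
    then show ?thesis by (simp add: algebra_simps)
  qed
  ultimately show ?thesis by linarith
qed

lemma gauss_kernel_tendsto: "((\<lambda>\<epsilon>. gauss_kernel \<epsilon> i l) \<longlongrightarrow> (if i = l then 1 else 0)) (at_right 0)"
proof (cases "i = l")
  case False
  then have "0 < (int i - int l)\<^sup>2" by simp
  then have "nat ((int i - int l)\<^sup>2) \<noteq> 0" by simp
  then have "((\<lambda>\<epsilon>::real. \<epsilon> ^ nat ((int i - int l)\<^sup>2)) \<longlongrightarrow> 0) (at_right 0)"
    by (auto intro!: tendsto_eq_intros)
  then show ?thesis using False by (simp add: gauss_kernel_def)
qed (simp add: gauss_kernel_def)

lemma minor_tendsto:
  assumes "\<And>a b. a < j \<Longrightarrow> b < j \<Longrightarrow> ((\<lambda>x. K x (f a) (g b)) \<longlongrightarrow> L (f a) (g b)) F"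
  shows "((\<lambda>x. minor (K x) j f g) \<longlongrightarrow> minor L j f g) F"
  unfolding minor_def fdet_leibniz
proof (intro tendsto_sum tendsto_mult tendsto_const tendsto_prod)
  fix p i assume "p \<in> {p. p permutes {0..<j}}" "i \<in> {0..<j}"
  then show "((\<lambda>x. K x (f i) (g (p i))) \<longlongrightarrow> L (f i) (g (p i))) F"
    using permutes_in_image[of p "{0..<j}" i] assms by simp
qed

section \<open>Row relations and rank of an orbit, and the passage from leading minors to all
  minors\<close>

section \<open>Rows generated by a positive matrix\<close>

text \<open>By the Cauchy--Binet formula the Gram determinant is the sum of the squared maximal minors.\<close>

lemma maximal_minors_zero_imp_dependent:
  fixes M :: "nat \<Rightarrow> nat \<Rightarrow> real"
  assumes "\<And>I. I \<in> set (lex_subsets n j) \<Longrightarrow> fdet j (\<lambda>a b. M a (I ! b)) = 0"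
  shows "\<exists>x. (\<exists>a<j. x a \<noteq> 0) \<and> (\<forall>l<n. (\<Sum>a<j. x a * M a l) = 0)"
proof -
  have "fdet j (\<lambda>a b. \<Sum>l<n. M a l * M b l) = 0"
    using cauchy_binet[where j = j and n = n and X = M and Y = "\<lambda>l b. M b l"] assms by simp
  then obtain x where x: "\<exists>a<j. x a \<noteq> 0" "\<forall>a<j. (\<Sum>b<j. (\<Sum>l<n. M a l * M b l) * x b) = 0"
    using fdet_kernel[of j "\<lambda>a b. \<Sum>l<n. M a l * M b l"] by blast
  have "(\<Sum>l<n. (\<Sum>a<j. x a * M a l)\<^sup>2) = (\<Sum>l<n. \<Sum>a<j. \<Sum>b<j. x a * (M a l * M b l * x b))"
    by (simp add: power2_eq_square sum_product mult_ac)
  also have "\<dots> = (\<Sum>a<j. \<Sum>l<n. \<Sum>b<j. x a * (M a l * M b l * x b))"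
    by (rule sum.swap)
  also have "\<dots> = (\<Sum>a<j. \<Sum>b<j. \<Sum>l<n. x a * (M a l * M b l * x b))"
    by (intro sum.cong refl sum.swap)
  also have "\<dots> = (\<Sum>a<j. x a * (\<Sum>b<j. (\<Sum>l<n. M a l * M b l) * x b))"
    by (simp add: sum_distrib_left sum_distrib_right)
  also have "\<dots> = 0" using x(2) by simp
  finally have "\<forall>l<n. (\<Sum>a<j. x a * M a l) = 0"
    by (subst (asm) sum_nonneg_eq_0_iff) auto
  then show ?thesis using x(1) by blast
qed

text \<open>Padding the transposed array with zero rows makes it square of size \<open>p\<close>;
  row \<open>r\<close> is zero, so it has a kernel vector.\<close>

lemma more_rows_than_cols_dependent:
  fixes C :: "nat \<Rightarrow> nat \<Rightarrow> real"
  assumes "r < p"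
  shows "\<exists>y. (\<exists>a<p. y a \<noteq> 0) \<and> (\<forall>i<r. (\<Sum>a<p. y a * C a i) = 0)"
proof -
  define M where "M i a = (if i < r then C a i else 0)" for i a
  have "fdet p M = 0" using assms by (intro fdet_zero_row[of r]) (auto simp: M_def)
  then obtain y where y: "\<exists>a<p. y a \<noteq> 0" "\<forall>i<p. (\<Sum>a<p. M i a * y a) = 0"
    using fdet_kernel[of p M] by blast
  have "(\<Sum>a<p. y a * C a i) = (\<Sum>a<p. M i a * y a)" if "i < r" for i
    using that by (simp add: M_def mult.commute)
  then have "\<forall>i<r. (\<Sum>a<p. y a * C a i) = 0" using y(2) assms by simp
  then show ?thesis using y(1) by blast
qed

lemma minor_zero_if_rows_dependent:
  assumes "a0 < j" "x a0 \<noteq> 0" "\<And>l. (\<Sum>a<j. x a * K (f a) l) = 0"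
  shows "minor K j f g = 0"
proof (rule ccontr)
  assume "minor K j f g \<noteq> 0"
  then have "fdet j (\<lambda>b a. K (f a) (g b)) \<noteq> 0" by (simp add: minor_def fdet_transpose[of j "\<lambda>a b. K (f a) (g b)"])
  then have "x a0 = 0"
    by (rule fdet_nonzero_imp_injective) (use assms in \<open>auto simp: mult.commute\<close>)
  then show False using assms by simp
qed

text \<open>Row \<open>t + d\<close> is a combination of the \<open>d\<close> rows from
  \<open>t\<close> on, with coefficients independent of the column. In an orbit array the least such
  \<open>d\<close> is the rank of all rows from \<open>t\<close> on.\<close>

definition monic_relation :: "(nat \<Rightarrow> nat \<Rightarrow> real) \<Rightarrow> nat \<Rightarrow> nat \<Rightarrow> bool" where
  "monic_relation K t d \<longleftrightarrow> (\<exists>p. \<forall>l. K (t + d) l = (\<Sum>i<d. p i * K (t + i) l))"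

text \<open>Solve the relation for the row with the last nonzero coefficient.\<close>

lemma monic_relation_if_dependent:
  assumes "i0 < j" "x i0 \<noteq> 0" "\<And>l. (\<Sum>i<j. x i * K (t + i) l) = 0"
  shows "\<exists>d<j. monic_relation K t d"
proof -
  define d where "d = (GREATEST d. d < j \<and> x d \<noteq> 0)"
  have d: "d < j" "x d \<noteq> 0"
    using GreatestI_nat[of "\<lambda>d. d < j \<and> x d \<noteq> 0" i0 j] assms(1,2) by (auto simp: d_def)
  have max: "x i = 0" if "d < i" "i < j" for i
    using Greatest_le_nat[of "\<lambda>d. d < j \<and> x d \<noteq> 0" i j] that by (auto simp: d_def)
  have "K (t + d) l = (\<Sum>i<d. (- x i / x d) * K (t + i) l)" for l
  proof -
    have "0 = (\<Sum>i<Suc d. x i * K (t + i) l)"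
      unfolding assms(3)[of l, symmetric] using d(1)
      by (intro sum.mono_neutral_right) (auto simp: max less_Suc_eq)
    then have "x d * K (t + d) l = - (\<Sum>i<d. x i * K (t + i) l)" by simp
    then have "K (t + d) l = - (\<Sum>i<d. x i * K (t + i) l) / x d" using d(2) by (simp add: field_simps)
    then show ?thesis by (simp add: sum_negf sum_divide_distrib)
  qed
  then show ?thesis using d(1) unfolding monic_relation_def
    by (intro exI[of _ d] conjI exI[of _ "\<lambda>i. - x i / x d"] allI)
qed

text \<open>The relation starting at row \<open>t + s - d\<close> expresses row \<open>t + s\<close>
  by earlier ones, so strong induction on \<open>s\<close> applies.\<close>

lemma rows_spanned_if_monic_relation:
  assumes "\<And>t'. t \<le> t' \<Longrightarrow> monic_relation K t' d"
  shows "\<exists>c. \<forall>l. K (t + s) l = (\<Sum>i<d. c i * K (t + i) l)"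
proof (induction s rule: less_induct)
  case (less s)
  show ?case
  proof (cases "s < d")
    case True
    have "K (t + s) l = (\<Sum>i<d. (if i = s then 1 else 0) * K (t + i) l)" for l
      using True by (simp add: if_distrib[of "\<lambda>x. x * _"] cong: if_cong)
    then show ?thesis by (intro exI[of _ "\<lambda>i. if i = s then 1 else 0"] allI)
  next
    case False
    define s' where "s' = s - d"
    obtain p where p: "\<forall>l. K (t + s' + d) l = (\<Sum>i<d. p i * K (t + s' + i) l)"
      using assms[of "t + s'"] by (auto simp: monic_relation_def)
    have "\<forall>i\<in>{..<d}. \<exists>c. \<forall>l. K (t + (s' + i)) l = (\<Sum>i'<d. c i' * K (t + i') l)"
    proof
      fix i assume "i \<in> {..<d}"
      then have "s' + i < s" using False by (simp add: s'_def)
      then show "\<exists>c. \<forall>l. K (t + (s' + i)) l = (\<Sum>i'<d. c i' * K (t + i') l)" by (rule less)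
    qed
    then obtain c where c: "\<And>i l. i < d \<Longrightarrow> K (t + (s' + i)) l = (\<Sum>i'<d. c i i' * K (t + i') l)"
      by (metis lessThan_iff)
    have "K (t + s) l = (\<Sum>i'<d. (\<Sum>i<d. p i * c i i') * K (t + i') l)" for l
    proof -
      have "K (t + s) l = (\<Sum>i<d. p i * (\<Sum>i'<d. c i i' * K (t + i') l))"
        using p[rule_format, of l] False c by (simp add: s'_def add.assoc)
      also have "\<dots> = (\<Sum>i'<d. (\<Sum>i<d. p i * c i i') * K (t + i') l)"
        unfolding sum_distrib_left sum_distrib_right by (subst sum.swap) (simp add: mult.assoc)
      finally show ?thesis .
    qed
    then show ?thesis by (intro exI[of _ "\<lambda>i'. \<Sum>i<d. p i * c i i'"]) simp
  qed
qed

text \<open>Each row is the previous one times \<open>A\<close>. Hence minors on consecutive rows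
  are propagated by the minors of \<open>A\<close>, which fixes their signs, and linear relations
  between rows are propagated as well, which gives the decreasing rank profile used in
  \<open>fekete\<close>.\<close>

theorem minors_nonneg_orbit:
  fixes K A :: "nat \<Rightarrow> nat \<Rightarrow> real"
  assumes step: "\<And>t l. K (Suc t) l = (\<Sum>i<n. K t i * A i l)"
    and A: "minors_nonneg k A"
    and zero: "\<And>t l. n \<le> l \<Longrightarrow> K t l = 0"
    and initial: "\<And>j g. j \<le> k \<Longrightarrow> strict_mono g \<Longrightarrow> 0 \<le> minor K j id g"
  shows "minors_nonneg k K"
proof -
  have consecutive: "0 \<le> minor K j (\<lambda>a. t + a) g" if "j \<le> k" "strict_mono_on {..<j} g" for t j g
    using that
  proof (induction t arbitrary: g)
    case 0
    obtain g' where "strict_mono g'" "\<And>a. a < j \<Longrightarrow> g' a = g a"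
      using strict_mono_extend[OF 0(2)] by blast
    moreover from this have "minor K j (\<lambda>a. 0 + a) g = minor K j id g'" by (intro minor_cong) auto
    ultimately show ?case using initial 0 by simp
  next
    case (Suc t)
    have "minor K j (\<lambda>a. Suc t + a) g = minor (\<lambda>i l. K (Suc i) l) j (\<lambda>a. t + a) g"
      by (rule minor_cong) simp
    also have "\<dots> = (\<Sum>I\<in>set (lex_subsets n j). minor K j (\<lambda>a. t + a) ((!) I) * minor A j ((!) I) g)"
      by (rule minor_cauchy_binet) (simp add: step)
    also have "\<dots> \<ge> 0"
    proof (intro sum_nonneg mult_nonneg_nonneg)
      fix I assume "I \<in> set (lex_subsets n j)"
      then have I: "strict_mono_on {..<j} ((!) I)" using strict_mono_on_nth[of I] by (auto simp: set_lex_subsets)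
      show "0 \<le> minor K j (\<lambda>a. t + a) ((!) I)" by (rule Suc.IH[OF Suc.prems(1) I])
      show "0 \<le> minor A j ((!) I) g" using A Suc.prems I by (intro minors_nonnegD) auto
    qed
    finally show ?case .
  qed
  have rel_Suc: "monic_relation K (Suc t) d" if rel: "monic_relation K t d" for t d
  proof -
    obtain p where p: "\<forall>l. K (t + d) l = (\<Sum>i<d. p i * K (t + i) l)"
      using rel by (auto simp: monic_relation_def)
    have "K (Suc t + d) l = (\<Sum>i<d. p i * K (Suc t + i) l)" for l
    proof -
      have "K (Suc t + d) l = (\<Sum>m<n. \<Sum>i<d. p i * (K (t + i) m * A m l))"
        by (simp add: step p sum_distrib_right mult.assoc)
      also have "\<dots> = (\<Sum>i<d. p i * K (Suc t + i) l)"
        by (subst sum.swap) (simp add: step sum_distrib_left)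
      finally show ?thesis .
    qed
    then show ?thesis by (auto simp: monic_relation_def)
  qed
  have rel_mono: "monic_relation K t' d" if "monic_relation K t d" "t \<le> t'" for t t' d
    using that(2,1) by (induction t' rule: dec_induct) (auto intro: rel_Suc)
  have rel_ex: "\<exists>d. monic_relation K t d" for t
  proof -
    obtain y a where y: "a < Suc n" "y a \<noteq> 0" "\<forall>i<n. (\<Sum>a<Suc n. y a * K (t + a) i) = 0"
      using more_rows_than_cols_dependent[of n "Suc n" "\<lambda>a i. K (t + a) i"] by blast
    have "(\<Sum>a<Suc n. y a * K (t + a) l) = 0" for l
      using y(3) zero by (cases "l < n") auto
    then show ?thesis using monic_relation_if_dependent[of a "Suc n" y K t] y(1,2) by blast
  qed
  define R where "R t = (LEAST d. monic_relation K t d)" for t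
  have R: "monic_relation K t (R t)" for t using rel_ex[of t] unfolding R_def by (metis LeastI)
  have R_le: "R t \<le> d" if "monic_relation K t d" for t d using that unfolding R_def by (rule Least_le)
  have antimono_R: "antimono R" using R R_le rel_mono by (intro antimonoI) blast
  \<comment> \<open>The \<open>j - a0\<close> rows from \<open>f a0\<close> on lie in the span of
    \<open>R (f a0)\<close> rows, so too many of them are dependent.\<close>
  have degenerate: "minor K j f g = 0" if a0: "a0 < j" and lt: "R (f a0) < j - a0" and f: "strict_mono f" for j f g a0
  proof -
    let ?t = "f a0"
    have "\<exists>c. \<forall>l. K (f (a0 + a)) l = (\<Sum>i<R ?t. c i * K (?t + i) l)" for a
    proof -
      have "?t \<le> f (a0 + a)" using f by (simp add: strict_mono_less_eq)
      then obtain s where "f (a0 + a) = ?t + s" using le_Suc_ex by blast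
      then show ?thesis using rows_spanned_if_monic_relation[of ?t K "R ?t" s] rel_mono[OF R] by simp
    qed
    then obtain c where c: "\<And>a l. K (f (a0 + a)) l = (\<Sum>i<R ?t. c a i * K (?t + i) l)" by metis
    obtain y a1 where y: "a1 < j - a0" "y a1 \<noteq> 0" "\<forall>i<R ?t. (\<Sum>a<j - a0. y a * c a i) = 0"
      using more_rows_than_cols_dependent[OF lt, of c] by blast
    show ?thesis
    proof (rule minor_zero_if_rows_dependent[of "a0 + a1" j "\<lambda>a. if a0 \<le> a then y (a - a0) else 0"])
      fix l
      have "(\<Sum>a<j. (if a0 \<le> a then y (a - a0) else 0) * K (f a) l) =
          (\<Sum>a\<in>{a0..<j}. y (a - a0) * K (f a) l)"
        by (intro sum.mono_neutral_cong_right) auto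
      also have "\<dots> = (\<Sum>a<j - a0. y a * K (f (a0 + a)) l)"
        using a0 by (intro sum.reindex_bij_witness[of _ "\<lambda>a. a0 + a" "\<lambda>a. a - a0"]) auto
      also have "\<dots> = (\<Sum>i<R ?t. (\<Sum>a<j - a0. y a * c a i) * K (?t + i) l)"
        unfolding c sum_distrib_left sum_distrib_right by (subst sum.swap) (simp add: mult.assoc)
      also have "\<dots> = 0" using y(3) by simp
      finally show "(\<Sum>a<j. (if a0 \<le> a then y (a - a0) else 0) * K (f a) l) = 0" .
    qed (use y in auto)
  qed
  \<comment> \<open>Dependence of these \<open>j\<close> rows would give a monic relation shorter
    than \<open>R t\<close>.\<close>
  have regular: "\<exists>I\<in>set (lex_subsets n j). minor K j (\<lambda>a. t + a) ((!) I) \<noteq> 0" if "j \<le> R t" for t j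
  proof (rule ccontr)
    assume "\<not> ?thesis"
    then obtain x a where x: "a < j" "x a \<noteq> 0" "\<forall>l<n. (\<Sum>a<j. x a * K (t + a) l) = 0"
      using maximal_minors_zero_imp_dependent[of n j "\<lambda>a l. K (t + a) l"] unfolding minor_def by blast
    have "(\<Sum>a<j. x a * K (t + a) l) = 0" for l using x(3) zero by (cases "l < n") auto
    then obtain d where "d < j" "monic_relation K t d"
      using monic_relation_if_dependent[of a j x K t, OF x(1,2)] by blast
    then show False using R_le that by fastforce
  qed
  \<comment> \<open>Being a product with \<open>K\<close> on the left, \<open>W \<epsilon>\<close>
    inherits the vanishing of degenerate minors from \<open>K\<close> through Cauchy--Binet.\<close>
  define W where "W \<epsilon> i l = (\<Sum>m<n. K i m * gauss_kernel \<epsilon> m l)" for \<epsilon> i l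
  have CB: "minor (W \<epsilon>) j f g =
      (\<Sum>I\<in>set (lex_subsets n j). minor K j f ((!) I) * minor (gauss_kernel \<epsilon>) j ((!) I) g)" for \<epsilon> j f g
    by (rule minor_cauchy_binet) (simp add: W_def)
  have nonneg: "0 \<le> minor (W \<epsilon>) j f g"
    if \<epsilon>: "0 < \<epsilon>" "\<epsilon> * fact k < 1" and j: "j \<le> k" and f: "strict_mono f" and g: "strict_mono g" for \<epsilon> j f g
  proof -
    \<comment> \<open>The bound with \<open>fact k\<close> lets one \<epsilon> serve every order up
      to \<open>k\<close>.\<close>
    have gauss: "0 < minor (gauss_kernel \<epsilon>) i ((!) I) g" if "I \<in> set (lex_subsets n i)" "i \<le> k" "strict_mono g" for i I g
    proof (rule minor_gauss_kernel_pos[OF \<epsilon>(1)])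
      have "\<epsilon> * fact i \<le> \<epsilon> * fact k" using \<epsilon>(1) that(2) by (intro mult_left_mono fact_mono) auto
      then show "\<epsilon> * fact i < 1" using \<epsilon>(2) by linarith
    qed (use that strict_mono_on_nth[of I] in \<open>auto simp: set_lex_subsets strict_mono_def strict_mono_on_def\<close>)
    have zeroW: "minor (W \<epsilon>) i f g = 0" if "strict_mono f" "\<exists>a<i. R (f a) < i - a" for i f g
      unfolding CB using degenerate that by (intro sum.neutral) force
    show ?thesis
    proof (cases "\<exists>a<j. R (f a) < j - a")
      case True
      then show ?thesis using zeroW f by simp
    next
      case False
      have "0 < minor (W \<epsilon>) j f g"
      proof (rule fekete[OF antimono_R, of k "Collect strict_mono"])
        fix i t and g :: "nat \<Rightarrow> nat" assume i: "i \<le> k" "g \<in> Collect strict_mono" "\<forall>a<i. i - a \<le> R (t + a)"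
        have "i \<le> R t" using i(3) by (cases "i = 0") auto
        \<comment> \<open>One nonzero minor of \<open>K\<close> is enough: all minors of
          \<open>K\<close> on these consecutive rows are nonnegative and all Gauss minors positive,
          so the Cauchy--Binet sum is strictly positive for every \<open>g\<close>.\<close>
        then obtain I where I: "I \<in> set (lex_subsets n i)" "minor K i (\<lambda>a. t + a) ((!) I) \<noteq> 0"
          using regular by blast
        have ge: "0 \<le> minor K i (\<lambda>a. t + a) ((!) I)" if "I \<in> set (lex_subsets n i)" for I
          using consecutive[OF i(1)] strict_mono_on_nth[of I] that by (auto simp: set_lex_subsets)
        show "0 < minor (W \<epsilon>) i (\<lambda>a. t + a) g"
          unfolding CB
        proof (rule sum_pos2[OF _ I(1)])
          show "0 < minor K i (\<lambda>a. t + a) ((!) I) * minor (gauss_kernel \<epsilon>) i ((!) I) g"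
            using I ge[OF I(1)] gauss[OF I(1) i(1)] i(2) by simp
          show "0 \<le> minor K i (\<lambda>a. t + a) ((!) I) * minor (gauss_kernel \<epsilon>) i ((!) I) g"
            if "I \<in> set (lex_subsets n i)" for I
            using ge[OF that] gauss[OF that i(1)] i(2) by (simp add: less_imp_le)
        qed simp
      next
        show "\<forall>a<j. j - a \<le> R (f a)" using False by (meson not_less)
      qed (use zeroW j f g in auto)
      then show ?thesis by simp
    qed
  qed
  show ?thesis
    unfolding minors_nonneg_def
  proof (intro allI impI)
    fix j :: nat and f g :: "nat \<Rightarrow> nat"
    assume j: "j \<le> k" and f: "strict_mono f" and g: "strict_mono g"
    \<comment> \<open>Columns from \<open>n\<close> on need not vanish in
      \<open>W \<epsilon>\<close>, but they tend to 0, which is the value in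
      \<open>K\<close>.\<close>
    have WK: "((\<lambda>\<epsilon>. W \<epsilon> i l) \<longlongrightarrow> K i l) (at_right 0)" for i l
    proof -
      have "((\<lambda>\<epsilon>. W \<epsilon> i l) \<longlongrightarrow> (\<Sum>m<n. K i m * (if m = l then 1 else 0))) (at_right 0)"
        unfolding W_def by (intro tendsto_sum tendsto_mult tendsto_const gauss_kernel_tendsto)
      moreover have "(\<Sum>m<n. K i m * (if m = l then 1 else 0)) = K i l"
        using zero[of l i] by (simp add: if_distrib[of "\<lambda>x. _ * x"] not_less cong: if_cong)
      ultimately show ?thesis by simp
    qed
    have ev: "eventually (\<lambda>\<epsilon>. 0 \<le> minor (W \<epsilon>) j f g) (at_right 0)"
    proof (rule eventually_at_rightI[of 0 "1 / fact k"])
      fix \<epsilon> :: real assume "\<epsilon> \<in> {0<..<1 / fact k}"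
      then show "0 \<le> minor (W \<epsilon>) j f g" using j f g by (intro nonneg) (auto simp: field_simps)
    qed simp
    show "0 \<le> minor K j f g"
      using tendsto_lowerbound[OF minor_tendsto[of j W f g K "at_right 0", OF WK] ev] by simp
  qed
qed

section \<open>Linear systems: annihilating recurrences, Markov parameters, minimality\<close>

section \<open>The Cayley--Hamilton theorem for Krylov sequences\<close>

text \<open>Compare coefficients in \<open>(x I - A) adj(x I - A) = \<chi>(x) I\<close>, where
  \<chi> is the characteristic polynomial. Weighted with powers of \<open>A\<close>, the
  contributions telescope.\<close>

lemma cayley_hamilton_entry:
  fixes A :: "'a::comm_ring_1 Matrix.mat"
  assumes A: "A \<in> carrier_mat n n" and ij: "i < n" "j < n"
  shows "(\<Sum>k\<le>n. coeff (char_poly A) k * (A ^\<^sub>m k) $$ (i, j)) = 0"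
proof -
  let ?C = "char_poly_matrix A"
  have C: "?C \<in> carrier_mat n n" using A by simp
  define adj where "adj = adj_mat ?C"
  have adj: "adj \<in> carrier_mat n n" "?C * adj = char_poly A \<cdot>\<^sub>m 1\<^sub>m n"
    using adj_mat[OF C] by (auto simp: adj_def char_poly_def)
  define B where "B k l = coeff (adj $$ (l, j)) k" for k l
  have eq: "(if l = j then coeff (char_poly A) k else 0) =
      (if k = 0 then 0 else B (k - 1) l) - (\<Sum>m<n. A $$ (l, m) * B k m)" if l: "l < n" for k l
  proof -
    have "(char_poly A \<cdot>\<^sub>m 1\<^sub>m n) $$ (l, j) = (\<Sum>m<n. ?C $$ (l, m) * adj $$ (m, j))"
      unfolding adj(2)[symmetric] using C adj(1) l ij by (auto simp: scalar_prod_def lessThan_atLeast0)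
    also have "\<dots> = (\<Sum>m<n. (if l = m then pCons 0 (adj $$ (m, j)) else 0) - Polynomial.smult (A $$ (l, m)) (adj $$ (m, j)))"
      using A l by (intro sum.cong) (auto simp: char_poly_matrix_def algebra_simps)
    also have "\<dots> = pCons 0 (adj $$ (l, j)) - (\<Sum>m<n. Polynomial.smult (A $$ (l, m)) (adj $$ (m, j)))"
      using l by (simp add: sum_subtractf)
    finally have "coeff ((char_poly A \<cdot>\<^sub>m 1\<^sub>m n) $$ (l, j)) k =
        coeff (pCons 0 (adj $$ (l, j)) - (\<Sum>m<n. Polynomial.smult (A $$ (l, m)) (adj $$ (m, j)))) k" by simp
    then show ?thesis using l ij by (auto simp: B_def coeff_sum coeff_pCons split: nat.splits)
  qed
  have pow: "(A ^\<^sub>m Suc N) $$ (i, m) = (\<Sum>l<n. (A ^\<^sub>m N) $$ (i, l) * A $$ (l, m))" if "m < n" for N m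
    using A that ij by (auto simp: scalar_prod_def lessThan_atLeast0)
  \<comment> \<open>The partial sum up to \<open>N\<close> leaves one remainder, formed with the
    coefficients of order \<open>N\<close> of the adjugate; it vanishes once \<open>N\<close>
    exceeds their degrees.\<close>
  have T: "(\<Sum>k\<le>N. coeff (char_poly A) k * (A ^\<^sub>m k) $$ (i, j)) =
      - (\<Sum>m<n. (A ^\<^sub>m Suc N) $$ (i, m) * B N m)" for N
  proof (induction N)
    case 0
    have "coeff (char_poly A) 0 * (1\<^sub>m n) $$ (i, j) = (if i = j then coeff (char_poly A) 0 else 0)"
      using ij by simp
    then show ?case using eq[of i 0] A ij by (simp add: pow)
  next
    case (Suc N)
    have "coeff (char_poly A) (Suc N) * (A ^\<^sub>m Suc N) $$ (i, j) =
        (\<Sum>l<n. (A ^\<^sub>m Suc N) $$ (i, l) * (if l = j then coeff (char_poly A) (Suc N) else 0))"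
      using ij by (simp add: if_distrib[of "\<lambda>x. _ * x"] mult.commute cong: if_cong del: pow_mat.simps)
    also have "\<dots> = (\<Sum>l<n. (A ^\<^sub>m Suc N) $$ (i, l) * (B N l - (\<Sum>m<n. A $$ (l, m) * B (Suc N) m)))"
      by (intro sum.cong) (simp_all add: eq del: pow_mat.simps)
    also have "\<dots> = (\<Sum>l<n. (A ^\<^sub>m Suc N) $$ (i, l) * B N l) -
        (\<Sum>l<n. \<Sum>m<n. (A ^\<^sub>m Suc N) $$ (i, l) * A $$ (l, m) * B (Suc N) m)"
      by (simp add: right_diff_distrib sum_subtractf sum_distrib_left mult.assoc del: pow_mat.simps)
    also have "(\<Sum>l<n. \<Sum>m<n. (A ^\<^sub>m Suc N) $$ (i, l) * A $$ (l, m) * B (Suc N) m) =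
        (\<Sum>m<n. (A ^\<^sub>m Suc (Suc N)) $$ (i, m) * B (Suc N) m)"
      by (subst sum.swap) (simp add: pow[of _ "Suc N"] sum_distrib_right del: pow_mat.simps)
    finally show ?case using Suc.IH by (simp del: pow_mat.simps)
  qed
  define N where "N = Max (insert n ((\<lambda>l. Suc (degree (adj $$ (l, j)))) ` {..<n}))"
  have N: "n \<le> N" "\<And>l. l < n \<Longrightarrow> degree (adj $$ (l, j)) < N"
    unfolding N_def by (auto simp: Suc_le_eq[symmetric] intro!: Max_ge)
  have "(\<Sum>k\<le>N. coeff (char_poly A) k * (A ^\<^sub>m k) $$ (i, j)) = 0"
    unfolding T using N by (simp add: B_def coeff_eq_0)
  moreover have "(\<Sum>k\<le>N. coeff (char_poly A) k * (A ^\<^sub>m k) $$ (i, j)) =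
      (\<Sum>k\<le>n. coeff (char_poly A) k * (A ^\<^sub>m k) $$ (i, j))"
    using N(1) degree_monic_char_poly[OF A] by (intro sum.mono_neutral_right) (auto simp: coeff_eq_0)
  ultimately show ?thesis by simp
qed

lemma pow_mat_add:
  fixes A :: "'a::comm_ring_1 Matrix.mat"
  assumes "A \<in> carrier_mat n n"
  shows "A ^\<^sub>m (k + m) = A ^\<^sub>m k * A ^\<^sub>m m"
  using assms by (induction m) (auto simp: assoc_mult_mat[of _ n n _ n _ n, symmetric])

text \<open>For the input and output vectors of a system these are its Markov parameters. The vector
  \<open>b\<close> is also replaced by resolvent vectors below, over the complex numbers.\<close>

definition krylov :: "'a::comm_ring_1 Matrix.mat \<Rightarrow> 'a Matrix.vec \<Rightarrow> 'a Matrix.vec \<Rightarrow> nat \<Rightarrow> 'a" where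
  "krylov A c b i = scalar_prod c ((A ^\<^sub>m i) *\<^sub>v b)"

lemma krylov_expand:
  assumes "A \<in> carrier_mat n n" "b \<in> carrier_vec n" "c \<in> carrier_vec n"
  shows "krylov A c b k = (\<Sum>i<n. \<Sum>j<n. vec_index c i * (A ^\<^sub>m k) $$ (i, j) * vec_index b j)"
  using assms
  by (auto simp: krylov_def scalar_prod_def lessThan_atLeast0 sum_distrib_left mult.assoc intro!: sum.cong)

lemma krylov_shift:
  assumes "A \<in> carrier_mat n n" "b \<in> carrier_vec n"
  shows "krylov A c ((A ^\<^sub>m m) *\<^sub>v b) k = krylov A c b (k + m)"
  using assoc_mult_mat_vec[of "A ^\<^sub>m k" n n "A ^\<^sub>m m" n b]
    pow_mat_add[OF assms(1)] assms by (simp add: krylov_def)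

lemma krylov_recurrence:
  assumes "A \<in> carrier_mat n n" "b \<in> carrier_vec n" "c \<in> carrier_vec n"
  shows "(\<Sum>k\<le>n. coeff (char_poly A) k * krylov A c b (k + m)) = 0"
proof -
  let ?v = "(A ^\<^sub>m m) *\<^sub>v b"
  have v: "?v \<in> carrier_vec n"
    using assms by (intro mult_mat_vec_carrier[of _ n n] pow_carrier_mat)
  have "(\<Sum>k\<le>n. coeff (char_poly A) k * krylov A c b (k + m)) =
      (\<Sum>k\<le>n. \<Sum>i<n. \<Sum>j<n. vec_index c i * vec_index ?v j * (coeff (char_poly A) k * (A ^\<^sub>m k) $$ (i, j)))"
    unfolding krylov_shift[OF assms(1,2), symmetric] krylov_expand[OF assms(1) v assms(3)]
    by (simp add: sum_distrib_left mult_ac)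
  also have "\<dots> = (\<Sum>i<n. \<Sum>j<n. \<Sum>k\<le>n. vec_index c i * vec_index ?v j * (coeff (char_poly A) k * (A ^\<^sub>m k) $$ (i, j)))"
    by (subst sum.swap, rule sum.cong[OF refl], rule sum.swap)
  also have "\<dots> = 0"
    using cayley_hamilton_entry[OF assms(1)] by (simp flip: sum_distrib_left)
  finally show ?thesis .
qed

section \<open>Transfer functions and Markov parameters\<close>

text \<open>The polynomial part of \<open>p(z)\<close> times the formal series with terms
  \<open>h j * z^(-j-1)\<close>.\<close>

definition numerator :: "'a::comm_ring_1 poly \<Rightarrow> (nat \<Rightarrow> 'a) \<Rightarrow> 'a poly" where
  "numerator p h = (\<Sum>i\<le>degree p. \<Sum>j<i. monom (coeff p i * h j) (i - 1 - j))"

text \<open>\<open>g i\<close> stands for \<open>c A^i (zI - A)^(-1) b\<close>; unrolling the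
  recurrence expresses it by \<open>g 0\<close>. The last sum is \<open>p(A)\<close> inserted before
  the resolvent, and it vanishes when \<open>p\<close> annihilates the sequence.\<close>

lemma poly_times_first:
  fixes z :: "'a::comm_ring_1"
  assumes "\<And>i. z * g i - g (Suc i) = h i"
  shows "poly p z * g 0 = poly (numerator p h) z + (\<Sum>i\<le>degree p. coeff p i * g i)"
proof -
  have g: "g i = z ^ i * g 0 - (\<Sum>j<i. z ^ (i - 1 - j) * h j)" for i
  proof (induction i)
    case (Suc i)
    have "g (Suc i) = z * g i - h i" using assms[of i] by (simp add: algebra_simps)
    also have "\<dots> = z ^ Suc i * g 0 - ((\<Sum>j<i. z * (z ^ (i - 1 - j) * h j)) + h i)"
      unfolding Suc.IH by (simp add: algebra_simps sum_distrib_left)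
    also have "(\<Sum>j<i. z * (z ^ (i - 1 - j) * h j)) = (\<Sum>j<i. z ^ (Suc i - 1 - j) * h j)"
    proof (rule sum.cong[OF refl])
      fix j assume "j \<in> {..<i}"
      then have "Suc i - 1 - j = Suc (i - 1 - j)" by auto
      then show "z * (z ^ (i - 1 - j) * h j) = z ^ (Suc i - 1 - j) * h j" by (simp add: mult.assoc)
    qed
    finally show ?case by simp
  qed simp
  have "(\<Sum>i\<le>degree p. coeff p i * g i) =
      (\<Sum>i\<le>degree p. coeff p i * z ^ i * g 0 - (\<Sum>j<i. coeff p i * h j * z ^ (i - 1 - j)))"
  proof (rule sum.cong[OF refl])
    fix i
    show "coeff p i * g i = coeff p i * z ^ i * g 0 - (\<Sum>j<i. coeff p i * h j * z ^ (i - 1 - j))"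
      by (subst g) (simp add: right_diff_distrib sum_distrib_left mult_ac)
  qed
  also have "\<dots> = poly p z * g 0 - poly (numerator p h) z"
    by (simp add: sum_subtractf poly_altdef[of p] numerator_def poly_sum poly_monom sum_distrib_right)
  finally show ?thesis by simp
qed

text \<open>The witness is \<open>krylov A c x\<close> for the resolvent vector \<open>x\<close>,
  which satisfies \<open>z x - A x = b\<close>.\<close>

lemma resolvent_sequence:
  fixes A :: "complex Matrix.mat"
  assumes A: "A \<in> carrier_mat n n" and b: "b \<in> carrier_vec n" and c: "c \<in> carrier_vec n"
    and z: "\<not> eigenvalue A z"
  shows "\<exists>g. g 0 = scalar_prod c (the (mat_inverse (z \<cdot>\<^sub>m 1\<^sub>m n - A)) *\<^sub>v b) \<and>
    (\<forall>i. z * g i - g (Suc i) = krylov A c b i) \<and>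
    (\<forall>m. (\<Sum>k\<le>n. coeff (char_poly A) k * g (k + m)) = 0)"
proof -
  let ?M = "z \<cdot>\<^sub>m 1\<^sub>m n - A"
  have M: "?M \<in> carrier_mat n n" using A by (intro minus_carrier_mat)
  have "- char_matrix A z = ?M" using A by (auto simp: char_matrix_def intro!: eq_matI)
  then have "Determinant.det ?M \<noteq> 0"
    using z eigenvalue_det[OF A] det_0_negate[of "char_matrix A z" n] A by auto
  then have "?M \<in> Units (ring_mat TYPE(complex) n ())" using M by (rule det_non_zero_imp_unit[rotated])
  then obtain B where B: "mat_inverse ?M = Some B"
    using mat_inverse(1)[OF M, where b = "()"] by (cases "mat_inverse ?M") auto
  then have inv: "?M * B = 1\<^sub>m n" "B \<in> carrier_mat n n" using mat_inverse(2)[OF M] by auto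
  define x where "x = B *\<^sub>v b"
  have x: "x \<in> carrier_vec n" using inv b by (simp add: x_def)
  have "?M *\<^sub>v x = b"
    unfolding x_def using assoc_mult_mat_vec[OF M inv(2) b] inv(1) b by simp
  moreover have "(z \<cdot>\<^sub>m 1\<^sub>m n) *\<^sub>v x = z \<cdot>\<^sub>v x"
    using x by (intro eq_vecI) (auto simp: scalar_prod_def mult_delta_left mult_delta_right)
  ultimately have zx: "z \<cdot>\<^sub>v x - A *\<^sub>v x = b"
    using A x minus_mult_distrib_mat_vec[of "z \<cdot>\<^sub>m 1\<^sub>m n" n n A x] by simp
  have "z * krylov A c x i - krylov A c x (Suc i) = krylov A c b i" for i
  proof -
    have P: "A ^\<^sub>m i \<in> carrier_mat n n" using A by simp
    have "krylov A c b i = scalar_prod c ((A ^\<^sub>m i) *\<^sub>v (z \<cdot>\<^sub>v x) - (A ^\<^sub>m i) *\<^sub>v (A *\<^sub>v x))"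
      unfolding krylov_def zx[symmetric] using A x P
      by (subst mult_minus_distrib_mat_vec[of _ n n]) auto
    also have "\<dots> = scalar_prod c (z \<cdot>\<^sub>v ((A ^\<^sub>m i) *\<^sub>v x) - (A ^\<^sub>m Suc i) *\<^sub>v x)"
      using mult_mat_vec[OF P x] assoc_mult_mat_vec[OF P A x] by simp
    also have "\<dots> = z * krylov A c x i - krylov A c x (Suc i)"
      unfolding krylov_def
      using mult_mat_vec_carrier[OF P x] mult_mat_vec_carrier[OF pow_carrier_mat[OF A, of "Suc i"] x] c
      by (subst scalar_prod_minus_distrib[of _ n]) auto
    finally show ?thesis by simp
  qed
  moreover have "(\<Sum>k\<le>n. coeff (char_poly A) k * krylov A c x (k + m)) = 0" for m
    by (rule krylov_recurrence[OF A x c])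
  moreover have "krylov A c x 0 = scalar_prod c (the (mat_inverse ?M) *\<^sub>v b)"
    using A x B by (simp add: krylov_def x_def)
  ultimately show ?thesis by blast
qed

definition markov :: "real Matrix.mat \<Rightarrow> real Matrix.vec \<Rightarrow> real Matrix.vec \<Rightarrow> nat \<Rightarrow> complex" where
  "markov A c b i = complex_of_real (krylov A c b i)"

lemma krylov_of_real:
  assumes "A \<in> carrier_mat n n" "b \<in> carrier_vec n" "c \<in> carrier_vec n"
  shows "krylov (cmat A) (cvec c) (cvec b) i = markov A c b i"
proof -
  have "cmat A ^\<^sub>m i = cmat (A ^\<^sub>m i)" using assms(1) by (simp add: of_real_hom.mat_hom_pow)
  then show ?thesis using assms
    by (auto simp: markov_def krylov_def scalar_prod_def intro!: sum.cong)
qed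

lemma transfer_value_sequence:
  assumes A: "A \<in> carrier_mat n n" and b: "b \<in> carrier_vec n" and c: "c \<in> carrier_vec n"
    and z: "poly (char_poly (cmat A)) z \<noteq> 0"
  shows "\<exists>g. g 0 = transfer_value A b c z \<and> (\<forall>i. z * g i - g (Suc i) = markov A c b i) \<and>
    (\<forall>m. (\<Sum>k\<le>n. coeff (char_poly (cmat A)) k * g (k + m)) = 0)"
proof -
  have cA: "cmat A \<in> carrier_mat n n" using A by simp
  have "\<not> eigenvalue (cmat A) z" using z eigenvalue_root_char_poly[OF cA] by simp
  from resolvent_sequence[OF cA _ _ this, of "cvec b" "cvec c"] show ?thesis
    using A b c by (simp add: transfer_value_def krylov_of_real)
qed

lemma transfer_value_eq:
  assumes A: "A \<in> carrier_mat n n" and b: "b \<in> carrier_vec n" and c: "c \<in> carrier_vec n"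
    and z: "poly (char_poly (cmat A)) z \<noteq> 0"
  shows "transfer_value A b c z =
    poly (numerator (char_poly (cmat A)) (markov A c b)) z / poly (char_poly (cmat A)) z"
proof -
  obtain g where g: "g 0 = transfer_value A b c z" "\<forall>i. z * g i - g (Suc i) = markov A c b i"
    "\<forall>m. (\<Sum>k\<le>n. coeff (char_poly (cmat A)) k * g (k + m)) = 0"
    using transfer_value_sequence[OF assms] by blast
  have "degree (char_poly (cmat A)) = n" using degree_monic_char_poly[of "cmat A" n] A by simp
  then have "poly (char_poly (cmat A)) z * g 0 =
      poly (numerator (char_poly (cmat A)) (markov A c b)) z"
    using poly_times_first[of z g "markov A c b" "char_poly (cmat A)"] g(2) g(3)[rule_format, of 0] by simp
  then show ?thesis using z g(1) by (simp add: field_simps)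
qed

lemma poly_eq_if_eq_off_roots:
  fixes p q r :: "complex poly"
  assumes "r \<noteq> 0" "\<And>z. poly r z \<noteq> 0 \<Longrightarrow> poly p z = poly q z"
  shows "p = q"
proof -
  have "poly (r * (p - q)) z = 0" for z using assms(2)[of z] by (cases "poly r z = 0") auto
  then have "r * (p - q) = 0" using poly_all_0_iff_0 by blast
  then show ?thesis using assms(1) by simp
qed

text \<open>A common root would cancel: the order of \<open>G\<close> at \<open>l\<close> is the
  order of \<open>q\<close> minus that of \<open>\<chi>\<close>, so the pole would be of smaller
  multiplicity than the root of \<open>\<chi>\<close>. For \<open>q = 0\<close> there is no pole at
  all.\<close>

lemma no_common_root_if_pole_mult:
  fixes \<chi> q :: "complex poly"
  assumes \<chi>: "\<chi> \<noteq> 0" and G: "\<And>z. poly \<chi> z \<noteq> 0 \<Longrightarrow> G z = poly q z / poly \<chi> z"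
    and ord: "Polynomial.order l \<chi> = pole_mult G l" and root: "poly \<chi> l = 0"
  shows "poly q l \<noteq> 0"
proof
  assume ql: "poly q l = 0"
  have o: "0 < Polynomial.order l \<chi>" using root \<chi> by (simp add: order_root)
  then have pole: "is_pole G l" and zo: "nat (- zorder G l) = Polynomial.order l \<chi>"
    using ord by (auto simp: pole_mult_def split: if_splits)
  obtain \<chi>1 where \<chi>1: "\<chi> = [:- l, 1:] ^ Polynomial.order l \<chi> * \<chi>1" "poly \<chi>1 l \<noteq> 0"
    using order_decomp[OF \<chi>, of l] by (metis poly_eq_0_iff_dvd)
  have fin: "finite ({w. poly \<chi> w = 0} - {l})" using poly_roots_finite[OF \<chi>] by simp
  define S where "S = - ({w. poly \<chi> w = 0} - {l})"
  have S: "open S" "l \<in> S"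
    unfolding S_def by (rule open_Compl, rule finite_imp_closed[OF fin]) simp
  have nz: "poly \<chi> w \<noteq> 0" if "w \<in> S" "w \<noteq> l" for w using that by (auto simp: S_def)
  show False
  proof (cases "q = 0")
    case True
    have "eventually (\<lambda>w. G w = 0) (at l)"
      using eventually_at_in_open'[OF S(1,2)] eventually_neq_at_within[of l l UNIV]
    proof eventually_elim
      case (elim w)
      then show ?case using G[of w] nz[of w] True by simp
    qed
    then have "is_pole (\<lambda>_. 0 :: complex) l" by (rule is_pole_transform[OF pole _ refl])
    then show False using not_is_pole_holomorphic[of UNIV l "\<lambda>_. 0"] by auto
  next
    case False
    obtain q1 where q1: "q = [:- l, 1:] ^ Polynomial.order l q * q1" "poly q1 l \<noteq> 0"
      using order_decomp[OF False, of l] by (metis poly_eq_0_iff_dvd)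
    have s: "0 < Polynomial.order l q" using ql False by (simp add: order_root)
    have \<chi>1S: "poly \<chi>1 w \<noteq> 0" if "w \<in> S" for w
    proof (cases "w = l")
      case False
      then show ?thesis using nz[OF that False] by (subst (asm) \<chi>1(1)) auto
    qed (use \<chi>1 in auto)
    have "zorder G l = int (Polynomial.order l q) - int (Polynomial.order l \<chi>)"
    proof (rule zorder_eqI[OF S, of "\<lambda>w. poly q1 w / poly \<chi>1 w"])
      show "(\<lambda>w. poly q1 w / poly \<chi>1 w) holomorphic_on S" using \<chi>1S by (intro holomorphic_intros) auto
      show "poly q1 l / poly \<chi>1 l \<noteq> 0" using q1 \<chi>1 by simp
      fix w assume w: "w \<in> S" "w \<noteq> l"
      have "G w = poly q w / poly \<chi> w" using G nz w by blast
      also have "poly q w = (w - l) ^ Polynomial.order l q * poly q1 w" by (subst q1(1)) simp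
      also have "poly \<chi> w = (w - l) ^ Polynomial.order l \<chi> * poly \<chi>1 w" by (subst \<chi>1(1)) simp
      finally show "G w = poly q1 w / poly \<chi>1 w * (w - l) powi (int (Polynomial.order l q) - int (Polynomial.order l \<chi>))"
        using w by (simp add: power_int_diff mult.commute)
    qed
    then show False using zo o s by simp
  qed
qed

lemma monic_eq_if_order_eq:
  fixes p q :: "complex poly"
  assumes "lead_coeff p = 1" "lead_coeff q = 1" "\<And>l. Polynomial.order l p = Polynomial.order l q"
  shows "p = q"
proof -
  have "p \<noteq> 0" "q \<noteq> 0" using assms by auto
  then have "poly p z = 0 \<longleftrightarrow> poly q z = 0" for z using assms(3)[of z] by (simp add: order_root)
  then show ?thesis
    using complex_poly_decompose[of p] complex_poly_decompose[of q] assms by simp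
qed

text \<open>Over the complex numbers the degree is the number of roots with multiplicity.\<close>

lemma degree_le_if_order_le:
  fixes p q :: "complex poly"
  assumes "q \<noteq> 0" "p \<noteq> 0" "\<And>l. poly p l = 0 \<Longrightarrow> Polynomial.order l p \<le> Polynomial.order l q"
  shows "degree p \<le> degree q"
proof -
  have "proots p \<subseteq># proots q"
  proof (rule mset_subset_eqI)
    fix l show "count (proots p) l \<le> count (proots q) l"
      using assms by (cases "poly p l = 0") (auto simp: order_0I)
  qed
  then have "size (proots p) \<le> size (proots q)" by (rule size_mset_mono)
  then show ?thesis by (simp add: size_proots_complex)
qed

lemma recurrence_zero:
  fixes s :: "nat \<Rightarrow> 'a::comm_ring_1"
  assumes "\<And>m. (\<Sum>k\<le>n. a k * s (k + m)) = 0" "a n = 1" "\<And>i. i < n \<Longrightarrow> s i = 0"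
  shows "s i = 0"
proof (induction i rule: less_induct)
  case (less i)
  show ?case
  proof (cases "i < n")
    case False
    have "0 = (\<Sum>k\<le>n. a k * s (k + (i - n)))" using assms(1) by simp
    also have "\<dots> = a n * s (n + (i - n))"
    proof (subst sum.remove[of _ n])
      have "a k * s (k + (i - n)) = 0" if "k \<in> {..n} - {n}" for k
      proof -
        have "k + (i - n) < i" using that False by auto
        then show ?thesis using less by simp
      qed
      then show "a n * s (n + (i - n)) + (\<Sum>k\<in>{..n} - {n}. a k * s (k + (i - n))) = a n * s (n + (i - n))"
        by simp
    qed auto
    finally show ?thesis using False assms(2) by simp
  qed (use assms in auto)
qed

text \<open>The coefficient at \<open>n - 1 - m\<close> is \<open>e m\<close> plus multiples of
  \<open>e j\<close> with \<open>j < m\<close>; this triangular system kills the first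
  \<open>n\<close> terms, and the recurrence kills the others.\<close>

lemma numerator_zero_imp_zero:
  fixes p :: "'a::comm_ring_1 poly"
  assumes rec: "\<And>m. (\<Sum>k\<le>n. coeff p k * e (k + m)) = 0" and deg: "degree p = n" and monic: "coeff p n = 1"
    and num: "numerator p e = 0"
  shows "e i = 0"
proof (rule recurrence_zero[where n = n and a = "coeff p"])
  fix m assume "m < n"
  then show "e m = 0"
  proof (induction m rule: less_induct)
    case (less m)
    have "0 = coeff (numerator p e) (n - 1 - m)" using num by simp
    also have "\<dots> = (\<Sum>i\<le>n. \<Sum>j<i. if i - 1 - j = n - 1 - m then coeff p i * e j else 0)"
      by (simp add: numerator_def coeff_sum deg)
    also have "\<dots> = (\<Sum>i\<le>n. if i = n then e m else 0)"
    proof (rule sum.cong[OF refl])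
      fix i assume i: "i \<in> {..n}"
      have "(\<Sum>j<i. if i - 1 - j = n - 1 - m then coeff p i * e j else 0) =
          (\<Sum>j<i. if i = n \<and> j = m then e m else 0)"
      proof (rule sum.cong[OF refl])
        fix j assume j: "j \<in> {..<i}"
        show "(if i - 1 - j = n - 1 - m then coeff p i * e j else 0) = (if i = n \<and> j = m then e m else 0)"
        proof (cases "i = n")
          case True
          then have "i - 1 - j = n - 1 - m \<longleftrightarrow> j = m" using j less.prems by auto
          then show ?thesis using True monic by auto
        next
          case False
          then have "i - 1 - j = n - 1 - m \<Longrightarrow> j < m" using i j by auto
          then show ?thesis using False less by auto
        qed
      qed
      also have "\<dots> = (if i = n then e m else 0)" using less.prems by auto
      finally show "(\<Sum>j<i. if i - 1 - j = n - 1 - m then coeff p i * e j else 0) =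
          (if i = n then e m else 0)" .
    qed
    finally show ?case by simp
  qed
qed (use rec monic in auto)

lemma numerator_diff: "numerator p (\<lambda>i. h i - h' i) = numerator p h - numerator p h'"
  by (simp add: numerator_def right_diff_distrib diff_monom[symmetric] sum_subtractf)

section \<open>Minimal realizations\<close>

lemma realization_quotient:
  assumes "realization n A b c G" "poly (char_poly (cmat A)) z \<noteq> 0"
  shows "G z = poly (numerator (char_poly (cmat A)) (markov A c b)) z / poly (char_poly (cmat A)) z"
proof -
  have "\<not> eigenvalue (cmat A) z"
    using assms eigenvalue_root_char_poly[of "cmat A" n z] by (simp add: realization_def)
  then show ?thesis
    using assms transfer_value_eq[of A n b c z] unfolding realization_def by metis
qed

lemma markov_recurrence:
  assumes "A \<in> carrier_mat n n" "b \<in> carrier_vec n" "c \<in> carrier_vec n"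
  shows "(\<Sum>k\<le>n. coeff (char_poly (cmat A)) k * markov A c b (k + m)) = 0"
  using krylov_recurrence[of "cmat A" n "cvec b" "cvec c" m] assms
  by (simp add: krylov_of_real[OF assms])

text \<open>Pole multiplicities determine the monic characteristic polynomial, hence the dimension.
  The numerators then agree off its roots, hence everywhere, and they determine the Markov
  parameters.\<close>

lemma minimal_realization_unique:
  assumes "minimal_realization n A b c G" "minimal_realization m A' b' c' G"
  shows "m = n \<and> krylov A' c' b' = krylov A c b"
proof -
  have A: "A \<in> carrier_mat n n" "b \<in> carrier_vec n" "c \<in> carrier_vec n"
    and A': "A' \<in> carrier_mat m m" "b' \<in> carrier_vec m" "c' \<in> carrier_vec m"
    using assms by (auto simp: minimal_realization_def realization_def)
  let ?\<chi> = "char_poly (cmat A)" and ?\<chi>' = "char_poly (cmat A')"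
  have deg: "degree ?\<chi> = n" "coeff ?\<chi> n = 1" "degree ?\<chi>' = m" "coeff ?\<chi>' m = 1"
    using degree_monic_char_poly[of "cmat A" n] degree_monic_char_poly[of "cmat A'" m] A A' by auto
  have eq: "?\<chi>' = ?\<chi>"
    by (rule monic_eq_if_order_eq) (use assms deg in \<open>auto simp: minimal_realization_def\<close>)
  then have mn: "m = n" using deg by simp
  have "?\<chi> \<noteq> 0" using deg(2) by auto
  then have "numerator ?\<chi> (markov A' c' b') = numerator ?\<chi> (markov A c b)"
  proof (rule poly_eq_if_eq_off_roots)
    fix z assume z: "poly ?\<chi> z \<noteq> 0"
    then show "poly (numerator ?\<chi> (markov A' c' b')) z = poly (numerator ?\<chi> (markov A c b)) z"
      using realization_quotient[of n A b c G z] realization_quotient[of m A' b' c' G z] assms eq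
      by (simp add: minimal_realization_def)
  qed
  then have num: "numerator ?\<chi> (\<lambda>i. markov A' c' b' i - markov A c b i) = 0" by (simp add: numerator_diff)
  have "markov A' c' b' i - markov A c b i = 0" for i
  proof (rule numerator_zero_imp_zero[OF _ deg(1,2) num])
    fix l show "(\<Sum>k\<le>n. coeff ?\<chi> k * (markov A' c' b' (k + l) - markov A c b (k + l))) = 0"
      using markov_recurrence[OF A, of l] markov_recurrence[OF A', of l] eq mn
      by (simp add: right_diff_distrib sum_subtractf)
  qed
  then show ?thesis using mn by (auto simp: markov_def)
qed

text \<open>Read a kernel vector as a polynomial \<open>p\<close> of degree below \<open>n\<close>.
  Then \<open>p G\<close> is a polynomial, so \<open>p q = numerator p h * \<chi>\<close> with
  \<open>G = q / \<chi>\<close>. Since \<open>q\<close> has no root in common with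
  \<open>\<chi>\<close>, all \<open>n\<close> roots of \<open>\<chi>\<close> are roots of
  \<open>p\<close> with multiplicity.\<close>

lemma hankel_nonsingular:
  assumes min: "minimal_realization n A b c G"
  shows "fdet n (\<lambda>i j. krylov A c b (i + j)) \<noteq> 0"
proof
  assume "fdet n (\<lambda>i j. krylov A c b (i + j)) = 0"
  then obtain v j0 where v: "j0 < n" "v j0 \<noteq> 0" "\<forall>i<n. (\<Sum>j<n. krylov A c b (i + j) * v j) = 0"
    using fdet_kernel[of n "\<lambda>i j. krylov A c b (i + j)"] by blast
  have A: "A \<in> carrier_mat n n" "b \<in> carrier_vec n" "c \<in> carrier_vec n"
    using min by (auto simp: minimal_realization_def realization_def)
  let ?\<chi> = "char_poly (cmat A)" and ?h = "markov A c b"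
  let ?q = "numerator ?\<chi> ?h"
  have deg: "degree ?\<chi> = n" "coeff ?\<chi> n = 1"
    using degree_monic_char_poly[of "cmat A" n] A by auto
  then have \<chi>: "?\<chi> \<noteq> 0" by auto
  define w where "w j = complex_of_real (v j)" for j
  have shift_rec: "(\<Sum>k\<le>n. coeff ?\<chi> k * (\<Sum>j<n. f (k + m + j) * w j)) = 0"
    if "\<And>m. (\<Sum>k\<le>n. coeff ?\<chi> k * f (k + m)) = 0" for f m
  proof -
    have "(\<Sum>k\<le>n. coeff ?\<chi> k * (\<Sum>j<n. f (k + m + j) * w j)) =
        (\<Sum>j<n. w j * (\<Sum>k\<le>n. coeff ?\<chi> k * f (k + (m + j))))"
      unfolding sum_distrib_left by (subst sum.swap) (simp add: mult_ac add.assoc)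
    then show ?thesis using that by simp
  qed
  \<comment> \<open>The kernel equation covers \<open>i < n\<close>; Cayley--Hamilton extends it to
    all \<open>i\<close>.\<close>
  have s: "(\<Sum>j<n. ?h (i + j) * w j) = 0" for i
  proof (rule recurrence_zero[where n = n and a = "coeff ?\<chi>" and s = "\<lambda>i. \<Sum>j<n. ?h (i + j) * w j"])
    fix i assume "i < n"
    then have "complex_of_real (\<Sum>j<n. krylov A c b (i + j) * v j) = 0" using v(3) by simp
    then show "(\<Sum>j<n. ?h (i + j) * w j) = 0" by (simp add: markov_def w_def)
  qed (use deg shift_rec markov_recurrence[OF A] in auto)
  define p where "p = (\<Sum>j<n. monom (w j) j)"
  have cp: "coeff p j = (if j < n then w j else 0)" for j by (simp add: p_def coeff_sum)
  have p0: "p \<noteq> 0" using cp[of j0] v by (auto simp: w_def)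
  have "degree p < n" using cp leading_coeff_0_iff[of p] p0 by (metis)
  have pq: "p * ?q = numerator p ?h * ?\<chi>"
  proof (rule poly_eq_if_eq_off_roots[OF \<chi>])
    fix z assume z: "poly ?\<chi> z \<noteq> 0"
    obtain g where g: "g 0 = transfer_value A b c z" "\<forall>i. z * g i - g (Suc i) = ?h i"
      "\<forall>m. (\<Sum>k\<le>n. coeff ?\<chi> k * g (k + m)) = 0"
      using transfer_value_sequence[OF A z] by blast
    \<comment> \<open>This inserts \<open>p(A)\<close> before the resolvent. By \<open>s\<close> the
      inhomogeneous term of the recurrence disappears, so
      \<open>\<chi>(z) * g' 0 = 0\<close>.\<close>
    define g' where "g' i = (\<Sum>j<n. g (i + j) * w j)" for i
    have "z * g' i - g' (Suc i) = 0" for i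
    proof -
      have "z * g' i - g' (Suc i) = (\<Sum>j<n. (z * g (i + j) - g (Suc (i + j))) * w j)"
        by (simp add: g'_def sum_distrib_left sum_subtractf algebra_simps)
      then show ?thesis using s g(2) by simp
    qed
    then have "poly ?\<chi> z * g' 0 = poly (numerator ?\<chi> (\<lambda>_. 0)) z + (\<Sum>i\<le>n. coeff ?\<chi> i * g' i)"
      using poly_times_first[of z g' "\<lambda>_. 0" ?\<chi>] deg by simp
    also have "\<dots> = 0" using shift_rec[of g 0] g(3) by (simp add: numerator_def g'_def)
    finally have "g' 0 = 0" using z by simp
    moreover have "(\<Sum>i\<le>degree p. coeff p i * g i) = g' 0"
    proof -
      have "(\<Sum>i\<le>degree p. coeff p i * g i) = (\<Sum>i<n. coeff p i * g i)"
        using \<open>degree p < n\<close> by (intro sum.mono_neutral_left) (auto simp: coeff_eq_0)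
      then show ?thesis by (simp add: cp g'_def mult.commute)
    qed
    ultimately have "poly p z * g 0 = poly (numerator p ?h) z"
      using poly_times_first[of z g ?h p] g(2) by simp
    then show "poly (p * ?q) z = poly (numerator p ?h * ?\<chi>) z"
      using z g(1) transfer_value_eq[OF A z] by (simp add: field_simps)
  qed
  have qnz: "poly ?q l \<noteq> 0" if "poly ?\<chi> l = 0" for l
  proof (rule no_common_root_if_pole_mult[OF \<chi> _ _ that])
    show "G z = poly ?q z / poly ?\<chi> z" if "poly ?\<chi> z \<noteq> 0" for z
      using min that realization_quotient by (auto simp: minimal_realization_def)
  qed (use min in \<open>simp add: minimal_realization_def\<close>)
  have "?q \<noteq> 0"
  proof
    assume "?q = 0"
    then have "\<And>i. ?h i = 0" using numerator_zero_imp_zero[OF markov_recurrence[OF A] deg] by blast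
    moreover have "\<exists>l. poly ?\<chi> l = 0"
      using fundamental_theorem_of_algebra[of ?\<chi>] deg v(1) by (auto simp: constant_degree)
    ultimately show False using qnz \<open>?q = 0\<close> by auto
  qed
  then have pq0: "p * ?q \<noteq> 0" using p0 by simp
  then have num0: "numerator p ?h * ?\<chi> \<noteq> 0" using pq by simp
  have "degree ?\<chi> \<le> degree p"
  proof (rule degree_le_if_order_le[OF p0 \<chi>])
    fix l assume l: "poly ?\<chi> l = 0"
    have "Polynomial.order l ?\<chi> \<le> Polynomial.order l (numerator p ?h * ?\<chi>)"
      using order_mult[OF num0] by simp
    also have "\<dots> = Polynomial.order l p" using order_mult[OF pq0] qnz[OF l] pq by (simp add: order_0I)
    finally show "Polynomial.order l ?\<chi> \<le> Polynomial.order l p" .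
  qed
  then show False using \<open>degree p < n\<close> deg by simp
qed

section \<open>Similarity of minimal realizations\<close>

lemma pow_mat_vec_Suc:
  fixes A :: "'a::comm_ring_1 Matrix.mat"
  assumes "A \<in> carrier_mat n n" "b \<in> carrier_vec n"
  shows "(A ^\<^sub>m Suc k) *\<^sub>v b = A *\<^sub>v ((A ^\<^sub>m k) *\<^sub>v b)"
proof -
  have "A ^\<^sub>m 1 = A" using assms(1) by simp
  then have "A ^\<^sub>m Suc k = A * A ^\<^sub>m k" using pow_mat_add[OF assms(1), of 1 k] by (simp only: plus_1_eq_Suc)
  then show ?thesis
    using assoc_mult_mat_vec[OF assms(1) pow_carrier_mat[OF assms(1)] assms(2)] by (simp only:)
qed

lemma pow_mat_vec_carrier:
  assumes "A \<in> carrier_mat n n" "b \<in> carrier_vec n"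
  shows "(A ^\<^sub>m k) *\<^sub>v b \<in> carrier_vec n"
  using assms by (intro mult_mat_vec_carrier[of _ n n] pow_carrier_mat)

lemma scalar_prod_transpose_pow:
  fixes A :: "real Matrix.mat"
  assumes A: "A \<in> carrier_mat n n" and c: "c \<in> carrier_vec n" and v: "v \<in> carrier_vec n"
  shows "scalar_prod ((transpose_mat A ^\<^sub>m i) *\<^sub>v c) v = scalar_prod c ((A ^\<^sub>m i) *\<^sub>v v)"
  using v
proof (induction i arbitrary: v)
  case (Suc i)
  have At: "transpose_mat A \<in> carrier_mat n n" using A by simp
  have "scalar_prod ((transpose_mat A ^\<^sub>m Suc i) *\<^sub>v c) v =
      scalar_prod ((transpose_mat A ^\<^sub>m i) *\<^sub>v c) (A *\<^sub>v v)"
    unfolding pow_mat_vec_Suc[OF At c]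
    by (rule transpose_vec_mult_scalar[OF A Suc.prems pow_mat_vec_carrier[OF At c]])
  also have "\<dots> = scalar_prod c ((A ^\<^sub>m i) *\<^sub>v (A *\<^sub>v v))"
    by (rule Suc.IH) (use A Suc.prems in simp)
  also have "(A ^\<^sub>m i) *\<^sub>v (A *\<^sub>v v) = (A ^\<^sub>m Suc i) *\<^sub>v v"
    using assoc_mult_mat_vec[OF pow_carrier_mat[OF A] A Suc.prems] by simp
  finally show ?case .
qed (use assms in simp)

lemma ctrb_carrier [simp]: "A \<in> carrier_mat n n \<Longrightarrow> ctrb j A b \<in> carrier_mat n j"
  unfolding ctrb_def by (rule carrier_matI) simp_all

lemma dim_ctrb [simp]: "dim_row (ctrb j A b) = dim_row A" "dim_col (ctrb j A b) = j"
  by (simp_all add: ctrb_def)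

lemma ctrb_col:
  assumes "A \<in> carrier_mat n n" "b \<in> carrier_vec n" "s < j"
  shows "Matrix.col (ctrb j A b) s = (A ^\<^sub>m s) *\<^sub>v b"
  using assms pow_mat_vec_carrier[OF assms(1,2), of s] by (simp add: ctrb_def)

lemma obsv_carrier [simp]: "A \<in> carrier_mat n n \<Longrightarrow> obsv j A c \<in> carrier_mat j n"
  by (simp add: obsv_def)

lemma obsv_row:
  assumes "A \<in> carrier_mat n n" "c \<in> carrier_vec n" "s < j"
  shows "Matrix.row (obsv j A c) s = (transpose_mat A ^\<^sub>m s) *\<^sub>v c"
  using assms ctrb_col[of "transpose_mat A" n c s j] carrier_matD(2)[OF ctrb_carrier[of "transpose_mat A" n j c]]
  by (simp add: obsv_def)

lemma obsv_mult_vec: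
  assumes "A \<in> carrier_mat n n" "c \<in> carrier_vec n" "v \<in> carrier_vec n" "s < j"
  shows "vec_index (obsv j A c *\<^sub>v v) s = krylov A c v s"
  using assms carrier_matD(1)[OF obsv_carrier[OF assms(1), of j c]]
  by (simp add: obsv_row scalar_prod_transpose_pow krylov_def)

lemma left_cancel_mat:
  fixes M :: "'a::field Matrix.mat"
  assumes "B \<in> carrier_mat n n" "M \<in> carrier_mat n n" "B * M = 1\<^sub>m n"
    "X \<in> carrier_mat n m" "Y \<in> carrier_mat n m" "M * X = M * Y"
  shows "X = Y"
proof -
  have "X = B * (M * X)" using assms(1-5) by (simp add: assoc_mult_mat[of B n n M n X m, symmetric])
  also have "\<dots> = Y" using assms(1-5) unfolding assms(6) by (simp add: assoc_mult_mat[of B n n M n Y m, symmetric])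
  finally show ?thesis .
qed

lemma left_cancel_vec:
  fixes M :: "'a::field Matrix.mat"
  assumes "B \<in> carrier_mat n n" "M \<in> carrier_mat n n" "B * M = 1\<^sub>m n"
    "x \<in> carrier_vec n" "y \<in> carrier_vec n" "M *\<^sub>v x = M *\<^sub>v y"
  shows "x = y"
proof -
  have "x = B *\<^sub>v (M *\<^sub>v x)" using assms(1-5) by (simp add: assoc_mult_mat_vec[of B n n M n x, symmetric])
  also have "\<dots> = y" using assms(1-5) unfolding assms(6) by (simp add: assoc_mult_mat_vec[of B n n M n y, symmetric])
  finally show ?thesis .
qed

text \<open>The Hankel matrix and its shift consist of Markov parameters only, so these products are
  the same for both realizations being compared.\<close>

lemma obsv_mult_ctrb:
  assumes A: "A \<in> carrier_mat n n" "b \<in> carrier_vec n" "c \<in> carrier_vec n"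
  shows "obsv n A c * ctrb n A b = Matrix.mat n n (\<lambda>(i, j). krylov A c b (i + j))" (is "?O * ?C = ?H")
    and "obsv n A c * (A * ctrb n A b) = Matrix.mat n n (\<lambda>(i, j). krylov A c b (Suc (i + j)))" (is "_ = ?H'")
proof -
  have O: "?O \<in> carrier_mat n n" and C: "?C \<in> carrier_mat n n" using A by auto
  have entry: "(?O * X) $$ (i, j) = krylov A c (Matrix.col X j) i"
    if "X \<in> carrier_mat n n" "i < n" "j < n" for X i j
  proof -
    have "(?O * X) $$ (i, j) = vec_index (?O *\<^sub>v Matrix.col X j) i" using O that by simp
    then show ?thesis using obsv_mult_vec[OF A(1,3)] that by simp
  qed
  show "?O * ?C = ?H"
  proof (rule eq_matI)
    fix i j assume "i < dim_row ?H" "j < dim_col ?H"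
    then show "(?O * ?C) $$ (i, j) = ?H $$ (i, j)"
      using entry[OF C] ctrb_col[OF A(1,2)] krylov_shift[OF A(1,2)] by simp
  qed (use carrier_matD[OF O] carrier_matD[OF C] in auto)
  show "?O * (A * ?C) = ?H'"
  proof (rule eq_matI)
    fix i j assume ij: "i < dim_row ?H'" "j < dim_col ?H'"
    then have "Matrix.col (A * ?C) j = (A ^\<^sub>m Suc j) *\<^sub>v b"
      using C A col_mult2[OF A(1) C, of j] pow_mat_vec_Suc[OF A(1,2)] by (simp add: ctrb_col del: pow_mat.simps)
    then show "(?O * (A * ?C)) $$ (i, j) = ?H' $$ (i, j)"
      using entry[OF mult_carrier_mat[OF A(1) C]] krylov_shift[OF A(1,2), of c "Suc j"] ij
      by (simp del: pow_mat.simps)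
  qed (use carrier_matD[OF O] carrier_matD[OF C] A in auto)
qed

text \<open>Kalman's state space isomorphism is $P = C C'^{-1}$ for the controllability matrices $C$, $C'$.\<close>

lemma similar_if_equal_krylov:
  fixes A A' :: "real Matrix.mat"
  assumes A: "A \<in> carrier_mat n n" "b \<in> carrier_vec n" "c \<in> carrier_vec n"
    and A': "A' \<in> carrier_mat n n" "b' \<in> carrier_vec n" "c' \<in> carrier_vec n"
    and eq: "krylov A' c' b' = krylov A c b"
    and nonsing: "fdet n (\<lambda>i j. krylov A c b (i + j)) \<noteq> 0"
  obtains P Q where "P \<in> carrier_mat n n" "Q \<in> carrier_mat n n" "P * Q = 1\<^sub>m n" "Q * P = 1\<^sub>m n"
    "A * P = P * A'" "P *\<^sub>v b' = b" "transpose_mat P *\<^sub>v c = c'"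
proof -
  define C where "C = ctrb n A b"
  define C' where "C' = ctrb n A' b'"
  define Ob where "Ob = obsv n A c"
  define Ob' where "Ob' = obsv n A' c'"
  have carr: "C \<in> carrier_mat n n" "C' \<in> carrier_mat n n" "Ob \<in> carrier_mat n n" "Ob' \<in> carrier_mat n n"
    using A A' by (simp_all add: C_def C'_def Ob_def Ob'_def)
  have H: "Ob' * C' = Ob * C" and HA: "Ob' * (A' * C') = Ob * (A * C)"
    unfolding C_def C'_def Ob_def Ob'_def obsv_mult_ctrb[OF A] obsv_mult_ctrb[OF A'] eq by auto
  have "Determinant.det (Ob * C) \<noteq> 0"
    using nonsing unfolding C_def Ob_def obsv_mult_ctrb[OF A] by (simp add: fdet_def)
  \<comment> \<open>Both factorizations give the same nonsingular Hankel matrix, so the factors are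
    invertible.\<close>
  then have dets: "Determinant.det Ob \<noteq> 0" "Determinant.det C \<noteq> 0" "Determinant.det C' \<noteq> 0"
    using det_mult[OF carr(3,1)] det_mult[OF carr(4,2)] H by auto
  obtain Oi where Oi: "Oi \<in> carrier_mat n n" "Oi * Ob = 1\<^sub>m n"
    using mat_inverse_if_det_nonzero[OF carr(3) dets(1)] by metis
  obtain Ci where Ci: "Ci \<in> carrier_mat n n" "C * Ci = 1\<^sub>m n" "Ci * C = 1\<^sub>m n"
    using mat_inverse_if_det_nonzero[OF carr(1) dets(2)] by metis
  obtain Ci' where Ci': "Ci' \<in> carrier_mat n n" "C' * Ci' = 1\<^sub>m n" "Ci' * C' = 1\<^sub>m n"
    using mat_inverse_if_det_nonzero[OF carr(2) dets(3)] by metis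
  define P where "P = C * Ci'"
  define Q where "Q = C' * Ci"
  have P: "P \<in> carrier_mat n n" and Q: "Q \<in> carrier_mat n n" using carr Ci Ci' by (auto simp: P_def Q_def)
  note assoc = assoc_mult_mat[of _ n n _ n _ n]
  have PQ: "P * Q = 1\<^sub>m n"
  proof -
    have "P * Q = C * ((Ci' * C') * Ci)"
      unfolding P_def Q_def using carr Ci(1) Ci'(1) by (simp add: assoc)
    then show ?thesis using Ci Ci' by simp
  qed
  have QP: "Q * P = 1\<^sub>m n" by (rule mat_mult_left_right_inverse[OF P Q PQ])
  have PC': "P * C' = C" unfolding P_def using carr Ci' by (simp add: assoc)
  have OP: "Ob * P = Ob'"
  proof -
    have "Ob * P = (Ob' * C') * Ci'" unfolding H P_def using carr Ci' by (simp add: assoc)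
    also have "\<dots> = Ob'" using carr Ci' by (simp add: assoc)
    finally show ?thesis .
  qed
  \<comment> \<open>After multiplication by \<open>Ob\<close> both sides come from the shifted
    Hankel matrix.\<close>
  have AP: "A * P = P * A'"
  proof (rule left_cancel_mat[OF Oi(1) carr(3) Oi(2)])
    have "Ob * (A * P) = (Ob * (A * C)) * Ci'" unfolding P_def using carr Ci' A by (simp add: assoc)
    also have "\<dots> = Ob' * A'" unfolding HA[symmetric] using carr Ci' A' by (simp add: assoc)
    also have "\<dots> = Ob * (P * A')" unfolding OP[symmetric] using carr P A' by (simp add: assoc)
    finally show "Ob * (A * P) = Ob * (P * A')" .
  qed (use A A' P in auto)
  have Pb: "P *\<^sub>v b' = b"
  proof (rule left_cancel_vec[OF Oi(1) carr(3) Oi(2)])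
    have "Ob *\<^sub>v (P *\<^sub>v b') = Ob' *\<^sub>v b'"
      unfolding OP[symmetric] using carr P A' by (simp add: assoc_mult_mat_vec[of _ n n _ n])
    also have "\<dots> = Ob *\<^sub>v b"
    proof (rule eq_vecI)
      fix i assume "i < dim_vec (Ob *\<^sub>v b)"
      then have "i < n" using carr(3) by simp
      then show "vec_index (Ob' *\<^sub>v b') i = vec_index (Ob *\<^sub>v b) i"
        using obsv_mult_vec[OF A(1,3,2)] obsv_mult_vec[OF A'(1,3,2)] eq
        by (simp add: Ob_def Ob'_def del: index_mult_mat_vec)
    qed (use carr in simp)
    finally show "Ob *\<^sub>v (P *\<^sub>v b') = Ob *\<^sub>v b" .
  qed (use A A' P in auto)
  \<comment> \<open>Both vectors are tested on the columns of \<open>C'\<close>, where they give the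
    Markov parameters.\<close>
  have cP: "transpose_mat P *\<^sub>v c = c'"
  proof (rule left_cancel_vec[of "transpose_mat Ci'" n "transpose_mat C'"])
    show "transpose_mat Ci' * transpose_mat C' = 1\<^sub>m n"
      using Ci' carr transpose_mult[OF carr(2) Ci'(1)] by simp
    have "transpose_mat C' *\<^sub>v (transpose_mat P *\<^sub>v c) = transpose_mat C *\<^sub>v c"
      unfolding PC'[symmetric] using transpose_mult[OF P carr(2)] carr P A
      by (simp add: assoc_mult_mat_vec[of _ n n _ n])
    also have "\<dots> = transpose_mat C' *\<^sub>v c'"
    proof (rule eq_vecI)
      fix j assume "j < dim_vec (transpose_mat C' *\<^sub>v c')"
      then have j: "j < n" using carr by simp
      have "vec_index (transpose_mat C *\<^sub>v c) j = krylov A c b j"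
        using j carr A ctrb_col[OF A(1,2) j]
          comm_scalar_prod[of c n "(A ^\<^sub>m j) *\<^sub>v b"] pow_mat_vec_carrier[OF A(1,2)]
        by (simp add: C_def krylov_def)
      moreover have "vec_index (transpose_mat C' *\<^sub>v c') j = krylov A' c' b' j"
        using j carr A' ctrb_col[OF A'(1,2) j]
          comm_scalar_prod[of c' n "(A' ^\<^sub>m j) *\<^sub>v b'"] pow_mat_vec_carrier[OF A'(1,2)]
        by (simp add: C'_def krylov_def)
      ultimately show "vec_index (transpose_mat C *\<^sub>v c) j = vec_index (transpose_mat C' *\<^sub>v c') j"
        using eq by simp
    qed (use carr in auto)
    finally show "transpose_mat C' *\<^sub>v (transpose_mat P *\<^sub>v c) = transpose_mat C' *\<^sub>v c'" .
  qed (use Ci' carr P A A' in auto)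
  show ?thesis using that P Q PQ QP AP Pb cP by blast
qed

lemma pow_mat_intertwine:
  assumes "A \<in> carrier_mat n n" "A' \<in> carrier_mat n n" "P \<in> carrier_mat n n" "A * P = P * A'"
    and b': "b' \<in> carrier_vec n"
  shows "(A ^\<^sub>m i) *\<^sub>v (P *\<^sub>v b') = P *\<^sub>v ((A' ^\<^sub>m i) *\<^sub>v (b' :: 'a::comm_ring_1 Matrix.vec))"
proof (induction i)
  case (Suc i)
  let ?v = "(A' ^\<^sub>m i) *\<^sub>v b'"
  have v: "?v \<in> carrier_vec n" using pow_mat_vec_carrier assms by blast
  have "(A ^\<^sub>m Suc i) *\<^sub>v (P *\<^sub>v b') = A *\<^sub>v (P *\<^sub>v ?v)"
    using Suc assms by (subst pow_mat_vec_Suc[of _ n]) auto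
  also have "\<dots> = (P * A') *\<^sub>v ?v" using assoc_mult_mat_vec[OF assms(1,3) v] assms(4) by simp
  also have "\<dots> = P *\<^sub>v (A' *\<^sub>v ?v)" by (rule assoc_mult_mat_vec[OF assms(3,2) v])
  also have "\<dots> = P *\<^sub>v ((A' ^\<^sub>m Suc i) *\<^sub>v b')" unfolding pow_mat_vec_Suc[OF assms(2) b'] ..
  finally show ?case .
qed (use assms in simp)

lemma krylov_similar:
  assumes "A \<in> carrier_mat n n" "A' \<in> carrier_mat n n" "P \<in> carrier_mat n n" "A * P = P * A'"
    and "b' \<in> carrier_vec n" "c \<in> carrier_vec n"
  shows "krylov A' (transpose_mat P *\<^sub>v c) b' = krylov A c (P *\<^sub>v (b' :: real Matrix.vec))"
proof
  fix i
  have "krylov A' (transpose_mat P *\<^sub>v c) b' i = scalar_prod c (P *\<^sub>v ((A' ^\<^sub>m i) *\<^sub>v b'))"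
    unfolding krylov_def
    by (rule transpose_vec_mult_scalar[OF assms(3) pow_mat_vec_carrier[OF assms(2,5)] assms(6)])
  then show "krylov A' (transpose_mat P *\<^sub>v c) b' i = krylov A c (P *\<^sub>v b') i"
    using pow_mat_intertwine[OF assms(1-5)] by (simp add: krylov_def)
qed

text \<open>Stability and minimality depend on the characteristic polynomial, and the transfer
  function on it and the Markov parameters; a change of coordinates preserves both.\<close>

lemma minimal_realization_similar:
  assumes min: "minimal_realization n A b c G"
    and A': "A' \<in> carrier_mat n n" and b': "b' \<in> carrier_vec n"
    and P: "P \<in> carrier_mat n n" "Q \<in> carrier_mat n n" "P * Q = 1\<^sub>m n" "Q * P = 1\<^sub>m n"
    and AP: "A * P = P * A'" and b: "P *\<^sub>v b' = b"
  shows "minimal_realization n A' b' (transpose_mat P *\<^sub>v c) G"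
proof -
  have A: "A \<in> carrier_mat n n" "b \<in> carrier_vec n" "c \<in> carrier_vec n" and real: "realization n A b c G"
    using min by (auto simp: minimal_realization_def realization_def)
  let ?c = "transpose_mat P *\<^sub>v c"
  have c': "?c \<in> carrier_vec n" using A P by simp
  have "A = P * A' * Q"
  proof -
    have "A = A * (P * Q)" using A P by simp
    also have "\<dots> = P * A' * Q" by (metis A(1) AP P(1,2) assoc_mult_mat)
    finally show ?thesis .
  qed
  then have "similar_mat A A'" using A A' P by (intro similar_matI[of _ _ P Q n]) auto
  then have \<chi>: "char_poly (cmat A') = char_poly (cmat A)"
    unfolding of_real_hom.char_poly_hom[OF A(1)] of_real_hom.char_poly_hom[OF A']
    using char_poly_similar by metis
  have kry: "krylov A' ?c b' = krylov A c b"
    using krylov_similar[OF A(1) A' P(1) AP b' A(3)] b by simp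
  have ev: "eigenvalue (cmat A') z \<longleftrightarrow> eigenvalue (cmat A) z" for z
    using eigenvalue_root_char_poly[of "cmat A'" n z] eigenvalue_root_char_poly[of "cmat A" n z] A A' \<chi> by simp
  have "G z = transfer_value A' b' ?c z" if "\<not> eigenvalue (cmat A') z" for z
  proof -
    have nz: "poly (char_poly (cmat A)) z \<noteq> 0"
      using that eigenvalue_root_char_poly[of "cmat A'" n z] A' \<chi> by simp
    have "markov A' ?c b' = markov A c b" by (rule ext) (simp add: markov_def kry)
    then show ?thesis
      using realization_quotient[OF real nz] transfer_value_eq[OF A' b' c', of z] nz \<chi> by simp
  qed
  then show ?thesis
    using min A' b' c' ev \<chi> by (auto simp: minimal_realization_def realization_def stable_def)
qed

section \<open>The three operators as infinite arrays with nonnegative minors\<close>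

section \<open>Order-preserving variation diminishing operators\<close>

lemma vec_seq_index: "v \<in> carrier_vec n \<Longrightarrow> vec_seq v i = (if i < n then vec_index v i else 0)"
  by (auto simp: vec_seq_def)

text \<open>Diminution up to \<open>m\<close> changes matches minors up to order
  \<open>m + 1\<close>, the number of places in a pattern with \<open>m\<close> changes; this is the
  origin of the shift between \<open>k - 1\<close> and \<open>k\<close>.\<close>

lemma OVD_iff_minors_nonneg:
  assumes K: "\<And>i l. n \<le> l \<Longrightarrow> K i l = 0"
    and X: "\<And>x i. x \<in> carrier_vec n \<Longrightarrow> s' (X x) i = (\<Sum>l<n. K i l * vec_seq x l)"
  shows "OVD m vec_seq s' (carrier_vec n) X \<longleftrightarrow> minors_nonneg (Suc m) K"
proof -
  have "\<forall>x\<in>carrier_vec n. (\<forall>i. vec_seq x i = 0) \<longrightarrow> (\<forall>i. s' (X x) i = 0)" by (simp add: X)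
  note eq = OVD_iff_alternates[of "carrier_vec n" vec_seq s' X, OF this]
  have X': "s' (X x) = (\<lambda>i. \<Sum>l<n. K i l * vec_seq x l)" if "x \<in> carrier_vec n" for x
    using X[OF that] by (rule ext)
  show ?thesis
  proof
    assume ovd: "OVD m vec_seq s' (carrier_vec n) X"
    show "minors_nonneg (Suc m) K"
    proof (rule minors_nonneg_if_alternates)
      fix u :: "nat \<Rightarrow> real" and N q
      assume u0: "\<And>l. N \<le> l \<Longrightarrow> u l = 0"
        and nalt: "\<not> alternates u (Suc m) 1" "\<not> alternates u (Suc m) (-1)"
        and alt: "alternates (\<lambda>i. \<Sum>l<N. K i l * u l) q 1"
      \<comment> \<open>\<open>K\<close> does not see entries of \<open>u\<close> from
        \<open>n\<close> on, so they may be cut off: the image is unchanged, and patterns of the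
        truncation are patterns of \<open>u\<close>.\<close>
      define x where "x = Matrix.vec n u"
      have x: "x \<in> carrier_vec n" by (simp add: x_def)
      have vx: "vec_seq x l = (if l < n then u l else 0)" for l by (simp add: vec_seq_def x_def)
      have transfer: "alternates u t s" if "alternates (vec_seq x) t s" for t s
        by (rule alternates_sgn_cong[OF that]) (auto simp: vx split: if_splits)
      have "(\<Sum>l<N. K i l * u l) = (\<Sum>l<n. K i l * vec_seq x l)" for i
      proof -
        have "(\<Sum>l<N. K i l * u l) = (\<Sum>l<max N n. K i l * u l)"
          by (rule sum.mono_neutral_left) (auto simp: u0)
        also have "\<dots> = (\<Sum>l<n. K i l * vec_seq x l)"
          by (rule sum.mono_neutral_cong_right) (auto simp: vx K)
        finally show ?thesis .
      qed
      then have "alternates (s' (X x)) q 1" using alt by (simp add: X'[OF x])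
      then have "alternates (vec_seq x) q 1"
        using ovd[unfolded eq] x nalt transfer by blast
      then show "alternates u q 1" by (rule transfer)
    qed
  next
    assume K_nonneg: "minors_nonneg (Suc m) K"
    show "OVD m vec_seq s' (carrier_vec n) X"
      unfolding eq
    proof (intro ballI allI impI)
      fix x q \<sigma>
      assume x: "x \<in> carrier_vec n" and "\<not> alternates (vec_seq x) (Suc m) 1"
        "\<not> alternates (vec_seq x) (Suc m) (-1)" "\<sigma> = 1 \<or> \<sigma> = -1" "alternates (s' (X x)) q \<sigma>"
      then show "alternates (vec_seq x) q \<sigma>"
        using variation_diminishing[OF K_nonneg, of n "vec_seq x" q \<sigma>]
        by (simp add: X'[OF x] vec_seq_index)
    qed
  qed
qed

text \<open>An alternation pattern only involves finitely many strict inequalities, so it survives truncation of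
  the input sequence.\<close>

lemma OVD_sequences_iff_minors_nonneg:
  assumes summable: "\<And>i w. bounded (range w) \<Longrightarrow> summable (\<lambda>s. K i s * w s)"
    and X: "\<And>w i. bounded (range w) \<Longrightarrow> s' (X w) i = (\<Sum>s. K i s * w s)"
  shows "OVD m (\<lambda>w. w) s' {w. bounded (range w)} X \<longleftrightarrow> minors_nonneg (Suc m) K"
proof -
  have "\<forall>w\<in>{w. bounded (range w)}. (\<forall>i. w i = 0) \<longrightarrow> (\<forall>i. s' (X w) i = 0)" by (simp add: X)
  note eq = OVD_iff_alternates[of "{w. bounded (range w)}" "\<lambda>w. w", OF this]
  show ?thesis
  proof
    assume ovd: "OVD m (\<lambda>w. w) s' {w. bounded (range w)} X"
    show "minors_nonneg (Suc m) K"
    proof (rule minors_nonneg_if_alternates)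
      fix u :: "nat \<Rightarrow> real" and N q
      assume u0: "\<And>l. N \<le> l \<Longrightarrow> u l = 0"
        and nalt: "\<not> alternates u (Suc m) 1" "\<not> alternates u (Suc m) (-1)"
        and alt: "alternates (\<lambda>i. \<Sum>l<N. K i l * u l) q 1"
      have "range u \<subseteq> insert 0 (u ` {..<N})"
      proof
        fix y assume "y \<in> range u"
        then obtain l where "y = u l" by blast
        then show "y \<in> insert 0 (u ` {..<N})" using u0[of l] by (cases "l < N") auto
      qed
      then have b: "bounded (range u)" by (rule bounded_subset[rotated]) (simp add: finite_imp_bounded)
      have "s' (X u) = (\<lambda>i. \<Sum>l<N. K i l * u l)"
      proof
        fix i show "s' (X u) i = (\<Sum>l<N. K i l * u l)"
          unfolding X[OF b] by (rule suminf_finite) (auto simp: u0)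
      qed
      then show "alternates u q 1" using ovd[unfolded eq] b nalt alt by auto
    qed
  next
    assume K_nonneg: "minors_nonneg (Suc m) K"
    show "OVD m (\<lambda>w. w) s' {w. bounded (range w)} X"
      unfolding eq
    proof (intro ballI allI impI)
      fix w :: "nat \<Rightarrow> real" and q \<sigma>
      assume "w \<in> {w. bounded (range w)}" and nalt: "\<not> alternates w (Suc m) 1"
        "\<not> alternates w (Suc m) (-1)" and \<sigma>: "\<sigma> = 1 \<or> \<sigma> = -1" and alt: "alternates (s' (X w)) q \<sigma>"
      then have b: "bounded (range w)" by simp
      obtain f where f: "strict_mono f" "\<forall>a\<le>q. 0 < \<sigma> * (-1) ^ a * s' (X w) (f a)"
        using alt by (auto simp: alternates_strict_mono)
      have "eventually (\<lambda>N. \<forall>a\<in>{..q}. 0 < \<sigma> * (-1) ^ a * (\<Sum>s<N. K (f a) s * w s)) sequentially"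
      proof (rule eventually_ball_finite[OF finite_atMost], rule ballI)
        fix a assume a: "a \<in> {..q}"
        have "(\<lambda>N. \<Sum>s<N. K (f a) s * w s) \<longlonglongrightarrow> s' (X w) (f a)"
          unfolding X[OF b] using summable_LIMSEQ[OF summable[OF b]] .
        then have "(\<lambda>N. \<sigma> * (-1) ^ a * (\<Sum>s<N. K (f a) s * w s)) \<longlonglongrightarrow> \<sigma> * (-1) ^ a * s' (X w) (f a)"
          by (intro tendsto_mult tendsto_const)
        then show "eventually (\<lambda>N. 0 < \<sigma> * (-1) ^ a * (\<Sum>s<N. K (f a) s * w s)) sequentially"
          using f(2) a by (intro order_tendstoD(1)) auto
      qed
      then obtain N where N: "\<forall>a\<in>{..q}. 0 < \<sigma> * (-1) ^ a * (\<Sum>s<N. K (f a) s * w s)"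
        using eventually_happens'[OF sequentially_bot] by blast
      define u where "u l = (if l < N then w l else 0)" for l
      have transfer: "alternates w t s" if "alternates u t s" for t s
        by (rule alternates_sgn_cong[OF that]) (auto simp: u_def split: if_splits)
      have "(\<Sum>l<N. K i l * u l) = (\<Sum>s<N. K i s * w s)" for i by (simp add: u_def)
      then have "alternates (\<lambda>i. \<Sum>l<N. K i l * u l) q \<sigma>"
        unfolding alternates_strict_mono using f(1) N by (intro exI[of _ f]) auto
      then have "alternates u q \<sigma>"
        using variation_diminishing[OF K_nonneg, of N u q \<sigma>] transfer nalt \<sigma> by (auto simp: u_def)
      then show "alternates w q \<sigma>" by (rule transfer)
    qed
  qed
qed

section \<open>Geometric decay of the powers of a stable matrix\<close>

lemma pow_mat_smult:
  fixes M :: "'a::comm_ring_1 Matrix.mat"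
  assumes "M \<in> carrier_mat n n"
  shows "(r \<cdot>\<^sub>m M) ^\<^sub>m k = r ^ k \<cdot>\<^sub>m (M ^\<^sub>m k)"
proof (induction k)
  case 0
  then show ?case using assms by (auto intro!: eq_matI)
next
  case (Suc k)
  have "(r ^ k \<cdot>\<^sub>m (M ^\<^sub>m k)) * (r \<cdot>\<^sub>m M) = (r * r ^ k) \<cdot>\<^sub>m (M ^\<^sub>m k * M)"
    using assms pow_carrier_mat[OF assms, of k]
    by (intro eq_matI) (auto simp: mult_ac)
  then show ?case using Suc by simp
qed

text \<open>Choose \<rho> halfway between the spectral radius and 1. Then \<open>A / \<rho>\<close>
  still has spectral radius below 1, and its powers are bounded.\<close>

lemma stable_powers_bound:
  assumes A: "A \<in> carrier_mat n n" and st: "stable A" and n: "0 < n"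
  shows "\<exists>\<rho> C. 0 < \<rho> \<and> \<rho> < 1 \<and> (\<forall>k. \<forall>i<n. \<forall>j<n. \<bar>(A ^\<^sub>m k) $$ (i, j)\<bar> \<le> C * \<rho> ^ k)"
proof -
  let ?A = "cmat A"
  have cA: "?A \<in> carrier_mat n n" using A by simp
  let ?r = "spectral_radius ?A"
  obtain l where "eigenvalue ?A l" "?r = norm l"
    using spectral_radius_mem_max(1)[OF cA n] by (auto simp: spectrum_def)
  then have r: "0 \<le> ?r" "?r < 1" using st by (auto simp: stable_def)
  define \<rho> where "\<rho> = (1 + ?r) / 2"
  have \<rho>: "0 < \<rho>" "\<rho> < 1" "?r < \<rho>" using r by (auto simp: \<rho>_def)
  define B where "B = complex_of_real (1 / \<rho>) \<cdot>\<^sub>m ?A"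
  have B: "B \<in> carrier_mat n n" using cA by (simp add: B_def)
  have AB: "?A = complex_of_real \<rho> \<cdot>\<^sub>m B" using \<rho> cA by (intro eq_matI) (auto simp: B_def)
  obtain z where z: "eigenvalue B z" "spectral_radius B = norm z"
    using spectral_radius_mem_max(1)[OF B n] by (auto simp: spectrum_def)
  obtain v where v: "v \<in> carrier_vec n" "v \<noteq> 0\<^sub>v n" "B *\<^sub>v v = z \<cdot>\<^sub>v v"
    using z(1) B by (auto simp: eigenvalue_def eigenvector_def)
  have "?A *\<^sub>v v = complex_of_real \<rho> \<cdot>\<^sub>v (B *\<^sub>v v)"
    unfolding AB using B v(1) by (intro eq_vecI) (auto simp: scalar_prod_def sum_distrib_left mult.assoc)
  then have "?A *\<^sub>v v = (complex_of_real \<rho> * z) \<cdot>\<^sub>v v" using v by (simp add: smult_smult_assoc)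
  then have "eigenvalue ?A (complex_of_real \<rho> * z)"
    using v cA unfolding eigenvalue_def eigenvector_def by auto
  then have "norm (complex_of_real \<rho> * z) \<le> ?r"
    using spectral_radius_mem_max(2)[OF cA n] by (auto simp: spectrum_def)
  then have "\<rho> * norm z \<le> ?r" using \<rho>(1) by (simp add: norm_mult)
  then have "\<rho> * norm z < \<rho> * 1" using \<rho>(3) by linarith
  then have "spectral_radius B < 1" using z(2) \<rho>(1) by simp
  then obtain C where C: "\<forall>k. norm_bound (B ^\<^sub>m k) C"
    using spectral_radius_jnf_norm_bound_less_1_upper_triangular[OF B] by blast
  have "\<bar>(A ^\<^sub>m k) $$ (i, j)\<bar> \<le> C * \<rho> ^ k" if ij: "i < n" "j < n" for k i j
  proof -
    have Bk: "B ^\<^sub>m k \<in> carrier_mat n n" using B by simp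
    have Ak: "A ^\<^sub>m k \<in> carrier_mat n n" using A by simp
    have "cmat (A ^\<^sub>m k) = ?A ^\<^sub>m k" using A by (simp add: of_real_hom.mat_hom_pow)
    also have "\<dots> = complex_of_real \<rho> ^ k \<cdot>\<^sub>m (B ^\<^sub>m k)" unfolding AB by (rule pow_mat_smult[OF B])
    finally have "cmat (A ^\<^sub>m k) $$ (i, j) = complex_of_real \<rho> ^ k * (B ^\<^sub>m k) $$ (i, j)"
      using carrier_matD[OF B] ij by simp
    then have "complex_of_real ((A ^\<^sub>m k) $$ (i, j)) = complex_of_real \<rho> ^ k * (B ^\<^sub>m k) $$ (i, j)"
      using carrier_matD[OF A] ij by simp
    then have "\<bar>(A ^\<^sub>m k) $$ (i, j)\<bar> = \<rho> ^ k * norm ((B ^\<^sub>m k) $$ (i, j))"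
      using \<rho>(1) by (metis abs_of_pos norm_mult norm_of_real norm_power)
    also have "\<dots> \<le> \<rho> ^ k * C"
      using C carrier_matD[OF B] ij \<rho>(1) by (intro mult_left_mono) (auto simp: norm_bound_def)
    finally show ?thesis by (simp add: mult.commute)
  qed
  then show ?thesis using \<rho> by blast
qed

section \<open>Matrices and orbits as arrays padded with zeros\<close>

definition mat_kernel :: "real Matrix.mat \<Rightarrow> nat \<Rightarrow> nat \<Rightarrow> real" where
  "mat_kernel X i l = (if i < dim_row X \<and> l < dim_col X then X $$ (i, l) else 0)"

lemma mat_kernel_transpose: "mat_kernel (transpose_mat X) = (\<lambda>i l. mat_kernel X l i)"
  by (auto simp: mat_kernel_def fun_eq_iff)

text \<open>Row \<open>t\<close> is the vector \<open>A^t b\<close>, padded with zeros. This is the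
  transpose of the array of the controllability operator; taken for the transpose of
  \<open>A\<close> and for \<open>c\<close> it is the array of the observability operator.\<close>

definition orbit_kernel :: "real Matrix.mat \<Rightarrow> real Matrix.vec \<Rightarrow> nat \<Rightarrow> nat \<Rightarrow> real" where
  "orbit_kernel A b t l = (if l < dim_row A then vec_index ((A ^\<^sub>m t) *\<^sub>v b) l else 0)"

lemma orbit_kernel_Suc:
  assumes A: "A \<in> carrier_mat n n" and b: "b \<in> carrier_vec n"
  shows "orbit_kernel A b (Suc t) l = (\<Sum>i<n. orbit_kernel A b t i * mat_kernel (transpose_mat A) i l)"
proof (cases "l < n")
  case True
  have "vec_index ((A ^\<^sub>m Suc t) *\<^sub>v b) l = (\<Sum>i<n. A $$ (l, i) * vec_index ((A ^\<^sub>m t) *\<^sub>v b) i)"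
    unfolding pow_mat_vec_Suc[OF A b] using A pow_mat_vec_carrier[OF A b, of t] True
    by (auto simp: scalar_prod_def lessThan_atLeast0)
  then show ?thesis using True A by (simp add: orbit_kernel_def mat_kernel_def mult.commute)
qed (use A in \<open>simp add: orbit_kernel_def mat_kernel_def\<close>)

text \<open>Rows are multiplied by the transpose of \<open>A\<close> from the right, and
  transposition preserves nonnegativity of minors, so the orbit theorem applies.\<close>

lemma minors_nonneg_orbit_kernel:
  assumes A: "A \<in> carrier_mat n n" and b: "b \<in> carrier_vec n"
    and K: "minors_nonneg k (mat_kernel A)"
  shows "minors_nonneg k (orbit_kernel A b) \<longleftrightarrow>
    (\<forall>j\<le>k. \<forall>g. strict_mono g \<longrightarrow> 0 \<le> minor (orbit_kernel A b) j id g)"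
proof
  assume r: "\<forall>j\<le>k. \<forall>g. strict_mono g \<longrightarrow> 0 \<le> minor (orbit_kernel A b) j id g"
  show "minors_nonneg k (orbit_kernel A b)"
  proof (rule minors_nonneg_orbit[where n = n and K = "orbit_kernel A b" and A = "mat_kernel (transpose_mat A)", OF orbit_kernel_Suc[OF A b]])
    show "minors_nonneg k (mat_kernel (transpose_mat A))"
      unfolding mat_kernel_transpose minors_nonneg_transpose[of k "mat_kernel A"] by (rule K)
  qed (use r A in \<open>auto simp: orbit_kernel_def\<close>)
qed (auto simp: minors_nonneg_def strict_mono_def)

theorem internally_Hankel_positive_iff:
  assumes A: "A \<in> carrier_mat n n" and b: "b \<in> carrier_vec n" and c: "c \<in> carrier_vec n"
    and st: "stable A" and k: "1 \<le> k"
  shows "internally_Hankel_positive k A b c \<longleftrightarrow>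
    minors_nonneg k (mat_kernel A) \<and>
    (\<forall>j\<le>k. \<forall>g. strict_mono g \<longrightarrow> 0 \<le> minor (orbit_kernel A b) j id g) \<and>
    (\<forall>j\<le>k. \<forall>g. strict_mono g \<longrightarrow> 0 \<le> minor (orbit_kernel (transpose_mat A) c) j id g)"
proof -
  have Sk: "Suc (k - 1) = k" using k by simp
  have At: "transpose_mat A \<in> carrier_mat n n" using A by simp
  have 1: "OVD (k - 1) vec_seq vec_seq (carrier_vec n) (\<lambda>x. A *\<^sub>v x) \<longleftrightarrow> minors_nonneg (Suc (k - 1)) (mat_kernel A)"
  proof (rule OVD_iff_minors_nonneg)
    fix x :: "real Matrix.vec" and i assume x: "x \<in> carrier_vec n"
    show "vec_seq (A *\<^sub>v x) i = (\<Sum>l<n. mat_kernel A i l * vec_seq x l)"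
      using A x by (auto simp: vec_seq_def mat_kernel_def scalar_prod_def lessThan_atLeast0 intro!: sum.cong)
  qed (use A in \<open>simp add: mat_kernel_def\<close>)
  \<comment> \<open>The output is indexed by the state coordinate and the input by time, hence the
    transposed orbit array. Geometric decay of the powers of \<open>A\<close> makes the series
    converge.\<close>
  have 2: "OVD (k - 1) (\<lambda>w. w) vec_seq {w. bounded (range w)} (ctrb_op A b) \<longleftrightarrow>
      minors_nonneg (Suc (k - 1)) (\<lambda>i s. orbit_kernel A b s i)"
  proof (rule OVD_sequences_iff_minors_nonneg)
    fix i and w :: "nat \<Rightarrow> real" assume w: "bounded (range w)"
    then obtain W where W: "\<And>s. \<bar>w s\<bar> \<le> W" by (auto simp: bounded_iff)
    show "summable (\<lambda>s. orbit_kernel A b s i * w s)"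
    proof (cases "i < n")
      case True
      then obtain \<rho> C where \<rho>: "0 < \<rho>" "\<rho> < 1" "\<forall>k. \<forall>i<n. \<forall>j<n. \<bar>(A ^\<^sub>m k) $$ (i, j)\<bar> \<le> C * \<rho> ^ k"
        using stable_powers_bound[OF A st] by auto
      define D where "D = (\<Sum>j<n. C * \<bar>vec_index b j\<bar>) * W"
      have bound: "\<bar>orbit_kernel A b s i * w s\<bar> \<le> D * \<rho> ^ s" for s
      proof -
        have "\<bar>orbit_kernel A b s i\<bar> = \<bar>\<Sum>j<n. (A ^\<^sub>m s) $$ (i, j) * vec_index b j\<bar>"
          using True A b pow_carrier_mat[OF A, of s]
          by (auto simp: orbit_kernel_def scalar_prod_def lessThan_atLeast0)
        also have "\<dots> \<le> (\<Sum>j<n. (C * \<rho> ^ s) * \<bar>vec_index b j\<bar>)"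
          using \<rho>(3) True by (intro order_trans[OF sum_abs] sum_mono) (auto simp: abs_mult intro!: mult_right_mono)
        also have "\<dots> = (\<Sum>j<n. C * \<bar>vec_index b j\<bar>) * \<rho> ^ s"
          unfolding sum_distrib_right by (simp add: mult_ac)
        finally have "\<bar>orbit_kernel A b s i\<bar> * \<bar>w s\<bar> \<le> (\<Sum>j<n. C * \<bar>vec_index b j\<bar>) * \<rho> ^ s * W"
          using W[of s] by (intro mult_mono) auto
        then show ?thesis by (simp add: abs_mult D_def mult_ac)
      qed
      have "summable (\<lambda>s. D * \<rho> ^ s)" using \<rho> by (intro summable_mult summable_geometric) simp
      then show ?thesis by (rule summable_comparison_test'[where N = 0]) (simp add: bound)
    qed (use A in \<open>simp add: orbit_kernel_def\<close>)
    show "vec_seq (ctrb_op A b w) i = (\<Sum>s. orbit_kernel A b s i * w s)"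
      using A by (simp add: vec_seq_def ctrb_op_def orbit_kernel_def)
  qed
  have 3: "OVD (k - 1) vec_seq (\<lambda>y. y) (carrier_vec n) (obsv_op A c) \<longleftrightarrow>
      minors_nonneg (Suc (k - 1)) (orbit_kernel (transpose_mat A) c)"
  proof (rule OVD_iff_minors_nonneg)
    fix x :: "real Matrix.vec" and t assume x: "x \<in> carrier_vec n"
    have "obsv_op A c x t = scalar_prod ((transpose_mat A ^\<^sub>m t) *\<^sub>v c) x"
      unfolding obsv_op_def scalar_prod_transpose_pow[OF A c x] ..
    also have "\<dots> = (\<Sum>l<n. orbit_kernel (transpose_mat A) c t l * vec_seq x l)"
      using A x by (auto simp: scalar_prod_def orbit_kernel_def vec_seq_def lessThan_atLeast0 intro!: sum.cong)
    finally show "obsv_op A c x t = (\<Sum>l<n. orbit_kernel (transpose_mat A) c t l * vec_seq x l)" .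
  qed (use A in \<open>simp add: orbit_kernel_def\<close>)
  have tr: "minors_nonneg k (mat_kernel (transpose_mat A)) \<longleftrightarrow> minors_nonneg k (mat_kernel A)"
    unfolding mat_kernel_transpose by (rule minors_nonneg_transpose)
  have dim: "dim_row A = n" using A by simp
  show ?thesis
  \<comment> \<open>The reduction of the other two operators to leading minors presupposes
    positivity of \<open>A\<close>; without it both sides are false.\<close>
  proof (cases "minors_nonneg k (mat_kernel A)")
    case True
    show ?thesis
      unfolding internally_Hankel_positive_def dim 1 2 3 Sk minors_nonneg_transpose[of k "orbit_kernel A b"]
        minors_nonneg_orbit_kernel[OF A b True] minors_nonneg_orbit_kernel[OF At c tr[THEN iffD2, OF True]] ..
  next
    case False
    then show ?thesis unfolding internally_Hankel_positive_def dim 1 2 3 Sk by simp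
  qed
qed

section \<open>Compound matrices and cones\<close>

lemma pick_strict_sorted:
  assumes "sorted_wrt (<) I" "a < length I"
  shows "pick (set I) a = I ! a"
proof -
  have "{x \<in> set I. x < I ! a} = set (take a I)"
  proof (intro equalityI subsetI)
    fix x assume "x \<in> {x \<in> set I. x < I ! a}"
    then obtain b where b: "b < length I" "x = I ! b" "I ! b < I ! a" by (auto simp: in_set_conv_nth)
    then have "b < a"
      using sorted_wrt_nth_less[OF assms(1), of a b] by (metis less_asym linorder_neqE_nat)
    then show "x \<in> set (take a I)" using b assms(2) by (auto simp: in_set_conv_nth)
  next
    fix x assume x: "x \<in> set (take a I)"
    then obtain b where "b < a" "x = I ! b" by (auto simp: in_set_conv_nth)
    then show "x \<in> {x \<in> set I. x < I ! a}"
      using sorted_wrt_nth_less[OF assms(1), of b a] assms(2) in_set_takeD[OF x] by auto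
  qed
  moreover have "distinct (take a I)" using assms(1) by (simp add: strict_sorted_iff)
  ultimately have "card {x \<in> set I. x < I ! a} = a" using assms(2) by (simp add: distinct_card)
  then show ?thesis using pick_card_in_set[of "I ! a" "set I"] assms(2) by simp
qed

lemma lex_subsets_nth:
  assumes "p < n choose r"
  shows "lex_subsets n r ! p \<in> set (lex_subsets n r)"
  using assms by (simp add: length_lex_subsets)

lemma lex_subsets_nth_less:
  assumes "p < n choose r" "a < r"
  shows "lex_subsets n r ! p ! a < n"
proof -
  have "length (lex_subsets n r ! p) = r" "set (lex_subsets n r ! p) \<subseteq> {..<n}"
    using lex_subsets_nth[OF assms(1)] by (auto simp: set_lex_subsets)
  then show ?thesis using assms(2) by (metis lessThan_iff nth_mem subsetD)
qed

lemma dim_compound [simp]: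
  "dim_row (compound r X) = dim_row X choose r" "dim_col (compound r X) = dim_col X choose r"
  by (simp_all add: compound_def Let_def length_lex_subsets)

lemma compound_index:
  assumes "p < dim_row X choose r" "q < dim_col X choose r"
  shows "compound r X $$ (p, q) =
    minor (mat_kernel X) r ((!) (lex_subsets (dim_row X) r ! p)) ((!) (lex_subsets (dim_col X) r ! q))"
proof -
  let ?I = "lex_subsets (dim_row X) r ! p" and ?J = "lex_subsets (dim_col X) r ! q"
  have I: "sorted_wrt (<) ?I" "length ?I = r" "set ?I \<subseteq> {..<dim_row X}"
    and J: "sorted_wrt (<) ?J" "length ?J = r" "set ?J \<subseteq> {..<dim_col X}"
    using lex_subsets_nth[OF assms(1)] lex_subsets_nth[OF assms(2)] by (auto simp: set_lex_subsets)
  have "{i. i < dim_row X \<and> i \<in> set ?I} = set ?I" "{i. i < dim_col X \<and> i \<in> set ?J} = set ?J"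
    using I(3) J(3) by auto
  then have c: "card {i. i < dim_row X \<and> i \<in> set ?I} = r" "card {i. i < dim_col X \<and> i \<in> set ?J} = r"
    using I J by (simp_all add: distinct_card strict_sorted_iff)
  have "submatrix X (set ?I) (set ?J) = Matrix.mat r r (\<lambda>(a, b). mat_kernel X (?I ! a) (?J ! b))"
  proof (rule eq_matI)
    fix a b assume ab: "a < dim_row (Matrix.mat r r (\<lambda>(a, b). mat_kernel X (?I ! a) (?J ! b)))"
      "b < dim_col (Matrix.mat r r (\<lambda>(a, b). mat_kernel X (?I ! a) (?J ! b)))"
    then have "?I ! a \<in> set ?I" "?J ! b \<in> set ?J" using I J by auto
    then show "submatrix X (set ?I) (set ?J) $$ (a, b) =
        Matrix.mat r r (\<lambda>(a, b). mat_kernel X (?I ! a) (?J ! b)) $$ (a, b)"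
      using ab I J c lex_subsets_nth_less[OF assms(1)] lex_subsets_nth_less[OF assms(2)]
      by (auto simp: submatrix_def pick_strict_sorted mat_kernel_def)
  qed (use c in \<open>simp_all add: submatrix_def\<close>)
  then show ?thesis
    using assms by (simp add: compound_def Let_def length_lex_subsets minor_def fdet_def)
qed

lemma lex_subsets_full: "lex_subsets j j ! 0 = [0..<j]"
proof -
  have "length (lex_subsets j j) = 1" by (simp add: length_lex_subsets)
  then obtain x where x: "lex_subsets j j = [x]" by (metis One_nat_def length_0_conv length_Suc_conv)
  have "[0..<j] \<in> set (lex_subsets j j)" by (auto simp: set_lex_subsets)
  then show ?thesis using x by simp
qed

lemma minor_transpose: "minor (\<lambda>i l. K l i) j f g = minor K j g f"
  unfolding minor_def by (rule fdet_transpose[of j "\<lambda>a b. K (g a) (f b)"])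

text \<open>A selected column from \<open>n\<close> on is zero and makes the minor vanish, so only
  index lists below \<open>n\<close> matter.\<close>

lemma nonneg_minors_iff_lex_subsets:
  assumes "\<And>i l. n \<le> l \<Longrightarrow> K i l = 0"
  shows "(\<forall>g. strict_mono g \<longrightarrow> 0 \<le> minor K j f g) \<longleftrightarrow> (\<forall>J\<in>set (lex_subsets n j). 0 \<le> minor K j f ((!) J))"
proof (intro iffI ballI allI impI)
  fix J assume r: "\<forall>g. strict_mono g \<longrightarrow> 0 \<le> minor K j f g" and J: "J \<in> set (lex_subsets n j)"
  then have "strict_mono_on {..<j} ((!) J)" using strict_mono_on_nth[of J] by (simp add: set_lex_subsets)
  then obtain g where "strict_mono g" "\<And>a. a < j \<Longrightarrow> g a = J ! a" using strict_mono_extend by blast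
  moreover from this have "minor K j f ((!) J) = minor K j f g" by (intro minor_cong) simp
  ultimately show "0 \<le> minor K j f ((!) J)" using r by simp
next
  fix g assume r: "\<forall>J\<in>set (lex_subsets n j). 0 \<le> minor K j f ((!) J)" and g: "strict_mono (g :: nat \<Rightarrow> nat)"
  show "0 \<le> minor K j f g"
  proof (cases "\<exists>b<j. n \<le> g b")
    case True
    then obtain b where b: "b < j" "n \<le> g b" by blast
    then have "minor (\<lambda>i l. K l i) j g f = 0"
      unfolding minor_def by (intro fdet_zero_row[of b]) (auto simp: assms)
    then have "minor K j f g = 0" unfolding minor_transpose[of K] .
    then show ?thesis by simp
  next
    case False
    have "sorted_wrt (<) (map g [0..<j])"
      using g by (auto simp: sorted_wrt_iff_nth_less strict_mono_def)
    then have "map g [0..<j] \<in> set (lex_subsets n j)"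
      using False by (auto simp: set_lex_subsets not_le)
    moreover have "minor K j f g = minor K j f ((!) (map g [0..<j]))" by (rule minor_cong) simp
    ultimately show ?thesis using r by simp
  qed
qed

lemma ball_set_nth: "(\<forall>x\<in>set xs. Q x) \<longleftrightarrow> (\<forall>p<length xs. Q (xs ! p))"
  by (metis in_set_conv_nth)

lemma k_positive_iff: "k_positive k X \<longleftrightarrow> minors_nonneg k (mat_kernel X)"
proof -
  let ?K = "mat_kernel X"
  have rows: "(\<forall>f. strict_mono f \<longrightarrow> 0 \<le> minor ?K j f g) \<longleftrightarrow>
      (\<forall>I\<in>set (lex_subsets (dim_row X) j). 0 \<le> minor ?K j ((!) I) g)" for j g
    using nonneg_minors_iff_lex_subsets[of "dim_row X" "\<lambda>i l. ?K l i" j g]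
    unfolding minor_transpose[of ?K] by (simp add: mat_kernel_def)
  have cols: "(\<forall>g. strict_mono g \<longrightarrow> 0 \<le> minor ?K j f g) \<longleftrightarrow>
      (\<forall>J\<in>set (lex_subsets (dim_col X) j). 0 \<le> minor ?K j f ((!) J))" for j f
    by (rule nonneg_minors_iff_lex_subsets) (simp add: mat_kernel_def)
  have "minors_nonneg k ?K \<longleftrightarrow> (\<forall>j\<in>{1..k}. \<forall>f. strict_mono f \<longrightarrow> (\<forall>g. strict_mono g \<longrightarrow> 0 \<le> minor ?K j f g))"
    unfolding minors_nonneg_def
  proof (intro iffI allI impI)
    fix j :: nat and f g :: "nat \<Rightarrow> nat"
    assume r: "\<forall>j\<in>{1..k}. \<forall>f. strict_mono f \<longrightarrow> (\<forall>g. strict_mono g \<longrightarrow> 0 \<le> minor ?K j f g)"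
      and "j \<le> k" "strict_mono f" "strict_mono g"
    then show "0 \<le> minor ?K j f g" by (cases "j = 0") (auto simp: minor_def)
  qed auto
  also have "\<dots> \<longleftrightarrow> (\<forall>j\<in>{1..k}. \<forall>J\<in>set (lex_subsets (dim_col X) j). \<forall>f. strict_mono f \<longrightarrow> 0 \<le> minor ?K j f ((!) J))"
    unfolding cols by blast
  also have "\<dots> \<longleftrightarrow> (\<forall>j\<in>{1..k}. \<forall>J\<in>set (lex_subsets (dim_col X) j). \<forall>I\<in>set (lex_subsets (dim_row X) j).
      0 \<le> minor ?K j ((!) I) ((!) J))"
    unfolding rows ..
  also have "\<dots> \<longleftrightarrow> k_positive k X"
    unfolding k_positive_def ball_set_nth length_lex_subsets
    by (auto simp: compound_index)
  finally show ?thesis by simp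
qed

lemma sum_lex_subsets: "(\<Sum>I\<in>set (lex_subsets n j). F I) = (\<Sum>p<n choose j. F (lex_subsets n j ! p))"
proof -
  have "distinct (subseqs [0..<n])" using distinct_set_subseqs[of "[0..<n]"] by (simp add: distinct_map)
  then have "distinct (lex_subsets n j)" by (simp add: lex_subsets_def)
  then have "bij_betw ((!) (lex_subsets n j)) {..<n choose j} (set (lex_subsets n j))"
    by (intro bij_betw_nth) (auto simp: length_lex_subsets)
  then show ?thesis by (rule sum.reindex_bij_betw[symmetric])
qed

text \<open>The compound of order \<open>j\<close> of the first \<open>j\<close> orbit rows, as a
  vector; on the side of the \<open>j\<close> consecutive powers there is just one index
  set.\<close>

definition orbit_minors :: "nat \<Rightarrow> nat \<Rightarrow> real Matrix.mat \<Rightarrow> real Matrix.vec \<Rightarrow> real Matrix.vec" where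
  "orbit_minors n j A b = Matrix.vec (n choose j) (\<lambda>p. minor (orbit_kernel A b) j id ((!) (lex_subsets n j ! p)))"

lemma compound_ctrb:
  assumes A: "A \<in> carrier_mat n n" and b: "b \<in> carrier_vec n"
  shows "Matrix.col (compound j (ctrb j A b)) 0 = orbit_minors n j A b"
proof (rule eq_vecI)
  have n: "dim_row A = n" using A by simp
  fix p assume "p < dim_vec (orbit_minors n j A b)"
  then have p: "p < n choose j" by (simp add: orbit_minors_def)
  let ?I = "lex_subsets n j ! p"
  have "compound j (ctrb j A b) $$ (p, 0) = minor (mat_kernel (ctrb j A b)) j ((!) ?I) ((!) [0..<j])"
    using p n by (simp add: compound_index lex_subsets_full)
  also have "\<dots> = minor (\<lambda>i s. orbit_kernel A b s i) j ((!) ?I) id"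
  proof (rule minor_cong)
    fix a s assume as: "a < j" "s < j"
    then have I: "?I ! a < n" by (intro lex_subsets_nth_less[OF p])
    have "ctrb j A b $$ (?I ! a, s) = vec_index (Matrix.col (ctrb j A b) s) (?I ! a)"
      using as I n by simp
    then show "mat_kernel (ctrb j A b) (?I ! a) ([0..<j] ! s) = orbit_kernel A b (id s) (?I ! a)"
      using as I n by (simp add: mat_kernel_def orbit_kernel_def ctrb_col[OF A b])
  qed
  finally show "vec_index (Matrix.col (compound j (ctrb j A b)) 0) p = vec_index (orbit_minors n j A b) p"
    using p n unfolding minor_transpose[of "orbit_kernel A b"] by (simp add: orbit_minors_def)
qed (use A in \<open>simp add: orbit_minors_def\<close>)

lemma compound_obsv:
  assumes A: "A \<in> carrier_mat n n" and c: "c \<in> carrier_vec n"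
  shows "Matrix.col (transpose_mat (compound j (obsv j A c))) 0 = orbit_minors n j (transpose_mat A) c"
proof (rule eq_vecI)
  have n: "dim_col A = n" using A by simp
  have dims: "dim_row (obsv j A c) = j" "dim_col (obsv j A c) = n"
    using obsv_carrier[OF A, of j c] by auto
  fix p assume "p < dim_vec (orbit_minors n j (transpose_mat A) c)"
  then have p: "p < n choose j" by (simp add: orbit_minors_def)
  let ?I = "lex_subsets n j ! p"
  have "compound j (obsv j A c) $$ (0, p) = minor (mat_kernel (obsv j A c)) j ((!) [0..<j]) ((!) ?I)"
    using p dims by (simp add: compound_index lex_subsets_full)
  also have "\<dots> = minor (orbit_kernel (transpose_mat A) c) j id ((!) ?I)"
  proof (rule minor_cong)
    fix s a assume as: "s < j" "a < j"
    then have I: "?I ! a < n" by (intro lex_subsets_nth_less[OF p])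
    have "obsv j A c $$ (s, ?I ! a) = vec_index (Matrix.row (obsv j A c) s) (?I ! a)"
      using as I dims by simp
    then show "mat_kernel (obsv j A c) ([0..<j] ! s) (?I ! a) = orbit_kernel (transpose_mat A) c (id s) (?I ! a)"
      using as I n dims by (simp add: mat_kernel_def orbit_kernel_def obsv_row[OF A c])
  qed
  finally show "vec_index (Matrix.col (transpose_mat (compound j (obsv j A c))) 0) p =
      vec_index (orbit_minors n j (transpose_mat A) c) p"
    using p dims by (simp add: orbit_minors_def)
qed (use obsv_carrier[OF A, of j c] in \<open>simp add: orbit_minors_def\<close>)

text \<open>Since \<open>A^t P b' = P A'^t b'\<close>, Cauchy--Binet shows that the change of
  coordinates \<open>P\<close> acts on vectors of leading orbit minors through its compound.\<close>

lemma minor_orbit_similar: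
  assumes carr: "A \<in> carrier_mat n n" "A' \<in> carrier_mat n n" "P \<in> carrier_mat n n" "b' \<in> carrier_vec n"
    and AP: "A * P = P * A'"
  shows "minor (orbit_kernel A (P *\<^sub>v b')) j id g =
    (\<Sum>I\<in>set (lex_subsets n j). minor (mat_kernel P) j g ((!) I) * minor (orbit_kernel A' b') j id ((!) I))"
proof -
  have "minor (orbit_kernel A (P *\<^sub>v b')) j id g =
      (\<Sum>I\<in>set (lex_subsets n j). minor (orbit_kernel A' b') j id ((!) I) * minor (\<lambda>l i. mat_kernel P i l) j ((!) I) g)"
  proof (rule minor_cauchy_binet)
    fix a b
    let ?v = "(A' ^\<^sub>m a) *\<^sub>v b'"
    have v: "?v \<in> carrier_vec n" by (rule pow_mat_vec_carrier[OF carr(2,4)])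
    have "vec_index (P *\<^sub>v u) i = (\<Sum>l<n. vec_index u l * P $$ (i, l))"
      if "i < n" "u \<in> carrier_vec n" for i u
      using that carr(3) by (auto simp: scalar_prod_def lessThan_atLeast0 mult.commute)
    note this[OF _ v]
    then show "orbit_kernel A (P *\<^sub>v b') (id a) (g b) = (\<Sum>l<n. orbit_kernel A' b' (id a) l * mat_kernel P (g b) l)"
      using carr pow_mat_intertwine[OF carr(1-3) AP carr(4)]
      by (auto simp: orbit_kernel_def mat_kernel_def)
  qed
  then show ?thesis unfolding minor_transpose[of "mat_kernel P"] by (simp add: mult.commute)
qed

text \<open>The identity is a limit of Gauss kernels, whose minors are positive.\<close>

lemma minor_identity_nonneg:
  assumes "strict_mono_on {..<j} f" "strict_mono_on {..<j} g"
  shows "0 \<le> minor (\<lambda>i l. if i = l then 1 else 0) j f g"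
proof (rule tendsto_lowerbound[OF minor_tendsto])
  show "((\<lambda>\<epsilon>. gauss_kernel \<epsilon> (f a) (g b)) \<longlongrightarrow> (if f a = g b then 1 else 0)) (at_right 0)" for a b
    by (rule gauss_kernel_tendsto)
  show "eventually (\<lambda>\<epsilon>. 0 \<le> minor (gauss_kernel \<epsilon>) j f g) (at_right 0)"
  proof (rule eventually_at_rightI[of 0 "1 / fact j"])
    fix \<epsilon> :: real assume "\<epsilon> \<in> {0<..<1 / fact j}"
    then show "0 \<le> minor (gauss_kernel \<epsilon>) j f g"
      using minor_gauss_kernel_pos[of \<epsilon> j f g] assms by (simp add: field_simps)
  qed simp
qed simp

text \<open>The compound of $P^{-1}$ recovers the coefficients of a vector of the cone of $P_{[j]}$.\<close>

lemma orbit_minors_in_mat_cone_iff: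
  assumes A: "A \<in> carrier_mat n n" "A' \<in> carrier_mat n n" and P: "P \<in> carrier_mat n n" and Q: "Q \<in> carrier_mat n n"
    and b': "b' \<in> carrier_vec n"
    and AP: "A * P = P * A'" and PQ: "P * Q = 1\<^sub>m n" "Q * P = 1\<^sub>m n"
  shows "orbit_minors n j A (P *\<^sub>v b') \<in> mat_cone (compound j P) \<longleftrightarrow>
    (\<forall>J\<in>set (lex_subsets n j). 0 \<le> minor (orbit_kernel A' b') j id ((!) J))"
proof -
  let ?C = "compound j P" and ?L = "lex_subsets n j" and ?N = "n choose j"
  let ?MP = "\<lambda>p q. minor (mat_kernel P) j ((!) (?L ! p)) ((!) (?L ! q))"
    and ?MQ = "\<lambda>p q. minor (mat_kernel Q) j ((!) (?L ! p)) ((!) (?L ! q))"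
  define v where "v = orbit_minors n j A (P *\<^sub>v b')"
  define y where "y q = minor (orbit_kernel A' b') j id ((!) (?L ! q))" for q
  have dimP: "dim_row P = n" "dim_col P = n" using P by auto
  have mult: "vec_index (?C *\<^sub>v x) p = (\<Sum>q<?N. ?MP p q * vec_index x q)"
    if "x \<in> carrier_vec ?N" "p < ?N" for x p
    using that dimP by (auto simp: scalar_prod_def compound_index lessThan_atLeast0)
  have v: "vec_index v p = (\<Sum>q<?N. ?MP p q * y q)" if "p < ?N" for p
    using that minor_orbit_similar[OF A P b' AP, of j "(!) (?L ! p)"]
    by (simp add: v_def orbit_minors_def sum_lex_subsets y_def)
  have AQ: "A' * Q = Q * A"
  proof -
    have "A' * Q = Q * P * A' * Q" using A Q PQ by simp
    also have "\<dots> = Q * (A * P) * Q" using A P Q AP by (simp add: assoc_mult_mat[of _ n n _ n _ n])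
    also have "\<dots> = Q * A" using A P Q PQ by (simp add: assoc_mult_mat[of _ n n _ n _ n])
    finally show ?thesis .
  qed
  have Qb: "Q *\<^sub>v (P *\<^sub>v b') = b'"
    using assoc_mult_mat_vec[OF Q P b'] PQ b' by simp
  have yv: "y q = (\<Sum>p<?N. ?MQ q p * vec_index v p)" for q
    using minor_orbit_similar[OF A(2,1) Q _ AQ, of "P *\<^sub>v b'" j "(!) (?L ! q)"] P b'
    by (simp add: Qb v_def orbit_minors_def sum_lex_subsets y_def)
  \<comment> \<open>The product of the compounds of \<open>Q\<close> and \<open>P\<close> is the
    compound of the identity. Nonnegativity of its entries suffices to pass from nonnegative
    \<open>x\<close> to nonnegative \<open>y\<close>.\<close>
  have id: "0 \<le> (\<Sum>p<?N. ?MQ q p *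
      ?MP p r)" if qr: "q < ?N" "r < ?N" for q r
  proof -
    have I: "strict_mono_on {..<j} ((!) (?L ! q))" "\<And>a. a < j \<Longrightarrow> ?L ! q ! a < n" if "q < ?N" for q
      using lex_subsets_nth[OF that] strict_mono_on_nth[of "?L ! q"] lex_subsets_nth_less[OF that]
      by (auto simp: set_lex_subsets)
    have "minor (\<lambda>i l. if i = l then 1 else 0) j ((!) (?L ! q)) ((!) (?L ! r)) =
        (\<Sum>J\<in>set ?L. minor (mat_kernel Q) j ((!) (?L ! q)) ((!) J) * minor (mat_kernel P) j ((!) J) ((!) (?L ! r)))"
    proof (rule minor_cauchy_binet)
      fix a b assume ab: "a < j" "b < j"
      let ?i = "?L ! q ! a" and ?l = "?L ! r ! b"
      have il: "?i < n" "?l < n" using I(2) qr ab by auto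
      have "(Q * P) $$ (?i, ?l) = (\<Sum>m<n. Q $$ (?i, m) * P $$ (m, ?l))"
        using P Q il by (auto simp: scalar_prod_def lessThan_atLeast0)
      then show "(if ?i = ?l then 1 else 0) = (\<Sum>m<n. mat_kernel Q ?i m * mat_kernel P m ?l)"
        unfolding PQ using il P Q by (simp add: mat_kernel_def)
    qed
    then show ?thesis using minor_identity_nonneg[OF I(1) I(1), OF qr] by (simp add: sum_lex_subsets)
  qed
  have "v \<in> mat_cone ?C \<longleftrightarrow> (\<forall>q<?N. 0 \<le> y q)"
  proof
    assume "v \<in> mat_cone ?C"
    then obtain x where x: "v = ?C *\<^sub>v x" "x \<in> carrier_vec ?N" "\<forall>i<?N. 0 \<le> vec_index x i"
      using dimP by (auto simp: mat_cone_def)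
    show "\<forall>q<?N. 0 \<le> y q"
    proof (intro allI impI)
      fix q assume q: "q < ?N"
      have "y q = (\<Sum>p<?N. \<Sum>r<?N. ?MQ q p *
          (?MP p r * vec_index x r))"
        unfolding yv x(1) by (intro sum.cong) (auto simp: mult[OF x(2)] sum_distrib_left simp del: index_mult_mat_vec)
      also have "\<dots> = (\<Sum>r<?N. (\<Sum>p<?N. ?MQ q p *
          ?MP p r) * vec_index x r)"
        unfolding sum_distrib_right by (subst sum.swap) (simp add: mult.assoc)
      also have "\<dots> \<ge> 0"
      proof (rule sum_nonneg)
        fix r assume "r \<in> {..<?N}"
        then show "0 \<le> (\<Sum>p<?N. ?MQ q p *
          ?MP p r) * vec_index x r"
          using id[OF q, of r] x(3) by (simp add: mult_nonneg_nonneg)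
      qed
      finally show "0 \<le> y q" .
    qed
  next
    assume y: "\<forall>q<?N. 0 \<le> y q"
    have "v = ?C *\<^sub>v Matrix.vec ?N y"
    proof (rule eq_vecI)
      fix p assume "p < dim_vec (?C *\<^sub>v Matrix.vec ?N y)"
      then have p: "p < ?N" using dimP by simp
      show "vec_index v p = vec_index (?C *\<^sub>v Matrix.vec ?N y) p"
        unfolding v[OF p] mult[OF vec_carrier p] by simp
    qed (use dimP in \<open>simp add: v_def orbit_minors_def\<close>)
    then show "v \<in> mat_cone ?C" using y dimP unfolding mat_cone_def by fastforce
  qed
  then show ?thesis by (simp add: ball_set_nth length_lex_subsets v_def y_def)
qed

text \<open>The dual cone is tested on the generators, the columns of the compound. Pairing them
  with the observability minors gives, by Cauchy--Binet for the transposed matrices, the minors in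
  the new coordinates.\<close>

lemma orbit_minors_in_dual_cone_iff:
  assumes A: "A \<in> carrier_mat n n" "A' \<in> carrier_mat n n" and P: "P \<in> carrier_mat n n"
    and c: "c \<in> carrier_vec n" and AP: "A * P = P * A'"
  shows "orbit_minors n j (transpose_mat A) c \<in> dual_cone (n choose j) (mat_cone (compound j P)) \<longleftrightarrow>
    (\<forall>J\<in>set (lex_subsets n j). 0 \<le> minor (orbit_kernel (transpose_mat A') (transpose_mat P *\<^sub>v c)) j id ((!) J))"
proof -
  let ?C = "compound j P" and ?L = "lex_subsets n j" and ?N = "n choose j"
  let ?MP = "\<lambda>p q. minor (mat_kernel P) j ((!) (?L ! p)) ((!) (?L ! q))"
  define w where "w = orbit_minors n j (transpose_mat A) c"
  define y where "y q = minor (orbit_kernel (transpose_mat A') (transpose_mat P *\<^sub>v c)) j id ((!) (?L ! q))" for q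
  have dimP: "dim_row P = n" "dim_col P = n" using P by auto
  have w: "w \<in> carrier_vec ?N" by (simp add: w_def orbit_minors_def)
  have C: "?C \<in> carrier_mat ?N ?N" using dimP by (intro carrier_matI) auto
  have AtPt: "transpose_mat A' * transpose_mat P = transpose_mat P * transpose_mat A"
    using transpose_mult[OF P A(2)] transpose_mult[OF A(1) P] AP by simp
  have y: "y q = (\<Sum>p<?N. ?MP p q * vec_index w p)" for q
    using minor_orbit_similar[of "transpose_mat A'" n "transpose_mat A" "transpose_mat P" c j "(!) (?L ! q)"]
      A P c AtPt
    by (simp add: mat_kernel_transpose minor_transpose[of "mat_kernel P"] w_def orbit_minors_def sum_lex_subsets y_def)
  have prod: "scalar_prod w (?C *\<^sub>v x) = (\<Sum>q<?N. y q * vec_index x q)" if x: "x \<in> carrier_vec ?N" for x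
  proof -
    have "scalar_prod w (?C *\<^sub>v x) = (\<Sum>p<?N. \<Sum>q<?N. vec_index w p * (?C $$ (p, q) * vec_index x q))"
      using w x carrier_matD[OF C]
      by (auto simp: scalar_prod_def sum_distrib_left lessThan_atLeast0 simp del: dim_compound intro!: sum.cong)
    also have "\<dots> = (\<Sum>q<?N. y q * vec_index x q)"
      unfolding y sum_distrib_right
      by (subst sum.swap) (auto simp: compound_index dimP mult_ac intro!: sum.cong)
    finally show ?thesis .
  qed
  have "w \<in> dual_cone ?N (mat_cone ?C) \<longleftrightarrow> (\<forall>q<?N. 0 \<le> y q)"
  proof
    assume dual: "w \<in> dual_cone ?N (mat_cone ?C)"
    show "\<forall>q<?N. 0 \<le> y q"
    proof (intro allI impI)
      fix q assume q: "q < ?N"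
      \<comment> \<open>A unit vector selects one generator of the cone.\<close>
      let ?e = "unit_vec ?N q :: real Matrix.vec"
      have "?C *\<^sub>v ?e \<in> mat_cone ?C" using q dimP unfolding mat_cone_def by fastforce
      then have "0 \<le> scalar_prod w (?C *\<^sub>v ?e)" using dual by (auto simp: dual_cone_def)
      also have "\<dots> = (\<Sum>r<?N. if r = q then y r else 0)"
        unfolding prod[OF unit_vec_carrier] using q by (intro sum.cong) auto
      finally show "0 \<le> y q" using q by simp
    qed
  next
    assume y_nonneg: "\<forall>q<?N. 0 \<le> y q"
    show "w \<in> dual_cone ?N (mat_cone ?C)"
      unfolding dual_cone_def
    proof (intro CollectI conjI ballI)
      fix z assume "z \<in> mat_cone ?C"
      then obtain x where x: "z = ?C *\<^sub>v x" "x \<in> carrier_vec ?N" "\<forall>i<?N. 0 \<le> vec_index x i"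
        using dimP by (auto simp: mat_cone_def)
      show "0 \<le> scalar_prod w z"
        unfolding x(1) prod[OF x(2)] using y_nonneg x(3) by (intro sum_nonneg mult_nonneg_nonneg) auto
    qed (rule w)
  qed
  then show ?thesis by (simp add: ball_set_nth length_lex_subsets w_def y_def)
qed

lemma internally_Hankel_positive_similar_iff:
  assumes A: "A \<in> carrier_mat n n" "A' \<in> carrier_mat n n" and P: "P \<in> carrier_mat n n" and Q: "Q \<in> carrier_mat n n"
    and b': "b' \<in> carrier_vec n" and c: "c \<in> carrier_vec n"
    and AP: "A * P = P * A'" and PQ: "P * Q = 1\<^sub>m n" "Q * P = 1\<^sub>m n"
    and st: "stable A'" and k: "1 \<le> k"
  shows "internally_Hankel_positive k A' b' (transpose_mat P *\<^sub>v c) \<longleftrightarrow>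
    k_positive k A' \<and> (\<forall>j\<in>{1..k}.
      Matrix.col (compound j (ctrb j A (P *\<^sub>v b'))) 0 \<in> mat_cone (compound j P) \<and>
      Matrix.col (transpose_mat (compound j (obsv j A c))) 0 \<in> dual_cone (n choose j) (mat_cone (compound j P)))"
proof -
  have b: "P *\<^sub>v b' \<in> carrier_vec n" and c': "transpose_mat P *\<^sub>v c \<in> carrier_vec n" using P b' c by auto
  have shift: "(\<forall>j\<le>k. \<forall>g. strict_mono g \<longrightarrow> 0 \<le> minor (orbit_kernel M v) j id g) \<longleftrightarrow>
      (\<forall>j\<in>{1..k}. \<forall>J\<in>set (lex_subsets n j). 0 \<le> minor (orbit_kernel M v) j id ((!) J))"
    if "dim_row M = n" for M v
  proof -
    have *: "(\<forall>g. strict_mono g \<longrightarrow> 0 \<le> minor (orbit_kernel M v) j id g) \<longleftrightarrow>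
      (\<forall>J\<in>set (lex_subsets n j). 0 \<le> minor (orbit_kernel M v) j id ((!) J))" for j
      by (rule nonneg_minors_iff_lex_subsets) (simp add: orbit_kernel_def that)
    \<comment> \<open>Order 0 only contributes the empty minor, which is 1.\<close>
    have "(\<forall>j\<le>k. F j) \<longleftrightarrow> (\<forall>j\<in>{1..k}. F j)" if "F 0" for F :: "nat \<Rightarrow> bool"
      using that by (metis atLeastAtMost_iff less_one not_le)
    then show ?thesis unfolding * by (simp add: minor_def)
  qed
  show ?thesis
    unfolding internally_Hankel_positive_iff[OF A(2) b' c' st k] k_positive_iff
      compound_ctrb[OF A(1) b] compound_obsv[OF A(1) c]
      orbit_minors_in_mat_cone_iff[OF A P Q b' AP PQ] orbit_minors_in_dual_cone_iff[OF A P c AP]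
    using shift[of A' b'] shift[of "transpose_mat A'" "transpose_mat P *\<^sub>v c"] A by auto
qed

theorem theorem3p3:
  fixes G :: "complex \<Rightarrow> complex"
    and A :: "real Matrix.mat" and b c :: "real Matrix.vec" and n k :: nat
  assumes "minimal_realization n A b c G"
    and "1 \<le> k" and "k \<le> n"
  shows "(\<exists>m A' b' c'. minimal_realization m A' b' c' G \<and> internally_Hankel_positive k A' b' c')
    \<longleftrightarrow>
    (\<exists>P \<in> carrier_mat n n. \<exists>N \<in> carrier_mat n n.
       vec_space.rank n P = n \<and> k_positive k N \<and> A * P = P * N \<and>
       (\<forall>j \<in> {1..k}.
          Matrix.col (compound j (ctrb j A b)) 0 \<in> mat_cone (compound j P) \<and>
          Matrix.col (transpose_mat (compound j (obsv j A c))) 0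
            \<in> dual_cone (n choose j) (mat_cone (compound j P))))"
    (is "?L \<longleftrightarrow> ?R")
proof
  have A: "A \<in> carrier_mat n n" and b: "b \<in> carrier_vec n" and c: "c \<in> carrier_vec n"
    using assms(1) by (auto simp: minimal_realization_def realization_def)
  {
    assume ?L
    then obtain m A' b' c' where min': "minimal_realization m A' b' c' G"
      and pos: "internally_Hankel_positive k A' b' c'" by blast
    \<comment> \<open>The realization is given with its own dimension \<open>m\<close>; pole
      multiplicities force it to be \<open>n\<close>.\<close>
    have m: "m = n" and kry: "krylov A' c' b' = krylov A c b"
      using minimal_realization_unique[OF assms(1) min'] by auto
    have A': "A' \<in> carrier_mat n n" "b' \<in> carrier_vec n" "c' \<in> carrier_vec n" and st: "stable A'"
      using min' m by (auto simp: minimal_realization_def realization_def)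
    obtain P Q where P: "P \<in> carrier_mat n n" and Q: "Q \<in> carrier_mat n n"
      and PQ: "P * Q = 1\<^sub>m n" "Q * P = 1\<^sub>m n" and AP: "A * P = P * A'"
      and b': "P *\<^sub>v b' = b" and c': "transpose_mat P *\<^sub>v c = c'"
      using similar_if_equal_krylov[OF A b c A' kry hankel_nonsingular[OF assms(1)]] by blast
    have "Determinant.det P * Determinant.det Q = 1" using det_mult[OF P Q] PQ by simp
    then have "vec_space.rank n P = n" using vec_space.det_rank_iff[OF P] by auto
    then show ?R
      using internally_Hankel_positive_similar_iff[OF A A'(1) P Q A'(2) c AP PQ st assms(2)] pos P A'(1) AP
      unfolding b' c' by blast
  next
    assume ?R
    then obtain P N where P: "P \<in> carrier_mat n n" and N: "N \<in> carrier_mat n n"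
      and rank: "vec_space.rank n P = n" and AP: "A * P = P * N"
      and cond: "k_positive k N" "\<forall>j \<in> {1..k}.
          Matrix.col (compound j (ctrb j A b)) 0 \<in> mat_cone (compound j P) \<and>
          Matrix.col (transpose_mat (compound j (obsv j A c))) 0
            \<in> dual_cone (n choose j) (mat_cone (compound j P))" by blast
    have "Determinant.det P \<noteq> 0" using rank vec_space.det_rank_iff[OF P] by blast
    then obtain Q where Q: "Q \<in> carrier_mat n n" and PQ: "P * Q = 1\<^sub>m n" "Q * P = 1\<^sub>m n"
      using mat_inverse_if_det_nonzero[OF P] by metis
    \<comment> \<open>In the coordinates given by \<open>P\<close> the state matrix is
      \<open>N\<close>, so input and output vectors are forced to be the inverse of \<open>P\<close>
      applied to \<open>b\<close> and the transpose of \<open>P\<close> applied to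
      \<open>c\<close>.\<close>
    define b' where "b' = Q *\<^sub>v b"
    have b': "b' \<in> carrier_vec n" "P *\<^sub>v b' = b"
      using Q b assoc_mult_mat_vec[OF P Q b] PQ by (auto simp: b'_def)
    have min': "minimal_realization n N b' (transpose_mat P *\<^sub>v c) G"
      by (rule minimal_realization_similar[OF assms(1) N b'(1) P Q PQ AP b'(2)])
    then have "stable N" by (simp add: minimal_realization_def realization_def)
    then have "internally_Hankel_positive k N b' (transpose_mat P *\<^sub>v c)"
      using internally_Hankel_positive_similar_iff[OF A N P Q b'(1) c AP PQ _ assms(2)] cond
      unfolding b'(2) by blast
    then show ?L using min' by blast
  }
qed

end
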